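(* Let $\mathcal{A}$ be a simple, $\sigma$-unital, non-unital, non-elementary C*-algebra with an approximate identity $\{e_n\}$. Then $\mathcal{A}_+\neq\overline{K_o(\{e_n\})}$ (norm closure) in any of the following cases: (i) $\mathcal{A}$ is separable; (ii) the Cuntz semigroup of $\mathcal{A}$ is order separable; (iii) $\mathcal{A}$ has the (SP) property and its dimension semigroup $D(\mathcal{A})$ of Murray–von Neumann equivalence classes of projections of $\mathcal{A}$ is order separable; (iv) $\mathcal{A}$ has a continuous scale.
   Context: Non-elementary means not isomorphic to the algebra of compact operators on a Hilbert space. Cuntz subequivalence: for positive $a,b$ in a C*-algebra $\mathcal{B}$, $a\preceq b$ means there is a sequence $x_n\in\mathcal{B}$ with $\|x_nbx_n^*-a\|\to 0$ (for projections this is Murray–von Neumann subequivalence). An approximate identity $\{e_n\}_{n\ge1}$ of $\mathcal{A}$ always means a sequential approximate identity of positive contractions, strictly increasing ($0\le e_n\lneqq e_{n+1}$), with $e_{n+1}e_n=e_n$ for all $n$. With $\mathcal{M}(\mathcal{A})$ the multiplier algebra, define $$K_o(\{e_n\}):=\{X\in\mathcal{M}(\mathcal{A})_+ : \forall\, 0\ne a\in\mathcal{A}_+\ \exists N\in\mathbb{N}\ \text{such that}\ m>n\ge N\Rightarrow (e_m-e_n)X(e_m-e_n)\preceq a\}.$$ Property (SP): every nonzero hereditary C*-subalgebra contains a nonzero projection. $D(\mathcal{A})$ is order separable if there is a sequence of nonzero projections $p_n\in\mathcal{A}$ such that for every nonzero projection $p\in\mathcal{A}$ there is an $n$ with $p_n\preceq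 p$. The Cuntz semigroup of $\mathcal{A}$ is order separable if there is a sequence of elements $0\neq s_n\in\mathcal{A}_+$ such that for every $0\ne a\in\mathcal{A}_+$ there is an $n$ with $s_n\preceq a$. $\mathcal{A}$ has continuous scale if for some (equivalently, every) approximate identity $\{e_n\}$ and every $0\neq a\in\mathcal{A}_+$ there is $N$ with $e_m-e_n\preceq a$ for all $m>n\ge N$. *)

theory Defs
  imports "HOL-Analysis.Analysis"
begin

section \<open>C*-algebras\<close>

text \<open>Not necessarily unital. The distribution only knows real normed algebras, so complex scalar
  multiplication is added and tied to the existing real one.\<close>

class cstar_algebra = real_normed_algebra + banach +
  fixes scaleC :: "complex \<Rightarrow> 'a \<Rightarrow> 'a"  (infixr "*\<^sub>C" 75)
    and adj :: "'a \<Rightarrow> 'a"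
  assumes scaleC_add_right: "c *\<^sub>C (x + y) = c *\<^sub>C x + c *\<^sub>C y"
    and scaleC_add_left: "(c + d) *\<^sub>C x = c *\<^sub>C x + d *\<^sub>C x"
    and scaleC_scaleC: "c *\<^sub>C (d *\<^sub>C x) = (c * d) *\<^sub>C x"
    and scaleC_of_real: "complex_of_real r *\<^sub>C x = r *\<^sub>R x"
    and norm_scaleC: "norm (c *\<^sub>C x) = cmod c * norm x"
    and mult_scaleC_left: "(c *\<^sub>C x) * y = c *\<^sub>C (x * y)"
    and mult_scaleC_right: "x * (c *\<^sub>C y) = c *\<^sub>C (x * y)"
    and adj_adj: "adj (adj x) = x"
    and adj_add: "adj (x + y) = adj x + adj y"
    and adj_scaleC: "adj (c *\<^sub>C x) = cnj c *\<^sub>C adj x"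
    and adj_mult: "adj (x * y) = adj y * adj x"
    and norm_adj_mult_self: "norm (adj x * x) = (norm x)\<^sup>2"

context cstar_algebra
begin

definition positive :: "'a \<Rightarrow> bool" where
  "positive a \<longleftrightarrow> (\<exists>b. a = adj b * b)"

definition cstar_le :: "'a \<Rightarrow> 'a \<Rightarrow> bool"  (infix "\<sqsubseteq>\<^sub>+" 50) where
  "a \<sqsubseteq>\<^sub>+ b \<longleftrightarrow> positive (b - a)"

definition projection :: "'a \<Rightarrow> bool" where
  "projection p \<longleftrightarrow> adj p = p \<and> p * p = p"

text \<open>Cuntz subequivalence, meant for positive elements. On projections it is Murray--von Neumann
  subequivalence.\<close>

definition cuntz_le :: "'a \<Rightarrow> 'a \<Rightarrow> bool"  (infix "\<preceq>" 50) where
  "a \<preceq> b \<longleftrightarrow> (\<exists>x :: nat \<Rightarrow> 'a. (\<lambda>n. norm (x n * b * adj (x n) - a)) \<longlonglongrightarrow> 0)"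

text \<open>Approximate identities are sequential, strictly increasing and satisfy
  \<open>e (Suc n) * e n = e n\<close> throughout. The weaker textbook notion is only used in \<open>sigma_unital\<close>.\<close>

definition approximate_identity :: "(nat \<Rightarrow> 'a) \<Rightarrow> bool" where
  "approximate_identity e \<longleftrightarrow>
     (\<forall>n. positive (e n) \<and> norm (e n) \<le> 1) \<and>
     (\<forall>n. e n \<sqsubseteq>\<^sub>+ e (Suc n) \<and> e n \<noteq> e (Suc n)) \<and>
     (\<forall>n. e (Suc n) * e n = e n) \<and>
     (\<forall>a. (\<lambda>n. e n * a) \<longlonglongrightarrow> a \<and> (\<lambda>n. a * e n) \<longlonglongrightarrow> a)"

definition closed_ideal :: "'a set \<Rightarrow> bool" where
  "closed_ideal I \<longleftrightarrow> closed I \<and> 0 \<in> I \<and> (\<forall>x\<in>I. \<forall>y\<in>I. x + y \<in> I) \<and>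
     (\<forall>c. \<forall>x\<in>I. c *\<^sub>C x \<in> I) \<and> (\<forall>a. \<forall>x\<in>I. a * x \<in> I \<and> x * a \<in> I)"

definition cstar_subalgebra :: "'a set \<Rightarrow> bool" where
  "cstar_subalgebra B \<longleftrightarrow> closed B \<and> 0 \<in> B \<and> (\<forall>x\<in>B. \<forall>y\<in>B. x + y \<in> B) \<and>
     (\<forall>c. \<forall>x\<in>B. c *\<^sub>C x \<in> B) \<and> (\<forall>x\<in>B. \<forall>y\<in>B. x * y \<in> B) \<and> (\<forall>x\<in>B. adj x \<in> B)"

definition hereditary_subalgebra :: "'a set \<Rightarrow> bool" where
  "hereditary_subalgebra B \<longleftrightarrow> cstar_subalgebra B \<and>
     (\<forall>a b. positive a \<longrightarrow> b \<in> B \<longrightarrow> a \<sqsubseteq>\<^sub>+ b \<longrightarrow> a \<in> B)"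

end

text \<open>The following are properties of the whole algebra, i.e. of the type.\<close>

definition simple_algebra :: "'a::cstar_algebra itself \<Rightarrow> bool" where
  "simple_algebra _ \<longleftrightarrow> (\<exists>a::'a. a \<noteq> 0) \<and> (\<forall>I::'a set. closed_ideal I \<longrightarrow> I = {0} \<or> I = UNIV)"

definition unital :: "'a::cstar_algebra itself \<Rightarrow> bool" where
  "unital _ \<longleftrightarrow> (\<exists>u::'a. \<forall>a. u * a = a \<and> a * u = a)"

definition sigma_unital :: "'a::cstar_algebra itself \<Rightarrow> bool" where
  "sigma_unital _ \<longleftrightarrow> (\<exists>u :: nat \<Rightarrow> 'a.
     (\<forall>n. positive (u n) \<and> norm (u n) \<le> 1) \<and> (\<forall>n. u n \<sqsubseteq>\<^sub>+ u (Suc n)) \<and>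
     (\<forall>a. (\<lambda>n. u n * a) \<longlonglongrightarrow> a \<and> (\<lambda>n. a * u n) \<longlonglongrightarrow> a))"

definition property_SP :: "'a::cstar_algebra itself \<Rightarrow> bool" where
  "property_SP _ \<longleftrightarrow> (\<forall>B::'a set. hereditary_subalgebra B \<longrightarrow> B \<noteq> {0} \<longrightarrow>
     (\<exists>p\<in>B. projection p \<and> p \<noteq> 0))"

definition dimension_semigroup_order_separable :: "'a::cstar_algebra itself \<Rightarrow> bool" where
  "dimension_semigroup_order_separable _ \<longleftrightarrow> (\<exists>p :: nat \<Rightarrow> 'a.
     (\<forall>n. projection (p n) \<and> p n \<noteq> 0) \<and> (\<forall>q. projection q \<longrightarrow> q \<noteq> 0 \<longrightarrow> (\<exists>n. p n \<preceq> q)))"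

definition cuntz_semigroup_order_separable :: "'a::cstar_algebra itself \<Rightarrow> bool" where
  "cuntz_semigroup_order_separable _ \<longleftrightarrow> (\<exists>s :: nat \<Rightarrow> 'a.
     (\<forall>n. positive (s n) \<and> s n \<noteq> 0) \<and> (\<forall>a. positive a \<longrightarrow> a \<noteq> 0 \<longrightarrow> (\<exists>n. s n \<preceq> a)))"

text \<open>Asking this for some approximate identity is equivalent to asking it for every one.\<close>

definition continuous_scale :: "'a::cstar_algebra itself \<Rightarrow> bool" where
  "continuous_scale _ \<longleftrightarrow> (\<exists>e :: nat \<Rightarrow> 'a. approximate_identity e \<and>
     (\<forall>a. positive a \<longrightarrow> a \<noteq> 0 \<longrightarrow> (\<exists>N. \<forall>m n. m > n \<longrightarrow> n \<ge> N \<longrightarrow> e m - e n \<preceq> a)))"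

lemma norm_adj: "norm (adj x) = norm (x::'a::cstar_algebra)"
proof -
  have "norm y \<le> norm (adj y)" for y :: 'a
  proof (cases "y = 0")
    case False
    have "norm y * norm y \<le> norm (adj y) * norm y"
      using norm_mult_ineq[of "adj y" y] by (simp add: norm_adj_mult_self power2_eq_square)
    then show ?thesis using False by simp
  qed simp
  from this[of x] this[of "adj x"] show ?thesis by (simp add: adj_adj)
qed

lemma adj_scaleR: "adj (r *\<^sub>R x) = r *\<^sub>R adj (x::'a::cstar_algebra)"
  by (metis adj_scaleC scaleC_of_real complex_cnj_complex_of_real)

lemma bounded_linear_adj: "bounded_linear (adj :: 'a::cstar_algebra \<Rightarrow> 'a)"
  by (rule bounded_linear_intro[where K=1]) (auto simp: adj_add adj_scaleR norm_adj)

lemma bounded_linear_scaleC: "bounded_linear (scaleC c :: 'a::cstar_algebra \<Rightarrow> 'a)"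
proof (rule bounded_linear_intro[where K="cmod c"])
  show "c *\<^sub>C (r *\<^sub>R x) = r *\<^sub>R (c *\<^sub>C x)" for r and x :: 'a
    by (simp add: scaleC_of_real[symmetric] scaleC_scaleC mult.commute)
qed (auto simp: scaleC_add_right norm_scaleC mult.commute)

lift_definition adj_conj :: "('a::cstar_algebra \<Rightarrow>\<^sub>L 'a) \<Rightarrow> 'a \<Rightarrow>\<^sub>L 'a"
  is "\<lambda>f a. adj (f (adj a))"
  using bounded_linear_adj bounded_linear_compose by blast

lift_definition scaleC_blinfun :: "complex \<Rightarrow> ('a::cstar_algebra \<Rightarrow>\<^sub>L 'a) \<Rightarrow> 'a \<Rightarrow>\<^sub>L 'a"
  is "\<lambda>c f a. c *\<^sub>C f a"
  using bounded_linear_scaleC bounded_linear_compose by blast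

lift_definition mult_left_blinfun :: "'a::cstar_algebra \<Rightarrow> 'a \<Rightarrow>\<^sub>L 'a" is "\<lambda>a x. a * x"
  by (rule bounded_linear_mult_right)

lift_definition mult_right_blinfun :: "'a::cstar_algebra \<Rightarrow> 'a \<Rightarrow>\<^sub>L 'a" is "\<lambda>a x. x * a"
  by (rule bounded_linear_mult_left)

lemmas blinfun_ops_apply = adj_conj.rep_eq scaleC_blinfun.rep_eq mult_left_blinfun.rep_eq
  mult_right_blinfun.rep_eq

lifting_forget blinfun.lifting


section \<open>The multiplier algebra\<close>

text \<open>Double centralizers \<open>(L, R)\<close>, where \<open>L\<close> stands for left and \<open>R\<close> for right multiplication by
  the multiplier.\<close>

typedef (overloaded) 'a multiplier =
  "{(L, R). (\<forall>c a. blinfun_apply L (c *\<^sub>C a) = c *\<^sub>C blinfun_apply L a) \<and>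
            (\<forall>c a. blinfun_apply R (c *\<^sub>C a) = c *\<^sub>C blinfun_apply R a) \<and>
            (\<forall>a b. blinfun_apply L (a * b) = blinfun_apply L a * b) \<and>
            (\<forall>a b. blinfun_apply R (a * b) = a * blinfun_apply R b) \<and>
            (\<forall>a b. blinfun_apply R a * b = a * blinfun_apply L b)}
     :: (('a::cstar_algebra \<Rightarrow>\<^sub>L 'a) \<times> ('a \<Rightarrow>\<^sub>L 'a)) set"
  by (rule exI[of _ "(0, 0)"]) (simp add: linear_0[OF bounded_linear.linear[OF bounded_linear_scaleC]])

setup_lifting type_definition_multiplier

lift_definition lmul :: "'a::cstar_algebra multiplier \<Rightarrow> 'a \<Rightarrow>\<^sub>L 'a" is fst .
lift_definition rmul :: "'a::cstar_algebra multiplier \<Rightarrow> 'a \<Rightarrow>\<^sub>L 'a" is snd .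

lemma lmul_scaleC: "lmul X (c *\<^sub>C a) = c *\<^sub>C lmul X a"
  and rmul_scaleC: "rmul X (c *\<^sub>C a) = c *\<^sub>C rmul X a"
  and lmul_mult: "lmul X (a * b) = lmul X a * b"
  and rmul_mult: "rmul X (a * b) = a * rmul X b"
  and rmul_lmul: "rmul X a * b = a * lmul X b"
  by (transfer; auto)+

lemma multiplier_eqI:
  "(\<And>a. lmul X a = lmul Y a) \<Longrightarrow> (\<And>a. rmul X a = rmul Y a) \<Longrightarrow> X = Y"
  by transfer (auto intro: blinfun_eqI)

lemma mult_left_cancel_all:
  fixes x y :: "'a::cstar_algebra"
  assumes "\<And>a. a * x = a * y"
  shows "x = y"
proof -
  have "adj (x - y) * (x - y) = 0" using assms by (simp add: right_diff_distrib)
  then have "(norm (x - y))\<^sup>2 = 0" by (metis norm_adj_mult_self norm_zero)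
  then show ?thesis by simp
qed

lemma mult_right_cancel_all:
  fixes x y :: "'a::cstar_algebra"
  assumes "\<And>a. x * a = y * a"
  shows "x = y"
proof -
  have "adj x = adj y"
    by (rule mult_left_cancel_all) (metis adj_adj adj_mult assms)
  then show ?thesis by (metis adj_adj)
qed

text \<open>Each component of a double centralizer determines the other.\<close>

lemma multiplier_eqI_left: "(\<And>a. lmul X a = lmul Y a) \<Longrightarrow> X = Y"
  by (rule multiplier_eqI, simp, rule mult_right_cancel_all) (simp add: rmul_lmul)

lemma norm_rmul: "norm (rmul X) = norm (lmul X)"
proof (rule antisym)
  show "norm (lmul X) \<le> norm (rmul X)"
  proof (rule norm_blinfun_bound)
    fix a
    let ?x = "lmul X a"
    have "norm ?x * norm ?x = norm (rmul X (adj ?x) * a)"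
      by (simp add: rmul_lmul norm_adj_mult_self power2_eq_square)
    also have "\<dots> \<le> norm (rmul X (adj ?x)) * norm a" by (rule norm_mult_ineq)
    also have "\<dots> \<le> (norm (rmul X) * norm ?x) * norm a"
      by (metis mult_right_mono norm_adj norm_blinfun norm_ge_zero)
    finally have "norm ?x * norm ?x \<le> (norm (rmul X) * norm a) * norm ?x" by (simp add: ac_simps)
    then show "norm ?x \<le> norm (rmul X) * norm a"
      by (cases "?x = 0") auto
  qed simp
next
  show "norm (rmul X) \<le> norm (lmul X)"
  proof (rule norm_blinfun_bound)
    fix a
    let ?x = "rmul X a"
    have "norm ?x * norm ?x = norm (adj (adj ?x) * adj ?x)"
      by (simp add: norm_adj_mult_self norm_adj power2_eq_square)
    also have "\<dots> = norm (a * lmul X (adj ?x))"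
      by (simp add: adj_adj rmul_lmul)
    also have "\<dots> \<le> norm a * norm (lmul X (adj ?x))" by (rule norm_mult_ineq)
    also have "\<dots> \<le> norm a * (norm (lmul X) * norm ?x)"
      by (metis mult_left_mono norm_adj norm_blinfun norm_ge_zero)
    finally have "norm ?x * norm ?x \<le> (norm (lmul X) * norm a) * norm ?x" by (simp add: ac_simps)
    then show "norm ?x \<le> norm (lmul X) * norm a"
      by (cases "?x = 0") auto
  qed simp
qed

lemma scaleC_diff_right: "c *\<^sub>C (x - y) = c *\<^sub>C x - c *\<^sub>C (y::'a::cstar_algebra)"
  by (rule linear_diff[OF bounded_linear.linear[OF bounded_linear_scaleC]])

lemma scaleC_zero_right: "c *\<^sub>C 0 = (0::'a::cstar_algebra)"
  by (rule linear_0[OF bounded_linear.linear[OF bounded_linear_scaleC]])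

lemma scaleC_minus_right: "c *\<^sub>C (- x) = - (c *\<^sub>C (x::'a::cstar_algebra))"
  using scaleC_diff_right[of c 0 x] by (simp add: scaleC_zero_right)

lemma scaleC_scaleR: "c *\<^sub>C (r *\<^sub>R x) = r *\<^sub>R (c *\<^sub>C (x::'a::cstar_algebra))"
  by (simp add: scaleC_of_real[symmetric] scaleC_scaleC mult.commute)

lemma adj_swap:
  fixes L R :: "'a::cstar_algebra \<Rightarrow> 'a"
  assumes "\<forall>a b. R a * b = a * L b"
  shows "adj (L (adj a)) * b = a * adj (R (adj b))"
proof -
  have "adj (R (adj b) * adj a) = adj (adj b * L (adj a))" using assms by simp
  then show ?thesis by (simp add: adj_mult adj_adj)
qed

instantiation multiplier :: (cstar_algebra) real_normed_algebra
begin

lift_definition zero_multiplier :: "'a multiplier" is "(0, 0)"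
  by (simp add: scaleC_zero_right)

lift_definition plus_multiplier :: "'a multiplier \<Rightarrow> 'a multiplier \<Rightarrow> 'a multiplier"
  is "\<lambda>(L, R) (L', R'). (L + L', R + R')"
  by (auto simp: blinfun.bilinear_simps scaleC_add_right algebra_simps)

lift_definition minus_multiplier :: "'a multiplier \<Rightarrow> 'a multiplier \<Rightarrow> 'a multiplier"
  is "\<lambda>(L, R) (L', R'). (L - L', R - R')"
  by (auto simp: blinfun.bilinear_simps scaleC_diff_right algebra_simps)

lift_definition uminus_multiplier :: "'a multiplier \<Rightarrow> 'a multiplier"
  is "\<lambda>(L, R). (- L, - R)"
  by (auto simp: blinfun.bilinear_simps scaleC_minus_right)

lift_definition scaleR_multiplier :: "real \<Rightarrow> 'a multiplier \<Rightarrow> 'a multiplier"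
  is "\<lambda>r (L, R). (r *\<^sub>R L, r *\<^sub>R R)"
  by (auto simp: blinfun.bilinear_simps scaleC_scaleR)

lift_definition times_multiplier :: "'a multiplier \<Rightarrow> 'a multiplier \<Rightarrow> 'a multiplier"
  is "\<lambda>(L, R) (L', R'). (L o\<^sub>L L', R' o\<^sub>L R)"
  by auto

definition norm_multiplier :: "'a multiplier \<Rightarrow> real" where
  "norm_multiplier X = norm (lmul X)"

definition dist_multiplier :: "'a multiplier \<Rightarrow> 'a multiplier \<Rightarrow> real" where
  "dist_multiplier X Y = norm (X - Y)"

definition sgn_multiplier :: "'a multiplier \<Rightarrow> 'a multiplier" where
  "sgn_multiplier X = inverse (norm X) *\<^sub>R X"

definition uniformity_multiplier :: "('a multiplier \<times> 'a multiplier) filter" where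
  "uniformity_multiplier = (INF e\<in>{0<..}. principal {(X, Y). dist X Y < e})"

definition open_multiplier :: "'a multiplier set \<Rightarrow> bool" where
  "open_multiplier S \<longleftrightarrow> (\<forall>X\<in>S. \<forall>\<^sub>F (X', Y) in uniformity. X' = X \<longrightarrow> Y \<in> S)"

lemma lmul_ops:
  "lmul (0 :: 'a multiplier) = 0"
  "lmul (X + Y) = lmul X + lmul (Y :: 'a multiplier)"
  "lmul (X - Y) = lmul X - lmul (Y :: 'a multiplier)"
  "lmul (- X) = - lmul (X :: 'a multiplier)"
  "lmul (r *\<^sub>R X) = r *\<^sub>R lmul (X :: 'a multiplier)"
  "lmul (X * Y) = lmul X o\<^sub>L lmul (Y :: 'a multiplier)"
  by (transfer; auto)+

lemma rmul_ops:
  "rmul (X - Y) = rmul X - rmul (Y :: 'a multiplier)"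
  "rmul (X + Y) = rmul X + rmul (Y :: 'a multiplier)"
  "rmul (X * Y) = rmul Y o\<^sub>L rmul (X :: 'a multiplier)"
  by (transfer; auto)+

instance
proof
  fix X Y Z :: "'a multiplier" and r s :: real
  note simps = lmul_ops rmul_ops blinfun.bilinear_simps
  note eqI = multiplier_eqI_left
  show "X + Y + Z = X + (Y + Z)" by (rule eqI) (simp add: simps)
  show "X + Y = Y + X" by (rule eqI) (simp add: simps)
  show "0 + X = X" by (rule eqI) (simp add: simps)
  show "- X + X = 0" by (rule eqI) (simp add: simps)
  show "X - Y = X + - Y" by (rule eqI) (simp add: simps)
  show "r *\<^sub>R (X + Y) = r *\<^sub>R X + r *\<^sub>R Y" by (rule eqI) (simp add: simps scaleR_add_right)
  show "(r + s) *\<^sub>R X = r *\<^sub>R X + s *\<^sub>R X" by (rule eqI) (simp add: simps scaleR_add_left)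
  show "r *\<^sub>R s *\<^sub>R X = (r * s) *\<^sub>R X" by (rule eqI) (simp add: simps)
  show "1 *\<^sub>R X = X" by (rule eqI) (simp add: simps)
  show "X * Y * Z = X * (Y * Z)" by (rule eqI) (simp add: simps)
  show "(X + Y) * Z = X * Z + Y * Z" by (rule eqI) (simp add: simps)
  show "X * (Y + Z) = X * Y + X * Z" by (rule eqI) (simp add: simps)
  show "r *\<^sub>R X * Y = r *\<^sub>R (X * Y)" by (rule eqI) (simp add: simps)
  show "X * r *\<^sub>R Y = r *\<^sub>R (X * Y)" by (rule eqI) (simp add: simps)
  show "dist X Y = norm (X - Y)" by (rule dist_multiplier_def)
  show "sgn X = inverse (norm X) *\<^sub>R X" by (rule sgn_multiplier_def)
  show "(uniformity :: ('a multiplier \<times> 'a multiplier) filter) =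
      (INF e\<in>{0<..}. principal {(X, Y). dist X Y < e})"
    by (rule uniformity_multiplier_def)
  show "open U \<longleftrightarrow> (\<forall>X\<in>U. \<forall>\<^sub>F (X', Y) in uniformity. X' = X \<longrightarrow> Y \<in> U)"
    for U :: "'a multiplier set"
    by (rule open_multiplier_def)
  show "norm X = 0 \<longleftrightarrow> X = 0"
    by (auto simp: norm_multiplier_def lmul_ops intro: eqI)
  show "norm (X + Y) \<le> norm X + norm Y"
    by (simp add: norm_multiplier_def lmul_ops norm_triangle_ineq)
  show "norm (r *\<^sub>R X) = \<bar>r\<bar> * norm X"
    by (simp add: norm_multiplier_def lmul_ops)
  show "norm (X * Y) \<le> norm X * norm Y"
    by (simp add: norm_multiplier_def lmul_ops norm_blinfun_compose)
qed

end

instance multiplier :: (cstar_algebra) banach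
proof
  fix X :: "nat \<Rightarrow> 'a multiplier"
  assume CX: "Cauchy X"
  have distl: "dist (lmul x) (lmul y) = dist x y" for x y :: "'a multiplier"
    by (simp add: dist_norm norm_multiplier_def lmul_ops)
  have distr: "dist (rmul x) (rmul y) = dist x y" for x y :: "'a multiplier"
    by (simp add: dist_norm norm_multiplier_def norm_rmul flip: rmul_ops)
  from CX have "Cauchy (\<lambda>n. lmul (X n))" "Cauchy (\<lambda>n. rmul (X n))"
    by (simp_all add: Cauchy_def distl distr)
  then obtain L R where L: "(\<lambda>n. lmul (X n)) \<longlonglongrightarrow> L" and R: "(\<lambda>n. rmul (X n)) \<longlonglongrightarrow> R"
    by (auto dest!: Cauchy_convergent simp: convergent_def)
  have La: "(\<lambda>n. lmul (X n) a) \<longlonglongrightarrow> L a" and Ra: "(\<lambda>n. rmul (X n) a) \<longlonglongrightarrow> R a" for a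
    by (intro blinfun.tendsto L R tendsto_const)+
  note tendsto_scaleC = bounded_linear.tendsto[OF bounded_linear_scaleC]
  have "L (c *\<^sub>C a) = c *\<^sub>C L a" for c a
    using LIMSEQ_unique[OF La[of "c *\<^sub>C a", unfolded lmul_scaleC] tendsto_scaleC[OF La]] .
  moreover have "R (c *\<^sub>C a) = c *\<^sub>C R a" for c a
    using LIMSEQ_unique[OF Ra[of "c *\<^sub>C a", unfolded rmul_scaleC] tendsto_scaleC[OF Ra]] .
  moreover have "L (a * b) = L a * b" for a b
    using LIMSEQ_unique[OF La[of "a * b", unfolded lmul_mult] tendsto_mult[OF La tendsto_const]] .
  moreover have "R (a * b) = a * R b" for a b
    using LIMSEQ_unique[OF Ra[of "a * b", unfolded rmul_mult] tendsto_mult[OF tendsto_const Ra]] .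
  moreover have "R a * b = a * L b" for a b
    using LIMSEQ_unique[OF tendsto_mult[OF Ra tendsto_const, unfolded rmul_lmul]
        tendsto_mult[OF tendsto_const La]] .
  ultimately obtain Y where Y: "lmul Y = L"
    using lmul.rep_eq[of "Abs_multiplier (L, R)"] by (subst (asm) Abs_multiplier_inverse) auto
  have "X \<longlonglongrightarrow> Y"
    using L by (simp add: tendsto_iff distl flip: Y)
  then show "convergent X" by (auto simp: convergent_def)
qed

instantiation multiplier :: (cstar_algebra) cstar_algebra
begin

lift_definition scaleC_multiplier :: "complex \<Rightarrow> 'a multiplier \<Rightarrow> 'a multiplier"
  is "\<lambda>c (L, R). (scaleC_blinfun c L, scaleC_blinfun c R)"
  by (auto simp: blinfun_ops_apply scaleC_scaleC mult.commute mult_scaleC_left mult_scaleC_right)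

lift_definition adj_multiplier :: "'a multiplier \<Rightarrow> 'a multiplier"
  is "\<lambda>(L, R). (adj_conj R, adj_conj L)"
  by (auto simp: blinfun_ops_apply adj_scaleC adj_mult adj_adj) (rule adj_swap, simp)

lemma multiplier_cstar_ops:
  "lmul (c *\<^sub>C X) = scaleC_blinfun c (lmul (X :: 'a multiplier))"
  "rmul (c *\<^sub>C X) = scaleC_blinfun c (rmul (X :: 'a multiplier))"
  "lmul (adj X) = adj_conj (rmul (X :: 'a multiplier))"
  "rmul (adj X) = adj_conj (lmul (X :: 'a multiplier))"
  by (transfer; auto)+

instance
proof
  fix X Y :: "'a multiplier" and r :: real and c d :: complex
  note simps = lmul_ops rmul_ops multiplier_cstar_ops blinfun_ops_apply blinfun.bilinear_simps
  note eqI = multiplier_eqI_left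
  show "c *\<^sub>C (X + Y) = c *\<^sub>C X + c *\<^sub>C Y" by (rule eqI) (simp add: simps scaleC_add_right)
  show "(c + d) *\<^sub>C X = c *\<^sub>C X + d *\<^sub>C X" by (rule eqI) (simp add: simps scaleC_add_left)
  show "c *\<^sub>C d *\<^sub>C X = (c * d) *\<^sub>C X" by (rule eqI) (simp add: simps scaleC_scaleC)
  show "complex_of_real r *\<^sub>C X = r *\<^sub>R X" by (rule eqI) (simp add: simps scaleC_of_real)
  show "c *\<^sub>C X * Y = c *\<^sub>C (X * Y)" by (rule eqI) (simp add: simps)
  show "X * c *\<^sub>C Y = c *\<^sub>C (X * Y)" by (rule eqI) (simp add: simps lmul_scaleC)
  show "adj (adj X) = X" by (rule eqI) (simp add: simps adj_adj)
  show "adj (X * Y) = adj Y * adj X" by (rule eqI) (simp add: simps adj_adj)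
  show "adj (c *\<^sub>C X) = cnj c *\<^sub>C adj X" by (rule eqI) (simp add: simps adj_scaleC)
  show "adj (X + Y) = adj X + adj Y"
    by (rule eqI) (simp add: simps adj_add)
  show "norm (c *\<^sub>C X) = cmod c * norm X"
  proof -
    have le: "norm (c *\<^sub>C X) \<le> cmod c * norm X" for c and X :: "'a multiplier"
      unfolding norm_multiplier_def multiplier_cstar_ops
      by (rule norm_blinfun_bound)
        (auto simp: blinfun_ops_apply norm_scaleC mult.assoc intro!: mult_left_mono norm_blinfun)
    show ?thesis
    proof (cases "c = 0")
      case True
      then show ?thesis using le[of c X] by (simp add: norm_multiplier_def)
    next
      case False
      have "inverse c *\<^sub>C (c *\<^sub>C X) = X"
      proof (rule eqI)
        have "1 *\<^sub>C x = x" for x :: 'a using scaleC_of_real[of 1 x] by simp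
        then show "lmul (inverse c *\<^sub>C (c *\<^sub>C X)) a = lmul X a" for a
          using False by (simp add: simps scaleC_scaleC)
      qed
      then have "norm X \<le> inverse (cmod c) * norm (c *\<^sub>C X)"
        using le[of "inverse c" "c *\<^sub>C X"] by (simp add: norm_inverse)
      then have "cmod c * norm X \<le> norm (c *\<^sub>C X)"
        using False by (simp add: field_simps)
      then show ?thesis using le[of c X] by simp
    qed
  qed
  show "norm (adj X * X) = (norm X)\<^sup>2"
  proof (rule antisym)
    have nadj: "norm (adj_conj f) \<le> norm f" for f :: "'a \<Rightarrow>\<^sub>L 'a"
      by (rule norm_blinfun_bound)
        (auto simp: blinfun_ops_apply norm_adj intro: order_trans[OF norm_blinfun])
    have "norm (adj X * X) \<le> norm (adj X) * norm X"
      by (simp add: norm_multiplier_def lmul_ops norm_blinfun_compose)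
    also have "norm (adj X) \<le> norm X"
      using nadj[of "rmul X"] by (simp add: norm_multiplier_def multiplier_cstar_ops norm_rmul)
    finally show "norm (adj X * X) \<le> (norm X)\<^sup>2"
      by (simp add: power2_eq_square mult_right_mono norm_multiplier_def)
    have "norm (lmul X) \<le> sqrt (norm (adj X * X))"
    proof (rule norm_blinfun_bound)
      fix a
      let ?x = "lmul X a"
      have "adj ?x * ?x = adj (lmul (adj X * X) a) * a"
        by (simp add: simps adj_adj rmul_lmul)
      then have "(norm ?x)\<^sup>2 = norm (adj (lmul (adj X * X) a) * a)"
        by (metis norm_adj_mult_self)
      also have "\<dots> \<le> norm (lmul (adj X * X) a) * norm a"
        by (metis norm_adj norm_mult_ineq)
      also have "\<dots> \<le> (norm (adj X * X) * norm a) * norm a"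
        unfolding norm_multiplier_def by (intro mult_right_mono norm_blinfun) auto
      also have "\<dots> = (sqrt (norm (adj X * X)) * norm a)\<^sup>2"
        by (simp add: power2_eq_square norm_multiplier_def)
      finally show "norm ?x \<le> sqrt (norm (adj X * X)) * norm a"
        by (rule power2_le_imp_le) (simp add: norm_multiplier_def)
    qed (simp add: norm_multiplier_def)
    then have "(norm X)\<^sup>2 \<le> (sqrt (norm (adj X * X)))\<^sup>2"
      by (intro power_mono) (auto simp: norm_multiplier_def)
    then show "(norm X)\<^sup>2 \<le> norm (adj X * X)" by (simp add: norm_multiplier_def)
  qed
qed

end

lift_definition multiplier_of :: "'a::cstar_algebra \<Rightarrow> 'a multiplier"
  is "\<lambda>a. (mult_left_blinfun a, mult_right_blinfun a)"
  by (auto simp: blinfun_ops_apply mult_scaleC_left mult_scaleC_right mult.assoc)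

lemma lmul_multiplier_of: "lmul (multiplier_of a) x = a * x"
  by (simp add: lmul.rep_eq multiplier_of.rep_eq blinfun_ops_apply)

lemma rmul_multiplier_of: "rmul (multiplier_of a) x = x * a"
  by (simp add: rmul.rep_eq multiplier_of.rep_eq blinfun_ops_apply)

lemma multiplier_of_hom:
  "multiplier_of (a + b) = multiplier_of a + multiplier_of b"
  "multiplier_of (a * b) = multiplier_of a * multiplier_of b"
  "multiplier_of (c *\<^sub>C a) = c *\<^sub>C multiplier_of a"
  "multiplier_of (adj a) = adj (multiplier_of a)"
  by (rule multiplier_eqI_left; simp add: lmul_multiplier_of rmul_multiplier_of lmul_ops
      multiplier_cstar_ops blinfun_ops_apply blinfun.bilinear_simps distrib_right mult.assoc
      mult_scaleC_left adj_mult adj_adj)+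

lemma norm_multiplier_of: "norm (multiplier_of a) = norm a"
proof -
  have "norm (lmul (multiplier_of a)) = norm a"
  proof (rule antisym)
    show "norm (lmul (multiplier_of a)) \<le> norm a"
      by (rule norm_blinfun_bound) (auto simp: lmul_multiplier_of norm_mult_ineq)
    have "norm a * norm a \<le> norm (lmul (multiplier_of a)) * norm a"
      using norm_adj_mult_self[of "adj a"] norm_blinfun[of "lmul (multiplier_of a)" "adj a"]
      by (simp add: lmul_multiplier_of adj_adj norm_adj power2_eq_square)
    then show "norm a \<le> norm (lmul (multiplier_of a))"
      by (cases "a = 0") auto
  qed
  then show ?thesis by (simp add: norm_multiplier_def)
qed

text \<open>The algebra is an ideal of its multiplier algebra. In particular the element \<open>a X b\<close> with
  \<open>a, b\<close> in the algebra and \<open>X\<close> a multiplier lies in the algebra and is represented there by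
  \<open>a * lmul X b\<close>.\<close>

lemma multiplier_of_ideal:
  "X * multiplier_of b = multiplier_of (lmul X b)"
  "multiplier_of a * X = multiplier_of (rmul X a)"
  "multiplier_of a * X * multiplier_of b = multiplier_of (a * lmul X b)"
  by (rule multiplier_eqI_left; simp add: lmul_multiplier_of lmul_ops lmul_mult rmul_lmul mult.assoc)+

definition K_o :: "(nat \<Rightarrow> 'a::cstar_algebra) \<Rightarrow> 'a multiplier set" where
  "K_o e = {X. positive X \<and> (\<forall>a. positive a \<longrightarrow> a \<noteq> 0 \<longrightarrow>
     (\<exists>N. \<forall>m n. m > n \<longrightarrow> n \<ge> N \<longrightarrow> (e m - e n) * lmul X (e m - e n) \<preceq> a))}"


section \<open>Elementary C*-algebras\<close>

text \<open>Hilbert spaces with an explicit carrier, because the definition of an elementary algebra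
  quantifies over Hilbert spaces inside a formula. The inner product is linear in its first
  argument.\<close>

record 'h hilbert =
  hcarrier :: "'h set"
  hzero :: 'h
  hadd :: "'h \<Rightarrow> 'h \<Rightarrow> 'h"
  hscale :: "complex \<Rightarrow> 'h \<Rightarrow> 'h"
  hinner :: "'h \<Rightarrow> 'h \<Rightarrow> complex"

definition hnorm :: "'h hilbert \<Rightarrow> 'h \<Rightarrow> real" where
  "hnorm H x = sqrt (Re (hinner H x x))"

text \<open>The value outside the carrier is irrelevant but the locale \<open>Metric_space\<close> wants a symmetric
  nonnegative function on the whole type.\<close>

definition hdist :: "'h hilbert \<Rightarrow> 'h \<Rightarrow> 'h \<Rightarrow> real" where
  "hdist H x y = (if x \<in> hcarrier H \<and> y \<in> hcarrier H
                  then hnorm H (hadd H x (hscale H (-1) y)) else 0)"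

abbreviation htopology :: "'h hilbert \<Rightarrow> 'h topology" where
  "htopology H \<equiv> Metric_space.mtopology (hcarrier H) (hdist H)"

locale hilbert_space =
  fixes H :: "'h hilbert"
  assumes zero_closed: "hzero H \<in> hcarrier H"
    and add_closed: "\<lbrakk>x \<in> hcarrier H; y \<in> hcarrier H\<rbrakk> \<Longrightarrow> hadd H x y \<in> hcarrier H"
    and scale_closed: "x \<in> hcarrier H \<Longrightarrow> hscale H c x \<in> hcarrier H"
    and add_assoc: "\<lbrakk>x \<in> hcarrier H; y \<in> hcarrier H; z \<in> hcarrier H\<rbrakk> \<Longrightarrow>
      hadd H (hadd H x y) z = hadd H x (hadd H y z)"
    and add_commute: "\<lbrakk>x \<in> hcarrier H; y \<in> hcarrier H\<rbrakk> \<Longrightarrow> hadd H x y = hadd H y x"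
    and add_zero: "x \<in> hcarrier H \<Longrightarrow> hadd H (hzero H) x = x"
    and add_inverse: "x \<in> hcarrier H \<Longrightarrow> \<exists>y\<in>hcarrier H. hadd H x y = hzero H"
    and scale_add_right: "\<lbrakk>x \<in> hcarrier H; y \<in> hcarrier H\<rbrakk> \<Longrightarrow>
      hscale H c (hadd H x y) = hadd H (hscale H c x) (hscale H c y)"
    and scale_add_left: "x \<in> hcarrier H \<Longrightarrow>
      hscale H (c + d) x = hadd H (hscale H c x) (hscale H d x)"
    and scale_scale: "x \<in> hcarrier H \<Longrightarrow> hscale H c (hscale H d x) = hscale H (c * d) x"
    and scale_one: "x \<in> hcarrier H \<Longrightarrow> hscale H 1 x = x"
    and inner_add_left: "\<lbrakk>x \<in> hcarrier H; y \<in> hcarrier H; z \<in> hcarrier H\<rbrakk> \<Longrightarrow>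
      hinner H (hadd H x y) z = hinner H x z + hinner H y z"
    and inner_scale_left: "\<lbrakk>x \<in> hcarrier H; y \<in> hcarrier H\<rbrakk> \<Longrightarrow>
      hinner H (hscale H c x) y = c * hinner H x y"
    and inner_commute: "\<lbrakk>x \<in> hcarrier H; y \<in> hcarrier H\<rbrakk> \<Longrightarrow> hinner H x y = cnj (hinner H y x)"
    and inner_nonneg: "x \<in> hcarrier H \<Longrightarrow> 0 \<le> Re (hinner H x x)"
    and inner_eq_zeroD: "\<lbrakk>x \<in> hcarrier H; hinner H x x = 0\<rbrakk> \<Longrightarrow> x = hzero H"
    and complete: "Metric_space.mcomplete (hcarrier H) (hdist H)"

text \<open>Operators are normalised to \<open>undefined\<close> outside the carrier, so that equality of functions
  is equality of operators. A linear map with relatively compact image of the closed unit ball is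
  automatically bounded.\<close>

definition compact_operators :: "'h hilbert \<Rightarrow> ('h \<Rightarrow> 'h) set" where
  "compact_operators H = {T \<in> hcarrier H \<rightarrow>\<^sub>E hcarrier H.
     (\<forall>x\<in>hcarrier H. \<forall>y\<in>hcarrier H. T (hadd H x y) = hadd H (T x) (T y)) \<and>
     (\<forall>c. \<forall>x\<in>hcarrier H. T (hscale H c x) = hscale H c (T x)) \<and>
     compactin (htopology H) (htopology H closure_of (T ` {x \<in> hcarrier H. hnorm H x \<le> 1}))}"

definition compact_operators_iso :: "'h hilbert \<Rightarrow> ('a::cstar_algebra \<Rightarrow> 'h \<Rightarrow> 'h) \<Rightarrow> bool" where
  "compact_operators_iso H \<phi> \<longleftrightarrow> bij_betw \<phi> UNIV (compact_operators H) \<and>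
     (\<forall>a b. \<forall>x\<in>hcarrier H. \<phi> (a + b) x = hadd H (\<phi> a x) (\<phi> b x)) \<and>
     (\<forall>c a. \<forall>x\<in>hcarrier H. \<phi> (c *\<^sub>C a) x = hscale H c (\<phi> a x)) \<and>
     (\<forall>a b. \<forall>x\<in>hcarrier H. \<phi> (a * b) x = \<phi> a (\<phi> b x)) \<and>
     (\<forall>a. \<forall>x\<in>hcarrier H. \<forall>y\<in>hcarrier H. hinner H (\<phi> (adj a) x) y = hinner H x (\<phi> a y))"

text \<open>Isomorphic to the compact operators on some Hilbert space. It is enough to look at Hilbert
  spaces with elements from \<open>'a\<close>: if the algebra is isomorphic to the compact operators on a Hilbert
  space over any other type, the rank one operators \<open>x \<mapsto> \<langle>x, u\<rangle> h\<close> for a fixed unit vector \<open>u\<close> embed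
  that space into \<open>'a\<close>. See \<open>elementaryI\<close> below.\<close>

definition elementary :: "'a::cstar_algebra itself \<Rightarrow> bool" where
  "elementary _ \<longleftrightarrow> (\<exists>(H :: 'a hilbert) (\<phi> :: 'a \<Rightarrow> 'a \<Rightarrow> 'a).
     hilbert_space H \<and> compact_operators_iso H \<phi>)"

context hilbert_space
begin

lemma inner_add_right: "\<lbrakk>x \<in> hcarrier H; y \<in> hcarrier H; z \<in> hcarrier H\<rbrakk> \<Longrightarrow>
      hinner H z (hadd H x y) = hinner H z x + hinner H z y"
  by (metis add_closed complex_cnj_add inner_add_left inner_commute)

lemma inner_scale_right: "\<lbrakk>x \<in> hcarrier H; y \<in> hcarrier H\<rbrakk> \<Longrightarrow>
      hinner H x (hscale H c y) = cnj c * hinner H x y"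
  by (metis complex_cnj_mult inner_commute inner_scale_left scale_closed)

lemmas inner_simps = inner_add_left inner_add_right inner_scale_left inner_scale_right
  add_closed scale_closed

lemma Re_inner_commute: "\<lbrakk>x \<in> hcarrier H; y \<in> hcarrier H\<rbrakk> \<Longrightarrow> Re (hinner H x y) = Re (hinner H y x)"
  by (subst inner_commute) auto

lemma inner_self_real: "x \<in> hcarrier H \<Longrightarrow> hinner H x x = complex_of_real (Re (hinner H x x))"
  by (metis Reals_cnj_iff inner_commute of_real_Re)

lemma hnorm_eq_zeroD: "\<lbrakk>x \<in> hcarrier H; hnorm H x = 0\<rbrakk> \<Longrightarrow> x = hzero H"
  using inner_self_real[of x] inner_eq_zeroD[of x] by (simp add: hnorm_def)

lemma hnorm_nonneg: "x \<in> hcarrier H \<Longrightarrow> 0 \<le> hnorm H x"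
  by (simp add: hnorm_def inner_nonneg)

lemma hnorm_power2: "x \<in> hcarrier H \<Longrightarrow> (hnorm H x)\<^sup>2 = Re (hinner H x x)"
  by (simp add: hnorm_def inner_nonneg)

lemma hnorm_scale: "x \<in> hcarrier H \<Longrightarrow> hnorm H (hscale H c x) = cmod c * hnorm H x"
proof -
  assume x: "x \<in> hcarrier H"
  have "hinner H (hscale H c x) (hscale H c x) = complex_of_real ((cmod c)\<^sup>2) * hinner H x x"
    unfolding complex_norm_square using x by (simp add: inner_simps)
  then have "Re (hinner H (hscale H c x) (hscale H c x)) = (cmod c)\<^sup>2 * Re (hinner H x x)"
    by simp
  then show ?thesis by (simp add: hnorm_def real_sqrt_mult)
qed

lemma Re_inner_le:
  assumes x: "x \<in> hcarrier H" and y: "y \<in> hcarrier H"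
  shows "Re (hinner H x y) \<le> hnorm H x * hnorm H y"
proof (cases "hnorm H x = 0 \<or> hnorm H y = 0")
  case True
  have z: "hinner H z (hzero H) = 0 \<and> hinner H (hzero H) z = 0" if "z \<in> hcarrier H" for z
    by (metis add_cancel_right_left add_zero inner_add_left inner_commute complex_cnj_zero that zero_closed)
  from True show ?thesis using hnorm_eq_zeroD x y z by fastforce
next
  case False
  let ?a = "hnorm H x" and ?b = "hnorm H y"
  have pos: "?a > 0" "?b > 0" using False hnorm_nonneg[OF x] hnorm_nonneg[OF y] by auto
  let ?v = "hadd H (hscale H (of_real ?b) x) (hscale H (of_real (- ?a)) y)"
  have "0 \<le> Re (hinner H ?v ?v)" using x y by (intro inner_nonneg) (simp add: inner_simps)
  also have "Re (hinner H ?v ?v) = ?b\<^sup>2 * Re (hinner H x x) + ?a\<^sup>2 * Re (hinner H y y)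
      - 2 * ?a * ?b * Re (hinner H x y)"
    using x y Re_inner_commute[OF y x] by (simp add: inner_simps power2_eq_square algebra_simps)
  also have "\<dots> = 2 * (?a * ?b) * (?a * ?b - Re (hinner H x y))"
    using x y by (simp add: hnorm_power2[symmetric] power2_eq_square algebra_simps)
  finally show ?thesis using mult_pos_pos[OF pos] by (auto simp: zero_le_mult_iff)
qed

lemma hnorm_triangle:
  assumes x: "x \<in> hcarrier H" and y: "y \<in> hcarrier H"
  shows "hnorm H (hadd H x y) \<le> hnorm H x + hnorm H y"
proof -
  have "(hnorm H (hadd H x y))\<^sup>2 = (hnorm H x)\<^sup>2 + (hnorm H y)\<^sup>2 + 2 * Re (hinner H x y)"
    using x y Re_inner_commute[OF y x] by (simp add: hnorm_power2 inner_simps)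
  also have "\<dots> \<le> (hnorm H x + hnorm H y)\<^sup>2"
    using Re_inner_le[OF x y] by (simp add: power2_sum)
  finally show ?thesis
    using hnorm_nonneg x y by (meson add_nonneg_nonneg power2_le_imp_le)
qed

lemma scale_minus_one: "y \<in> hcarrier H \<Longrightarrow> hadd H y (hscale H (-1) y) = hzero H"
  using scale_add_left[of y 1 "-1"] hnorm_scale[of y 0] scale_closed[of y 0]
  by (simp add: scale_one hnorm_eq_zeroD)

lemma Metric_space_hilbert: "Metric_space (hcarrier H) (hdist H)"
proof
  let ?m = "\<lambda>x y. hadd H x (hscale H (-1) y)"
  show "0 \<le> hdist H x y" for x y
    by (simp add: hdist_def hnorm_nonneg inner_simps)
  show "hdist H x y = hdist H y x" for x y
    by (auto simp: hdist_def hnorm_def inner_simps)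
  show "hdist H x y = 0 \<longleftrightarrow> x = y" if x: "x \<in> hcarrier H" and y: "y \<in> hcarrier H" for x y
  proof
    assume "hdist H x y = 0"
    then have *: "?m x y = hzero H" using x y by (simp add: hdist_def hnorm_eq_zeroD inner_simps)
    have "x = hadd H x (?m y y)"
      using x y by (metis add_commute add_zero scale_minus_one zero_closed)
    also have "\<dots> = hadd H y (?m x y)"
      using x y by (metis add_assoc add_commute scale_closed)
    also have "\<dots> = y" using y by (metis * add_commute add_zero zero_closed)
    finally show "x = y" .
  next
    assume "x = y"
    then show "hdist H x y = 0" using y
      by (simp add: hdist_def hnorm_def inner_simps)
  qed
  show "hdist H x z \<le> hdist H x y + hdist H y z"
    if "x \<in> hcarrier H" "y \<in> hcarrier H" "z \<in> hcarrier H" for x y z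
  proof -
    have "hnorm H (?m x z) = hnorm H (hadd H (?m x y) (?m y z))"
      using that by (simp add: hnorm_def inner_simps)
    also have "\<dots> \<le> hnorm H (?m x y) + hnorm H (?m y z)"
      using that by (intro hnorm_triangle) (simp_all add: inner_simps)
    finally show ?thesis using that by (simp add: hdist_def)
  qed
qed

lemma cmod_inner_le:
  assumes x: "x \<in> hcarrier H" and y: "y \<in> hcarrier H"
  shows "cmod (hinner H x y) \<le> hnorm H x * hnorm H y"
proof (cases "hinner H x y = 0")
  case True
  then show ?thesis using hnorm_nonneg x y by simp
next
  case False
  let ?c = "cnj (sgn (hinner H x y))"
  have c: "cmod ?c = 1" using False by (simp add: norm_sgn)
  have "?c * hinner H x y = cmod (hinner H x y)"
    using False by (simp add: sgn_eq complex_norm_square[symmetric] power2_eq_square field_simps)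
  then have "cmod (hinner H x y) = Re (hinner H (hscale H ?c x) y)"
    using x y by (simp add: inner_simps)
  also have "\<dots> \<le> hnorm H (hscale H ?c x) * hnorm H y"
    using x y by (intro Re_inner_le) (simp_all add: inner_simps)
  finally show ?thesis using x c by (simp add: hnorm_scale)
qed

lemma rank_one_compact:
  assumes u: "u \<in> hcarrier H" "hnorm H u = 1" and h: "h \<in> hcarrier H"
  shows "(\<lambda>x\<in>hcarrier H. hscale H (hinner H x u) h) \<in> compact_operators H" (is "?T \<in> _")
proof -
  interpret M: Metric_space "hcarrier H" "hdist H" by (rule Metric_space_hilbert)
  let ?g = "\<lambda>c. hscale H c h"
  have d: "hdist H (?g c) (?g d) = cmod (c - d) * hnorm H h" for c d
  proof -
    have "hadd H (?g c) (hscale H (-1) (?g d)) = hscale H (c - d) h"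
      using h by (simp add: scale_scale flip: scale_add_left)
    then show ?thesis using h by (simp add: hdist_def scale_closed hnorm_scale)
  qed
  have "continuous_map euclidean (htopology H) ?g"
    unfolding M.continuous_map_to_metric
  proof (intro ballI allI impI)
    fix c :: complex and \<epsilon> :: real
    assume e: "\<epsilon> > 0"
    have n: "hnorm H h \<ge> 0" using h by (rule hnorm_nonneg)
    let ?U = "ball c (\<epsilon> / (hnorm H h + 1))"
    have "?g y \<in> M.mball (?g c) \<epsilon>" if "y \<in> ?U" for y :: complex
    proof -
      have "cmod (c - y) * hnorm H h \<le> cmod (c - y) * (hnorm H h + 1)"
        by (simp add: mult_left_mono)
      also have "\<dots> < \<epsilon>" using that n by (simp add: dist_norm field_simps)
      finally show ?thesis using h by (simp add: d scale_closed)
    qed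
    then show "\<exists>U. openin euclidean U \<and> c \<in> U \<and> (\<forall>y\<in>U. ?g y \<in> M.mball (?g c) \<epsilon>)"
      using e n by (intro exI[of _ ?U]) auto
  qed
  then have cpt: "compactin (htopology H) (?g ` cball 0 1)"
    by (intro image_compactin) auto
  have "?T ` {x \<in> hcarrier H. hnorm H x \<le> 1} \<subseteq> ?g ` cball 0 1"
    using cmod_inner_le[OF _ u(1)] u(2) by (fastforce intro!: imageI)
  then have "htopology H closure_of (?T ` {x \<in> hcarrier H. hnorm H x \<le> 1}) \<subseteq> ?g ` cball 0 1"
    using compactin_imp_closedin[OF M.Hausdorff_space_mtopology cpt] by (rule closure_of_minimal)
  then have "compactin (htopology H) (htopology H closure_of (?T ` {x \<in> hcarrier H. hnorm H x \<le> 1}))"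
    using cpt closed_compactin closedin_closure_of by blast
  then show ?thesis
    using u h by (auto simp: compact_operators_def inner_simps scale_add_left scale_scale)
qed

end

lemma compact_operators_transport:
  fixes H :: "'h hilbert" and K :: "'k hilbert"
  assumes H: "hilbert_space H" and K: "hilbert_space K"
    and bij: "bij_betw f (hcarrier H) (hcarrier K)"
    and g: "\<And>x. x \<in> hcarrier H \<Longrightarrow> g (f x) = x" "\<And>y. y \<in> hcarrier K \<Longrightarrow> f (g y) = y"
    and add: "\<And>x y. \<lbrakk>x \<in> hcarrier H; y \<in> hcarrier H\<rbrakk> \<Longrightarrow> f (hadd H x y) = hadd K (f x) (f y)"
    and scale: "\<And>c x. x \<in> hcarrier H \<Longrightarrow> f (hscale H c x) = hscale K c (f x)"
    and inner: "\<And>x y. \<lbrakk>x \<in> hcarrier H; y \<in> hcarrier H\<rbrakk> \<Longrightarrow> hinner K (f x) (f y) = hinner H x y"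
    and T: "T \<in> compact_operators H"
  shows "(\<lambda>y\<in>hcarrier K. f (T (g y))) \<in> compact_operators K" (is "?S \<in> _")
proof -
  interpret H: hilbert_space H by fact
  interpret K: hilbert_space K by fact
  interpret Metric_space12 "hcarrier H" "hdist H" "hcarrier K" "hdist K"
    by (intro Metric_space12.intro H.Metric_space_hilbert K.Metric_space_hilbert)
  have f: "f x \<in> hcarrier K" if "x \<in> hcarrier H" for x using bij that by (auto simp: bij_betw_def)
  have gc: "g y \<in> hcarrier H" if "y \<in> hcarrier K" for y
    using bij g(1) that by (metis bij_betw_imp_surj_on imageE)
  have Tc: "T x \<in> hcarrier H" if "x \<in> hcarrier H" for x
    using T that by (auto simp: compact_operators_def)
  have nm: "hnorm K (f x) = hnorm H x" if "x \<in> hcarrier H" for x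
    using that by (simp add: hnorm_def inner)
  have "hdist K (f x) (f y) = hdist H x y" if "x \<in> hcarrier H" "y \<in> hcarrier H" for x y
    using that f nm by (simp add: hdist_def H.scale_closed H.add_closed flip: add scale)
  then have hom: "homeomorphic_map (htopology H) (htopology K) f"
    using bij by (intro isometry_imp_homeomorphic_map) (auto simp: bij_betw_def)
  have "{y \<in> hcarrier K. hnorm K y \<le> 1} = f ` {x \<in> hcarrier H. hnorm H x \<le> 1}"
    using f nm g gc by (auto simp: image_iff) metis
  then have im: "?S ` {y \<in> hcarrier K. hnorm K y \<le> 1} = f ` (T ` {x \<in> hcarrier H. hnorm H x \<le> 1})"
    using image_cong[OF refl, of "{x \<in> hcarrier H. hnorm H x \<le> 1}" "\<lambda>x. ?S (f x)" "\<lambda>x. f (T x)"] f g(1)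
    by (simp only: image_image) auto
  have sub: "T ` {x \<in> hcarrier H. hnorm H x \<le> 1} \<subseteq> topspace (htopology H)"
    using Tc by auto
  have "compactin (htopology K) (htopology K closure_of (?S ` {y \<in> hcarrier K. hnorm K y \<le> 1}))"
    unfolding im homeomorphic_map_closure_of[OF hom sub]
    using T by (simp add: homeomorphic_map_compactness[OF hom closure_of_subset_topspace]
        compact_operators_def)
  moreover have "g (hadd K x y) = hadd H (g x) (g y)" if "x \<in> hcarrier K" "y \<in> hcarrier K" for x y
    using that by (metis H.add_closed add g gc)
  moreover have "g (hscale K c x) = hscale H c (g x)" if "x \<in> hcarrier K" for c x
    using that by (metis H.scale_closed scale g gc)
  moreover have "T (hadd H x y) = hadd H (T x) (T y)"
    if "x \<in> hcarrier H" "y \<in> hcarrier H" for x y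
    using T that by (auto simp: compact_operators_def)
  moreover have "T (hscale H c x) = hscale H c (T x)" if "x \<in> hcarrier H" for c x
    using T that by (auto simp: compact_operators_def)
  ultimately show ?thesis
    using f gc Tc K.add_closed K.scale_closed by (auto simp: compact_operators_def add scale)
qed

theorem elementaryI:
  fixes H :: "'h hilbert" and \<phi> :: "'a::cstar_algebra \<Rightarrow> 'h \<Rightarrow> 'h"
  assumes H: "hilbert_space H" and iso: "compact_operators_iso H \<phi>"
  shows "elementary TYPE('a)"
proof -
  interpret H: hilbert_space H by fact
  have bijphi: "bij_betw \<phi> UNIV (compact_operators H)"
    using iso by (simp add: compact_operators_iso_def)
  obtain f :: "'h \<Rightarrow> 'a" where inj: "inj_on f (hcarrier H)"
  proof (cases "\<exists>v\<in>hcarrier H. hnorm H v \<noteq> 0")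
    case True
    then obtain v where v: "v \<in> hcarrier H" "hnorm H v \<noteq> 0" by blast
    define u where "u = hscale H (of_real (inverse (hnorm H v))) v"
    have u: "u \<in> hcarrier H" "hnorm H u = 1"
      using v H.hnorm_nonneg[OF v(1)] by (auto simp: u_def H.scale_closed H.hnorm_scale norm_inverse)
    have uu: "hinner H u u = 1"
      using H.hnorm_power2[OF u(1)] H.inner_self_real[OF u(1)] u(2) by simp
    define R where "R h = (\<lambda>x\<in>hcarrier H. hscale H (hinner H x u) h)" for h
    have "inj_on (\<lambda>h. inv_into UNIV \<phi> (R h)) (hcarrier H)"
    proof (rule inj_onI)
      fix h k assume h: "h \<in> hcarrier H" and k: "k \<in> hcarrier H"
        and eq: "inv_into UNIV \<phi> (R h) = inv_into UNIV \<phi> (R k)"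
      have "\<phi> (inv_into UNIV \<phi> (R h)) = R h" if "h \<in> hcarrier H" for h
        using bij_betw_inv_into_right[OF bijphi] H.rank_one_compact[OF u that] by (simp add: R_def)
      then have "R h u = R k u" using h k eq by metis
      then show "h = k" using u h k by (simp add: R_def uu H.scale_one)
    qed
    then show thesis by (rule that)
  next
    case False
    then have "inj_on (\<lambda>_. 0) (hcarrier H)" by (metis H.hnorm_eq_zeroD inj_onI)
    then show thesis by (rule that)
  qed
  define g where "g = inv_into (hcarrier H) f"
  define K where "K = \<lparr>hcarrier = f ` hcarrier H, hzero = f (hzero H),
    hadd = (\<lambda>a b. f (hadd H (g a) (g b))), hscale = (\<lambda>c a. f (hscale H c (g a))),
    hinner = (\<lambda>a b. hinner H (g a) (g b))\<rparr>"
  have gf [simp]: "g (f x) = x" if "x \<in> hcarrier H" for x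
    using that inj by (simp add: g_def)
  have sel: "hcarrier K = f ` hcarrier H" "hzero K = f (hzero H)"
    "hadd K a b = f (hadd H (g a) (g b))" "hscale K c a = f (hscale H c (g a))"
    "hinner K a b = hinner H (g a) (g b)" for a b c
    by (simp_all add: K_def)
  have dist: "hdist K (f x) (f y) = hdist H x y" if "x \<in> hcarrier H" "y \<in> hcarrier H" for x y
    using that by (simp add: hdist_def hnorm_def sel H.scale_closed H.add_closed)
  have Kmetric: "Metric_space (hcarrier K) (hdist K)"
  proof
    fix x y
    have out: "hdist K x y = 0" if "\<not> (x \<in> hcarrier K \<and> y \<in> hcarrier K)" for x y
      using that by (auto simp: hdist_def)
    interpret M: Metric_space "hcarrier H" "hdist H" by (rule H.Metric_space_hilbert)
    show "0 \<le> hdist K x y" using out dist by (cases "x \<in> hcarrier K \<and> y \<in> hcarrier K") (auto simp: sel)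
    show "hdist K x y = hdist K y x" using out dist M.commute
      by (cases "x \<in> hcarrier K \<and> y \<in> hcarrier K") (auto simp: sel)
    show "x \<in> hcarrier K \<Longrightarrow> y \<in> hcarrier K \<Longrightarrow> (hdist K x y = 0) = (x = y)"
      using dist inj by (auto simp: sel inj_on_eq_iff)
    show "hdist K x z \<le> hdist K x y + hdist K y z"
      if "x \<in> hcarrier K" "y \<in> hcarrier K" "z \<in> hcarrier K" for z
      using that dist M.triangle by (auto simp: sel)
  qed
  interpret M: Metric_space12 "hcarrier H" "hdist H" "hcarrier K" "hdist K"
    by (intro Metric_space12.intro H.Metric_space_hilbert Kmetric)
  have "M.M2.mcomplete"
    unfolding M.M2.mcomplete_def
  proof (intro allI impI)
    fix \<sigma> assume \<sigma>: "M.M2.MCauchy \<sigma>"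
    have rng: "g (\<sigma> n) \<in> hcarrier H" "f (g (\<sigma> n)) = \<sigma> n" for n
    proof -
      have "\<sigma> n \<in> f ` hcarrier H" using \<sigma> M.M2.MCauchy_def[of \<sigma>] sel(1) by blast
      then show "g (\<sigma> n) \<in> hcarrier H" "f (g (\<sigma> n)) = \<sigma> n" by auto
    qed
    have dg: "hdist H (g (\<sigma> n)) (g (\<sigma> m)) = hdist K (\<sigma> n) (\<sigma> m)" for n m
      using dist[OF rng(1) rng(1)] by (simp add: rng)
    have "M.M1.MCauchy (g \<circ> \<sigma>)"
      using \<sigma> rng dg by (auto simp: M.M1.MCauchy_def M.M2.MCauchy_def)
    then obtain x where x: "limitin (htopology H) (g \<circ> \<sigma>) x sequentially"
      using H.complete by (auto simp: M.M1.mcomplete_def)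
    then have xc: "x \<in> hcarrier H" by (simp add: M.M1.limitin_metric)
    have "hdist K (\<sigma> n) (f x) = hdist H (g (\<sigma> n)) x" for n
      using dist[OF rng(1) xc] by (simp add: rng)
    moreover have "\<sigma> n \<in> hcarrier K" for n
      using \<sigma> M.M2.MCauchy_def[of \<sigma>] by blast
    ultimately have "limitin (htopology K) \<sigma> (f x) sequentially"
      using x xc rng(1) by (simp add: M.M1.limitin_metric M.M2.limitin_metric) (simp add: sel)
    then show "\<exists>x. limitin (htopology K) \<sigma> x sequentially" by blast
  qed
  have K: "hilbert_space K"
  proof
    show "\<exists>y\<in>hcarrier K. hadd K x y = hzero K" if "x \<in> hcarrier K" for x
    proof -
      from that obtain h where h: "h \<in> hcarrier H" "x = f h" by (auto simp: sel)
      with H.add_inverse obtain k where "k \<in> hcarrier H" "hadd H h k = hzero H" by blast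
      with h show ?thesis by (intro bexI[of _ "f k"]) (auto simp: sel)
    qed
    show "Metric_space.mcomplete (hcarrier K) (hdist K)" by fact
    show "hinner K x y = cnj (hinner K y x)" if "x \<in> hcarrier K" "y \<in> hcarrier K" for x y
      using that by (auto simp: sel intro: H.inner_commute)
    show "hadd K x y = hadd K y x" if "x \<in> hcarrier K" "y \<in> hcarrier K" for x y
      using that by (auto simp: sel intro!: arg_cong[of _ _ f] H.add_commute)
    show "hadd K (hadd K x y) z = hadd K x (hadd K y z)"
      if "x \<in> hcarrier K" "y \<in> hcarrier K" "z \<in> hcarrier K" for x y z
      using that by (auto simp: sel H.add_closed H.add_assoc)
    show "x = hzero K" if "x \<in> hcarrier K" "hinner K x x = 0" for x
      using that H.inner_eq_zeroD by (auto simp: sel)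
  qed (auto simp: sel H.zero_closed H.add_closed H.scale_closed H.add_zero H.scale_add_right
      H.scale_add_left H.scale_scale H.scale_one H.inner_add_left H.inner_scale_left H.inner_nonneg)
  have bijf: "bij_betw f (hcarrier H) (hcarrier K)" using inj by (auto simp: bij_betw_def sel)
  have bijg: "bij_betw g (hcarrier K) (hcarrier H)"
    using inj by (auto simp: sel g_def intro: bij_betw_inv_into bij_betw_imageI)
  define F where "F T = (\<lambda>y\<in>hcarrier K. f (T (g y)))" for T
  define G where "G S = (\<lambda>x\<in>hcarrier H. g (S (f x)))" for S
  have F: "F T \<in> compact_operators K" if "T \<in> compact_operators H" for T
    unfolding F_def using that
    by (intro compact_operators_transport[OF H K bijf]) (auto simp: sel H.add_closed H.scale_closed)
  have G: "G S \<in> compact_operators H" if "S \<in> compact_operators K" for S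
    unfolding G_def using that
    by (intro compact_operators_transport[OF K H bijg]) (auto simp: sel H.add_closed H.scale_closed)
  have ext: "T x = undefined" if "T \<in> compact_operators L" "x \<notin> hcarrier L"
    for T x and L :: "'z hilbert"
    using that by (auto simp: compact_operators_def)
  have closed: "T x \<in> hcarrier L" if "T \<in> compact_operators L" "x \<in> hcarrier L"
    for T x and L :: "'z hilbert"
    using that by (auto simp: compact_operators_def)
  have GF: "G (F T) = T" if "T \<in> compact_operators H" for T
  proof
    show "G (F T) x = T x" for x
      using closed[OF that, of x] ext[OF that, of x] by (simp add: G_def F_def sel)
  qed
  have FG: "F (G S) = S" if "S \<in> compact_operators K" for S
  proof
    show "F (G S) y = S y" for y
    proof (cases "y \<in> hcarrier K")
      case True
      then have "S y \<in> f ` hcarrier H" using closed[OF that] by (simp add: sel)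
      then show ?thesis using True by (auto simp: G_def F_def sel)
    next
      case False
      then show ?thesis using ext[OF that] by (simp add: F_def)
    qed
  qed
  have "bij_betw F (compact_operators H) (compact_operators K)"
    using F G GF FG by (intro bij_betw_byWitness[where f'=G]) blast+
  then have bijF: "bij_betw (F \<circ> \<phi>) UNIV (compact_operators K)"
    using bijphi by (rule bij_betw_trans[rotated])
  have phi: "\<phi> a x \<in> hcarrier H" if "x \<in> hcarrier H" for a x
    using closed[OF bij_betwE[OF bijphi, rule_format, OF UNIV_I] that] .
  have "compact_operators_iso K (F \<circ> \<phi>)"
    unfolding compact_operators_iso_def
  proof (intro conjI allI ballI)
    show "bij_betw (F \<circ> \<phi>) UNIV (compact_operators K)" by (rule bijF)
    fix a b :: 'a and c x y
    assume "x \<in> hcarrier K"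
    then obtain h where h: "h \<in> hcarrier H" "x = f h" by (auto simp: sel)
    have F: "(F \<circ> \<phi>) a (f h) = f (\<phi> a h)" if "h \<in> hcarrier H" for a h
      using that by (simp add: F_def sel)
    show "(F \<circ> \<phi>) (a + b) x = hadd K ((F \<circ> \<phi>) a x) ((F \<circ> \<phi>) b x)"
      using iso unfolding h(2) F[OF h(1)] by (simp add: compact_operators_iso_def h phi sel)
    show "(F \<circ> \<phi>) (c *\<^sub>C a) x = hscale K c ((F \<circ> \<phi>) a x)"
      using iso unfolding h(2) F[OF h(1)] by (simp add: compact_operators_iso_def h phi sel)
    show "(F \<circ> \<phi>) (a * b) x = (F \<circ> \<phi>) a ((F \<circ> \<phi>) b x)"
      using iso unfolding h(2) F[OF h(1)] F[OF phi[OF h(1)]]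
      by (simp add: compact_operators_iso_def h)
    assume "y \<in> hcarrier K"
    then obtain k where k: "k \<in> hcarrier H" "y = f k" by (auto simp: sel)
    show "hinner K ((F \<circ> \<phi>) (adj a) x) y = hinner K x ((F \<circ> \<phi>) a y)"
      using iso unfolding h(2) k(2) F[OF h(1)] F[OF k(1)]
      by (simp add: compact_operators_iso_def h k phi sel)
  qed
  then show ?thesis using K by (auto simp: elementary_def)
qed

end

theory Submission
  imports Defs
begin

text \<open>Each of the four hypotheses yields nonzero positive elements \<open>s\<^sub>0, s\<^sub>1, \<dots>\<close> such that every
  nonzero positive element dominates one of them. If the algebra had a minimal projection \<open>p\<close>, it
  would act on the Hilbert space \<open>A p\<close> as the compact operators. Hence there is none, and then
  every nonzero hereditary corner contains an infinite sequence of nonzero orthogonal elements; let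
  \<open>t j 0, t j 1, \<dots>\<close> be such a sequence in a corner below \<open>s\<^sub>j\<close>. Since the algebra is prime, there
  is for every \<open>k\<close> an element \<open>v\<^sub>k\<close> of norm one that factors through all of \<open>t 0 k, \<dots>, t k k\<close> and
  satisfies \<open>v\<^sub>k \<in> (e (2k + 1) - e (2k)) A\<close>. The sum \<open>X\<close> of the orthogonal elements
  \<open>d\<^sub>k = v\<^sub>k v\<^sub>k\<^sup>*\<close> converges strictly. Its tail from \<open>j\<close> on is dominated by \<open>s\<^sub>j\<close> because \<open>d\<^sub>k\<close> is
  below a conjugate of \<open>(t j k)\<^sup>2\<close>, so \<open>X\<close> belongs to \<open>K_o e\<close>. But \<open>X\<close> is not in the algebra, since
  \<open>d\<^sub>k\<close> has norm one and moves off to infinity.\<close>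

section \<open>Adjoints and square roots\<close>

text \<open>Order arguments need a unit, so they take place in the multiplier algebra. There
  positivity amounts to self-adjointness together with
  \<open>norm (M *\<^sub>R 1 - a) \<le> M\<close> for some \<open>M\<close>; this norm test takes
  the place of the spectrum and rests on an iterated square root. Conjugators found there return to
  the algebra because it is an ideal.

  The obstacle is that the blocks of a single \<open>X\<close> must eventually be small against
  every nonzero positive element. Countably many \<open>s\<^sub>j\<close> allow a diagonal choice:
  \<open>v\<^sub>k\<close> has to pass through \<open>t j k\<close> only for
  \<open>j \<le> k\<close>, a finite product, and the terms with \<open>k < j\<close> are cut off by
  \<open>e m - e n\<close> once \<open>n \<ge> 2 * j\<close>. For fixed \<open>j\<close> the
  remaining terms, whose number is unbounded, must fit below one conjugate of
  \<open>s\<^sub>j\<close>. Orthogonality of the \<open>t j k\<close> in \<open>k\<close> achieves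
  this, which is why infinitely many orthogonal elements are required below each
  \<open>s\<^sub>j\<close>.\<close>

lemma adj_zero [simp]: "adj (0::'a::cstar_algebra) = 0"
  by (rule linear_0[OF bounded_linear.linear[OF bounded_linear_adj]])

lemma adj_minus: "adj (- x) = - adj (x::'a::cstar_algebra)"
  by (rule linear_neg[OF bounded_linear.linear[OF bounded_linear_adj]])

lemma adj_diff: "adj (x - y) = adj x - adj (y::'a::cstar_algebra)"
  by (rule linear_diff[OF bounded_linear.linear[OF bounded_linear_adj]])

lemma adj_sum: "adj (sum f A) = (\<Sum>i\<in>A. adj (f i :: 'a::cstar_algebra))"
  by (rule linear_sum[OF bounded_linear.linear[OF bounded_linear_adj]])

lemmas tendsto_adj = bounded_linear.tendsto[OF bounded_linear_adj]

lemma scaleC_minus_left: "(- c) *\<^sub>C x = - (c *\<^sub>C (x::'a::cstar_algebra))"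
  using scaleC_scaleC[of c "-1" x] scaleC_of_real[of "-1" x] by (simp add: scaleC_minus_right)

lemmas adj_simps = adj_adj adj_add adj_mult adj_minus adj_diff adj_scaleR adj_scaleC

lemma norm_selfadjoint_square:
  fixes h :: "'a::cstar_algebra"
  shows "adj h = h \<Longrightarrow> norm (h * h) = (norm h)\<^sup>2"
  by (metis norm_adj_mult_self)

lemma adj_mult_self_eq_0_iff [simp]: "adj x * x = 0 \<longleftrightarrow> x = (0::'a::cstar_algebra)"
  by (metis norm_adj_mult_self norm_eq_zero power_eq_0_iff mult_zero_right)

lemma mult_adj_self_eq_0_iff [simp]: "x * adj x = 0 \<longleftrightarrow> x = (0::'a::cstar_algebra)"
  by (metis adj_mult_self_eq_0_iff adj_adj adj_zero)

text \<open>In the presence of a unit, \<open>1 - y\<close> is a square root of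
  \<open>1 - c\<close>. The iterates are polynomials in \<open>c\<close> with nonnegative
  coefficients, so the same iteration \<open>r\<close> at the scalar \<open>c = 1\<close> dominates
  norms and increments. Its monotone convergence replaces a contraction estimate, which fails at
  norm one.\<close>

lemma selfadjoint_quadratic:
  fixes c :: "'a::cstar_algebra"
  assumes c: "adj c = c" "norm c \<le> 1"
  obtains y where "adj y = y" "norm y \<le> 1" "2 *\<^sub>R y = c + y * y"
    "\<forall>x. x * c = c * x \<longrightarrow> x * y = y * x"
proof -
  define Y where "Y = rec_nat (0::'a) (\<lambda>_ y. (1/2) *\<^sub>R (c + y * y))"
  define r where "r = rec_nat (0::real) (\<lambda>_ t. (1/2) * (1 + t * t))"
  have Y0: "Y 0 = 0" and YS: "Y (Suc n) = (1/2) *\<^sub>R (c + Y n * Y n)" for n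
    by (simp_all add: Y_def)
  have r0: "r 0 = 0" and rS: "r (Suc n) = (1/2) * (1 + r n * r n)" for n
    by (simp_all add: r_def)
  have r01: "0 \<le> r n \<and> r n \<le> 1" for n
  proof (induction n)
    case (Suc n)
    then have "r n * r n \<le> 1 * 1" by (intro mult_mono) auto
    then show ?case by (simp add: rS)
  qed (simp add: r0)
  have comm: "x * Y n = Y n * x" if x: "x * c = c * x" for x n
  proof (induction n)
    case (Suc n)
    then have "x * (Y n * Y n) = (Y n * Y n) * x" by (metis mult.assoc)
    then show ?case using x by (simp add: YS distrib_left distrib_right)
  qed (simp add: Y0)
  have YY: "Y n * Y m = Y m * Y n" for n m
    by (rule comm) (simp add: comm)
  have adjY: "adj (Y n) = Y n" for n
    by (induction n) (simp_all add: Y0 YS adj_simps c)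
  have normY: "norm (Y n) \<le> r n" for n
  proof (induction n)
    case (Suc n)
    have "norm (Y n * Y n) \<le> r n * r n"
      by (rule order_trans[OF norm_mult_ineq]) (intro mult_mono Suc norm_ge_zero, use r01 in simp)
    then show ?case using norm_triangle_ineq[of c "Y n * Y n"] c by (simp add: YS rS)
  qed (simp add: Y0 r0)
  have diff: "norm (Y (Suc n) - Y n) \<le> r (Suc n) - r n" for n
  proof (induction n)
    case 0
    show ?case using c by (simp add: Y0 YS r0 rS)
  next
    case (Suc n)
    have "0 \<le> r (Suc n) - r n" using order_trans[OF norm_ge_zero Suc] .
    have "Y (Suc (Suc n)) - Y (Suc n) = (1/2) *\<^sub>R (Y (Suc n) * Y (Suc n) - Y n * Y n)"
      by (subst YS, subst (3) YS) (simp add: algebra_simps)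
    also have "Y (Suc n) * Y (Suc n) - Y n * Y n = (Y (Suc n) - Y n) * (Y (Suc n) + Y n)"
      using YY[of n "Suc n"] by (simp add: algebra_simps)
    finally have "norm (Y (Suc (Suc n)) - Y (Suc n))
        = 1/2 * norm ((Y (Suc n) - Y n) * (Y (Suc n) + Y n))" by simp
    also have "\<dots> \<le> 1/2 * ((r (Suc n) - r n) * (r (Suc n) + r n))"
      using norm_triangle_mono[OF normY normY, of "Suc n" n] Suc
      by (intro mult_left_mono order_trans[OF norm_mult_ineq] mult_mono)
        (use \<open>0 \<le> r (Suc n) - r n\<close> in auto)
    also have "\<dots> = (1/2) * (1 + r (Suc n) * r (Suc n)) - (1/2) * (1 + r n * r n)"
      by (simp add: algebra_simps)
    also have "\<dots> = r (Suc (Suc n)) - r (Suc n)" by (simp only: rS[symmetric])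
    finally show ?case .
  qed
  have "r n \<le> r (Suc n)" for n using order_trans[OF norm_ge_zero diff[of n]] by simp
  then have "incseq r" by (rule incseq_SucI)
  moreover have "Bseq r" using r01 by (intro BseqI'[of _ 1]) auto
  ultimately obtain l where "r \<longlonglongrightarrow> l"
    using Bseq_mono_convergent[of r] by (auto simp: incseq_def convergent_def)
  then have "summable (\<lambda>n. r (Suc n) - r n)" by (rule telescope_summable)
  then have "summable (\<lambda>n. Y (Suc n) - Y n)"
    by (rule summable_comparison_test'[of _ 0]) (use diff in simp)
  then have "convergent (\<lambda>n. \<Sum>i<n. Y (Suc i) - Y i)" by (simp add: summable_iff_convergent)
  then have "convergent Y" by (simp add: sum_lessThan_telescope Y0)
  then obtain y where y: "Y \<longlonglongrightarrow> y" by (auto simp: convergent_def)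
  show thesis
  proof (rule that)
    show "adj y = y" using tendsto_adj[OF y] y by (simp add: adjY LIMSEQ_unique)
    show "norm y \<le> 1"
      by (rule LIMSEQ_le_const2[OF tendsto_norm[OF y]]) (use normY r01 order_trans in blast)
    have "(\<lambda>n. 2 *\<^sub>R Y (Suc n)) \<longlonglongrightarrow> 2 *\<^sub>R y"
      by (intro tendsto_intros LIMSEQ_Suc y)
    moreover have "(\<lambda>n. 2 *\<^sub>R Y (Suc n)) \<longlonglongrightarrow> c + y * y"
      by (simp add: YS) (intro tendsto_intros y)
    ultimately show "2 *\<^sub>R y = c + y * y" by (rule LIMSEQ_unique)
    have "x * y = y * x" if x: "x * c = c * x" for x
    proof (rule LIMSEQ_unique)
      show "(\<lambda>n. x * Y n) \<longlonglongrightarrow> x * y" by (intro tendsto_intros y)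
      show "(\<lambda>n. x * Y n) \<longlonglongrightarrow> y * x" unfolding comm[OF x] by (intro tendsto_intros y)
    qed
    then show "\<forall>x. x * c = c * x \<longrightarrow> x * y = y * x" by blast
  qed
qed

section \<open>The multiplier algebra as a unital C*-algebra\<close>

text \<open>\<open>monoid_mult\<close> does not demand \<open>0 \<noteq> 1\<close>: the multiplier
  algebra of the zero algebra is zero. Hence \<open>norm_one_le\<close> is an inequality.\<close>

class unital_cstar_algebra = cstar_algebra + monoid_mult

instantiation multiplier :: (cstar_algebra) unital_cstar_algebra
begin

lift_definition one_multiplier :: "'a multiplier" is "(id_blinfun, id_blinfun)" by simp

instance
proof
  fix X :: "'a multiplier"
  have l: "lmul (1::'a multiplier) = id_blinfun" by transfer simp
  show "1 * X = X" by (rule multiplier_eqI_left) (simp add: lmul_ops l)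
  show "X * 1 = X" by (rule multiplier_eqI_left) (simp add: lmul_ops l)
qed

end

lemma adj_one [simp]: "adj (1::'a::unital_cstar_algebra) = 1"
  by (metis adj_adj adj_mult mult_1_left mult_1_right)

lemma norm_one_le: "norm (1::'a::unital_cstar_algebra) \<le> 1"
  using norm_selfadjoint_square[of "1::'a"] by (auto simp: power2_eq_square)

section \<open>Positivity in unital C*-algebras\<close>

text \<open>For squares of self-adjoint elements the cone axioms have direct proofs; that every \<open>b\<^sup>* b\<close> is
  such a square is \<open>psd_adj_mult_self\<close>.\<close>

definition psd :: "'a::cstar_algebra \<Rightarrow> bool" where
  "psd a \<longleftrightarrow> (\<exists>h. adj h = h \<and> h * h = a)"

lemma psd_adj: "psd a \<Longrightarrow> adj a = a"
  by (auto simp: psd_def adj_simps)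

text \<open>The hypothesis is the norm form of \<open>0 \<le> a \<le> 2 M\<close>. With
  \<open>c = 1 - a / M\<close> in the unit ball, \<open>selfadjoint_quadratic\<close> yields
  \<open>h = sqrt M (1 - y)\<close>. The root \<open>h\<close> passes the same kind of norm test, so
  it can later be recognised as positive.\<close>

lemma sqrt_of_norm_le:
  fixes a :: "'a::unital_cstar_algebra"
  assumes a: "adj a = a" and M: "norm (M *\<^sub>R 1 - a) \<le> M"
  obtains h N where "adj h = h" "h * h = a" "norm (N *\<^sub>R 1 - h) \<le> N"
    "\<forall>x. x * a = a * x \<longrightarrow> x * h = h * x"
proof (cases "M = 0")
  case True
  then have "a = 0" using M by simp
  then show thesis by (intro that[of 0 0]) auto
next
  case False
  then have M0: "M > 0" using M norm_ge_zero[of "M *\<^sub>R 1 - a"] by linarith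
  define c where "c = (1/M) *\<^sub>R (M *\<^sub>R 1 - a)"
  have c: "adj c = c" by (simp add: c_def adj_simps a)
  have nc: "norm c \<le> 1" using M M0 by (simp add: c_def)
  obtain y where y: "adj y = y" "norm y \<le> 1" "2 *\<^sub>R y = c + y * y"
    "\<forall>x. x * c = c * x \<longrightarrow> x * y = y * x"
    by (rule selfadjoint_quadratic[OF c nc])
  have c1: "a = M *\<^sub>R (1 - c)" using M0 by (simp add: c_def algebra_simps)
  show thesis
  proof (rule that)
    let ?h = "sqrt M *\<^sub>R (1 - y)"
    show "adj ?h = ?h" by (simp add: adj_simps y)
    have "(1 - y) * (1 - y) = 1 - 2 *\<^sub>R y + y * y" by (simp add: algebra_simps scaleR_2)
    also have "\<dots> = 1 - c" using y(3) by simp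
    finally show "?h * ?h = a" using M0 by (simp add: c1)
    show "norm (sqrt M *\<^sub>R 1 - ?h) \<le> sqrt M"
      using y(2) M0 by (simp flip: scaleR_diff_right)
    have "x * ?h = ?h * x" if x: "x * a = a * x" for x
    proof -
      have "x * c = c * x" by (simp add: c_def algebra_simps x)
      then have "x * y = y * x" using y(4) by blast
      then show ?thesis by (simp add: right_diff_distrib left_diff_distrib)
    qed
    then show "\<forall>x. x * a = a * x \<longrightarrow> x * ?h = ?h * x" by blast
  qed
qed

text \<open>The element \<open>h + i k\<close> is \<open>sqrt M\<close> times a unitary.\<close>

lemma norm_square_le_if_sum_squares:
  fixes h k :: "'a::unital_cstar_algebra"
  assumes h: "adj h = h" and k: "adj k = k" and hk: "h * k = k * h"
    and sq: "h * h + k * k = M *\<^sub>R 1" and M0: "M \<ge> 0"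
  shows "(norm k)\<^sup>2 \<le> M"
proof -
  define u where "u = h + \<i> *\<^sub>C k"
  have au: "adj u = h - \<i> *\<^sub>C k"
    by (simp add: u_def adj_simps h k scaleC_minus_left)
  have "adj u * u = (h - \<i> *\<^sub>C k) * (h + \<i> *\<^sub>C k)" unfolding au by (simp only: u_def)
  also have "\<dots> = h * h - \<i> *\<^sub>C \<i> *\<^sub>C (k * k)"
    by (simp add: distrib_left left_diff_distrib mult_scaleC_left mult_scaleC_right hk scaleC_diff_right)
  also have "\<i> *\<^sub>C \<i> *\<^sub>C (k * k) = - (k * k)"
    using scaleC_of_real[of "-1" "k * k"] by (simp add: scaleC_scaleC)
  finally have "adj u * u = M *\<^sub>R 1" by (simp add: sq)
  then have "(norm u)\<^sup>2 = M * norm (1::'a)"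
    unfolding norm_adj_mult_self[symmetric] using M0 by simp
  also have "\<dots> \<le> M" using M0 norm_one_le[where 'a='a] by (simp add: mult_left_le)
  finally have nu: "(norm u)\<^sup>2 \<le> M" .
  have eq: "2 *\<^sub>R (\<i> *\<^sub>C k) = u - adj u" unfolding au by (simp add: u_def scaleR_2)
  have "2 * norm k = norm (2 *\<^sub>R (\<i> *\<^sub>C k))" by (simp add: norm_scaleC)
  also have "\<dots> \<le> norm u + norm (adj u)" unfolding eq by (rule norm_triangle_ineq4)
  finally have "norm k \<le> norm u" by (simp add: norm_adj)
  then show ?thesis using nu power_mono[of "norm k" "norm u" 2] norm_ge_zero[of k] by linarith
qed

text \<open>Every square passes the norm test: by \<open>sqrt_of_norm_le\<close>,
  \<open>M - h * h\<close> is a square \<open>k * k\<close> with \<open>k\<close> commuting with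
  \<open>h\<close>, and \<open>h * h + k * k = M\<close> bounds \<open>k\<close>.\<close>

lemma norm_diff_square_le:
  fixes h :: "'a::unital_cstar_algebra"
  assumes h: "adj h = h" and M: "(norm h)\<^sup>2 \<le> M"
  shows "norm (M *\<^sub>R 1 - h * h) \<le> M"
proof -
  have nM: "norm (M *\<^sub>R 1 - (M *\<^sub>R 1 - h * h)) \<le> M" using norm_selfadjoint_square[OF h] M by simp
  have aM: "adj (M *\<^sub>R 1 - h * h) = M *\<^sub>R 1 - h * h" by (simp add: adj_simps h)
  obtain k N where k: "adj k = k" "k * k = M *\<^sub>R 1 - h * h" "norm (N *\<^sub>R 1 - k) \<le> N"
    "\<forall>x. x * (M *\<^sub>R 1 - h * h) = (M *\<^sub>R 1 - h * h) * x \<longrightarrow> x * k = k * x"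
    by (rule sqrt_of_norm_le[OF aM nM])
  have hk: "h * k = k * h"
    by (rule k(4)[rule_format]) (simp add: right_diff_distrib left_diff_distrib mult.assoc)
  have M0: "M \<ge> 0" using M zero_le_power2[of "norm h"] by linarith
  have "(norm k)\<^sup>2 \<le> M"
    by (rule norm_square_le_if_sum_squares[OF h k(1) hk _ M0]) (simp add: k(2))
  then show ?thesis unfolding k(2)[symmetric] norm_selfadjoint_square[OF k(1)] .
qed

lemma psd_square: "adj h = h \<Longrightarrow> psd (h * h)"
  by (auto simp: psd_def)

lemma psd_norm_diff_le:
  fixes a :: "'a::unital_cstar_algebra"
  assumes "psd a" and M: "norm a \<le> M"
  shows "norm (M *\<^sub>R 1 - a) \<le> M"
  using assms norm_diff_square_le norm_selfadjoint_square by (metis psd_def)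

lemma psdI_norm:
  fixes a :: "'a::unital_cstar_algebra"
  shows "adj a = a \<Longrightarrow> norm (M *\<^sub>R 1 - a) \<le> M \<Longrightarrow> psd a"
  by (metis sqrt_of_norm_le psd_def)

lemma psd_sqrt:
  fixes a :: "'a::unital_cstar_algebra"
  assumes "psd a"
  obtains h where "psd h" "adj h = h" "h * h = a" "\<forall>x. x * a = a * x \<longrightarrow> x * h = h * x"
  using sqrt_of_norm_le[OF psd_adj[OF assms] psd_norm_diff_le[OF assms order_refl]] psdI_norm
  by metis

lemma psd_zero [simp]: "psd (0::'a::cstar_algebra)"
  unfolding psd_def by (rule exI[of _ 0]) simp

lemma psd_one [simp]: "psd (1::'a::unital_cstar_algebra)"
  unfolding psd_def by (rule exI[of _ 1]) simp

lemma psd_scaleR: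
  assumes "psd (a::'a::cstar_algebra)" "0 \<le> r"
  shows "psd (r *\<^sub>R a)"
proof -
  obtain h where h: "adj h = h" "h * h = a" using assms by (auto simp: psd_def)
  have "psd ((sqrt r *\<^sub>R h) * (sqrt r *\<^sub>R h))" by (rule psd_square) (simp add: adj_simps h)
  then show ?thesis using assms h by simp
qed

text \<open>The norm test reduces closure of the cone under sums to the triangle inequality.\<close>

lemma psd_add:
  fixes a b :: "'a::unital_cstar_algebra"
  assumes "psd a" "psd b"
  shows "psd (a + b)"
proof (rule psdI_norm)
  show "adj (a + b) = a + b" using assms by (simp add: adj_simps psd_adj)
  have eq: "(norm a + norm b) *\<^sub>R 1 - (a + b) = (norm a *\<^sub>R 1 - a) + (norm b *\<^sub>R 1 - b)"
    by (simp add: algebra_simps)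
  show "norm ((norm a + norm b) *\<^sub>R 1 - (a + b)) \<le> norm a + norm b"
    unfolding eq using norm_triangle_mono[OF psd_norm_diff_le[OF assms(1) order_refl] psd_norm_diff_le[OF assms(2) order_refl]]
    by simp
qed

lemma psd_sum:
  fixes f :: "'i \<Rightarrow> 'a::unital_cstar_algebra"
  shows "(\<And>i. i \<in> I \<Longrightarrow> psd (f i)) \<Longrightarrow> psd (sum f I)"
  by (induction I rule: infinite_finite_induct) (auto intro: psd_add)

lemma psd_mult:
  fixes a b :: "'a::unital_cstar_algebra"
  assumes "psd a" "psd b" and ab: "a * b = b * a"
  shows "psd (a * b)"
proof -
  obtain h where h: "adj h = h" "h * h = a" "\<forall>x. x * a = a * x \<longrightarrow> x * h = h * x"
    using psd_sqrt[OF assms(1)] by metis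
  obtain k where k: "adj k = k" "k * k = b" "\<forall>x. x * b = b * x \<longrightarrow> x * k = k * x"
    using psd_sqrt[OF assms(2)] by metis
  have "b * h = h * b" using h(3) ab by simp
  then have hk: "h * k = k * h" using k(3) by simp
  have "psd ((h * k) * (h * k))" by (rule psd_square) (simp add: adj_simps h k hk)
  also have "(h * k) * (h * k) = h * (k * h) * k" by (simp add: mult.assoc)
  also have "\<dots> = h * (h * k) * k" by (simp only: hk)
  also have "\<dots> = a * b" by (simp add: h(2)[symmetric] k(2)[symmetric] mult.assoc)
  finally show ?thesis .
qed

lemma psd_power: "psd (a::'a::unital_cstar_algebra) \<Longrightarrow> psd (a ^ n)"
  by (induction n) (auto intro!: psd_mult simp: power_commutes)

lemma psd_diff_norm:
  fixes a :: "'a::unital_cstar_algebra"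
  assumes "adj a = a" "norm a \<le> M"
  shows "psd (M *\<^sub>R 1 - a)" "psd (M *\<^sub>R 1 + a)"
  using assms by (auto intro!: psdI_norm[of _ M] simp: adj_simps)

text \<open>The commuting positive factors \<open>M - a\<close> and \<open>M + a\<close> have a
  product \<open>M\<^sup>2 - a\<^sup>2 = k\<^sup>2\<close>, so \<open>a\<close> is one of two
  commuting elements whose squares add up to \<open>M\<^sup>2\<close>.\<close>

lemma norm_le_if_psd:
  fixes a :: "'a::unital_cstar_algebra"
  assumes m: "psd (M *\<^sub>R 1 - a)" and p: "psd (M *\<^sub>R 1 + a)" and M: "0 \<le> M"
  shows "norm a \<le> M"
proof -
  have a: "adj a = a" using psd_adj[OF p] by (simp add: adj_simps)
  have "psd ((M *\<^sub>R 1 - a) * (M *\<^sub>R 1 + a))"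
    by (rule psd_mult[OF m p]) (simp add: algebra_simps)
  also have "(M *\<^sub>R 1 - a) * (M *\<^sub>R 1 + a) = (M * M) *\<^sub>R 1 - a * a" by (simp add: algebra_simps)
  finally obtain k where pk: "psd k" and k: "adj k = k" "k * k = (M * M) *\<^sub>R 1 - a * a"
    "\<forall>x. x * ((M * M) *\<^sub>R 1 - a * a) = ((M * M) *\<^sub>R 1 - a * a) * x \<longrightarrow> x * k = k * x"
    by (rule psd_sqrt)
  have ka: "k * a = a * k"
    by (rule k(3)[rule_format, symmetric]) (simp add: right_diff_distrib left_diff_distrib mult.assoc)
  have "k * k + a * a = (M * M) *\<^sub>R 1" by (subst k(2)) (rule diff_add_cancel)
  from norm_square_le_if_sum_squares[OF k(1) a ka this zero_le_square]
  have "(norm a)\<^sup>2 \<le> M\<^sup>2" by (subst (2) power2_eq_square)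
  then show ?thesis using M by (rule power2_le_imp_le)
qed

lemma psd_antisym:
  fixes a :: "'a::unital_cstar_algebra"
  shows "psd a \<Longrightarrow> psd (- a) \<Longrightarrow> a = 0"
  using norm_le_if_psd[of 0 a] by simp

lemma selfadjoint_le_norm:
  fixes a :: "'a::unital_cstar_algebra"
  shows "psd a \<Longrightarrow> psd (M *\<^sub>R 1 - a) \<Longrightarrow> 0 \<le> M \<Longrightarrow> norm a \<le> M"
  by (rule norm_le_if_psd) (auto intro: psd_add[OF psd_scaleR[OF psd_one]])

lemma psd_norm_mono:
  fixes a b :: "'a::unital_cstar_algebra"
  assumes "psd a" "psd (b - a)"
  shows "norm a \<le> norm b"
proof (rule selfadjoint_le_norm[OF assms(1)])
  have "psd b" using psd_add[OF assms] by simp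
  then have "psd (norm b *\<^sub>R 1 - b)" by (intro psd_diff_norm psd_adj) auto
  from psd_add[OF this assms(2)] show "psd (norm b *\<^sub>R 1 - a)" by simp
qed simp

section \<open>Positive and negative parts, and positivity of \<open>adj x * x\<close>\<close>

lemma selfadjoint_square_eq_0:
  fixes h :: "'a::cstar_algebra"
  shows "adj h = h \<Longrightarrow> h * h = 0 \<Longrightarrow> h = 0"
  by (metis adj_mult_self_eq_0_iff)

text \<open>With \<open>q = |p|\<close> and \<open>z = q - p\<close>, the element \<open>z\<^sup>2 p\<^sup>3 = - z\<^sup>2 q\<^sup>3\<close> is both
  positive and negative.\<close>

lemma psd_if_psd_cube:
  fixes p :: "'a::unital_cstar_algebra"
  assumes p: "adj p = p" and cube: "psd (p * p * p)"
  shows "psd p"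
proof -
  obtain q where q: "psd q" "adj q = q" "q * q = p * p"
    "\<forall>x. x * (p * p) = (p * p) * x \<longrightarrow> x * q = q * x"
    by (rule psd_sqrt[OF psd_square[OF p]])
  have pq: "p * q = q * p" using q(4) by (simp add: mult.assoc)
  define z where "z = q - p"
  have z: "adj z = z" by (simp add: z_def adj_simps p q)
  have zp: "z * p = - (z * q)" and zq: "z * q = q * z" and pz: "z * p = p * z"
    by (simp_all add: z_def algebra_simps pq q(3))
  have zq': "z * (q * x) = q * (z * x)" and pz': "z * (p * x) = p * (z * x)" for x
    by (simp_all add: zq pz flip: mult.assoc)
  note comm = mult.assoc zq zq' pz pz'
  have "psd ((z * z) * (p * p * p))"
    by (rule psd_mult[OF psd_square[OF z] cube]) (simp add: comm)
  also have "(z * z) * (p * p * p) = - ((z * z) * (q * q * q))"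
  proof -
    have "(z * z) * (p * p * p) = z * (z * p) * (p * p)" by (simp add: mult.assoc)
    also have "\<dots> = - (z * (z * q) * (q * q))" by (simp add: zp q(3))
    finally show ?thesis by (simp add: mult.assoc)
  qed
  finally have 1: "psd (- ((z * z) * (q * q * q)))" .
  have "psd ((z * z) * (q * q * q))"
    by (rule psd_mult[OF psd_square[OF z] psd_mult[OF psd_square[OF q(2)] q(1)]])
      (simp_all add: comm)
  then have zzqqq: "(z * z) * (q * q * q) = 0" using 1 psd_antisym by blast
  have azq: "adj (z * q) = z * q" by (simp add: adj_simps z q zq)
  have "(z * q) * (z * q) * ((z * q) * (z * q)) = (z * z) * ((z * z) * (q * q * q)) * q"
    by (simp only: comm)
  also have "\<dots> = 0" by (simp only: zzqqq mult_zero_left mult_zero_right)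
  finally have "(z * q) * (z * q) = 0"
    by (rule selfadjoint_square_eq_0[rotated]) (simp add: adj_mult[of "z * q"] azq)
  then have zq0: "z * q = 0" by (rule selfadjoint_square_eq_0[OF azq])
  then have "z * p = 0" using zp by simp
  then have "z * z = 0" by (simp add: z_def right_diff_distrib zq0[unfolded z_def])
  then have "z = 0" by (rule selfadjoint_square_eq_0[OF z])
  then show ?thesis using q(1) by (simp add: z_def)
qed

text \<open>\<open>p\<close> and \<open>n\<close> are half the sum and half the difference of
  \<open>q = |a|\<close> and \<open>a\<close>. From \<open>p * n = 0\<close> and
  \<open>q = p + n\<close> follows \<open>p\<^sup>3 = p\<^sup>2 q\<close>, a product of commuting
  positive elements, so \<open>psd_if_psd_cube\<close> applies; likewise for
  \<open>n\<close>.\<close>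

lemma pos_neg_parts:
  fixes a :: "'a::unital_cstar_algebra"
  assumes a: "adj a = a"
  obtains p n where "psd p" "psd n" "a = p - n" "p * n = 0" "n * p = 0"
    "\<forall>x. x * a = a * x \<longrightarrow> x * p = p * x \<and> x * n = n * x"
proof -
  obtain q where q: "psd q" "adj q = q" "q * q = a * a"
    "\<forall>x. x * (a * a) = (a * a) * x \<longrightarrow> x * q = q * x"
    by (rule psd_sqrt[OF psd_square[OF a]])
  have aq: "a * q = q * a" using q(4) by (simp add: mult.assoc)
  define p where "p = (1/2) *\<^sub>R (q + a)"
  define n where "n = (1/2) *\<^sub>R (q - a)"
  have pn: "p * n = 0" and np: "n * p = 0" by (simp_all add: p_def n_def algebra_simps aq q(3))
  have ap: "adj p = p" and an: "adj n = n" by (simp_all add: p_def n_def adj_simps a q)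
  have pq: "p * q = q * p" and nq: "n * q = q * n" by (simp_all add: p_def n_def algebra_simps aq)
  have pq': "p * (q * x) = q * (p * x)" and nq': "n * (q * x) = q * (n * x)" for x
    by (simp_all add: pq nq flip: mult.assoc)
  have qpn: "q = p + n" by (simp add: p_def n_def flip: scaleR_add_right)
  have "psd ((p * p) * q)"
    by (rule psd_mult[OF psd_square[OF ap] q(1)]) (simp add: mult.assoc pq pq')
  also have "(p * p) * q = p * p * p" by (simp add: qpn distrib_left mult.assoc pn)
  finally have p: "psd p" by (rule psd_if_psd_cube[OF ap])
  have "psd ((n * n) * q)"
    by (rule psd_mult[OF psd_square[OF an] q(1)]) (simp add: mult.assoc nq nq')
  also have "(n * n) * q = n * n * n" by (simp add: qpn distrib_left mult.assoc np)
  finally have n: "psd n" by (rule psd_if_psd_cube[OF an])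
  show thesis
  proof (rule that[OF p n _ pn np])
    show "a = p - n" by (simp add: p_def n_def flip: scaleR_diff_right scaleR_2)
    have "x * p = p * x \<and> x * n = n * x" if x: "x * a = a * x" for x
    proof -
      have "x * (a * a) = (a * a) * x" using x by (metis mult.assoc)
      then have "x * q = q * x" using q(4) by blast
      then show ?thesis using x by (simp add: p_def n_def algebra_simps)
    qed
    then show "\<forall>x. x * a = a * x \<longrightarrow> x * p = p * x \<and> x * n = n * x" by blast
  qed
qed

text \<open>\<open>h\<close> and \<open>k\<close> are twice the real and imaginary parts of
  \<open>z\<close>, and \<open>h\<^sup>2 + k\<^sup>2\<close> is twice the sum in question because
  the mixed terms cancel.\<close>

lemma psd_adj_mult_add:
  fixes z :: "'a::unital_cstar_algebra"
  shows "psd (adj z * z + z * adj z)"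
proof -
  define h where "h = z + adj z"
  define k where "k = \<i> *\<^sub>C (adj z - z)"
  have h: "adj h = h" by (simp add: h_def adj_simps)
  have k: "adj k = k" by (simp add: k_def adj_simps scaleC_minus_left flip: scaleC_minus_right)
  have "k * k = - ((adj z - z) * (adj z - z))"
    using scaleC_of_real[of "-1" "(adj z - z) * (adj z - z)"]
    by (simp add: k_def mult_scaleC_left mult_scaleC_right scaleC_scaleC)
  then have "h * h + k * k = 2 *\<^sub>R (adj z * z + z * adj z)"
    by (simp add: h_def algebra_simps scaleR_2)
  moreover have "psd (h * h + k * k)" by (intro psd_add psd_square h k)
  ultimately have "psd ((1/2) *\<^sub>R 2 *\<^sub>R (adj z * z + z * adj z))"
    by (intro psd_scaleR[where r="1/2"]) simp_all
  then show ?thesis by simp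
qed

text \<open>With \<open>s\<^sup>2 = - y y\<^sup>*\<close> and \<open>z = s y\<close>, both \<open>z\<^sup>* z\<close> and \<open>z z\<^sup>*\<close> are negative, while
  their sum is positive.\<close>

lemma eq_0_if_adj_mult_self_neg:
  fixes y :: "'a::unital_cstar_algebra"
  assumes q: "psd (adj y * y)" and p: "psd (- (y * adj y))"
  shows "y = 0"
proof -
  obtain r where r: "adj r = r" "r * r = adj y * y" using q by (auto simp: psd_def)
  obtain s where s: "adj s = s" "s * s = - (y * adj y)" using p by (auto simp: psd_def)
  define z where "z = s * y"
  define A where "A = adj y * y * (adj y * y)"
  define B where "B = y * adj y * (y * adj y)"
  have az: "adj z = adj y * s" by (simp add: z_def adj_simps s)
  have "z * adj z = s * (y * adj y) * s" unfolding az by (simp add: z_def mult.assoc)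
  also have "\<dots> = - (s * (s * s) * s)" by (simp add: s(2))
  also have "s * (s * s) * s = (s * s) * (s * s)" by (simp add: mult.assoc)
  finally have zz: "z * adj z = - B" by (simp add: s(2) B_def)
  have "adj z * z = adj y * (s * s) * y" unfolding az by (simp add: z_def mult.assoc)
  also have "\<dots> = - A" by (simp add: s(2) A_def mult.assoc)
  finally have "psd (- A - B)" using psd_adj_mult_add[of z] zz by simp
  have A: "psd A" unfolding A_def by (rule psd_square) (simp add: adj_simps)
  have B: "psd B" unfolding B_def by (rule psd_square) (simp add: adj_simps)
  from psd_add[OF \<open>psd (- A - B)\<close> B] have "psd (- A)" by simp
  with A have "A = 0" by (rule psd_antisym)
  then have "adj y * y = 0" unfolding A_def
    by (rule selfadjoint_square_eq_0[rotated]) (simp add: adj_simps)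
  then show ?thesis by simp
qed

text \<open>For the negative part \<open>n\<close> of \<open>adj x * x\<close> and
  \<open>y = x * n\<close>, the element \<open>adj y * y = - n\<^sup>3\<close> is negative, which by
  \<open>psd_adj_mult_add\<close> makes \<open>y * adj y\<close> positive. Such a \<open>y\<close>
  vanishes, hence so does \<open>n\<close>.\<close>

lemma psd_adj_mult_self:
  fixes x :: "'a::unital_cstar_algebra"
  shows "psd (adj x * x)"
proof -
  have "adj (adj x * x) = adj x * x" by (simp add: adj_simps)
  then obtain p n where pn: "psd p" "psd n" "adj x * x = p - n" "p * n = 0" "n * p = 0"
    by (rule pos_neg_parts)
  have an: "adj n = n" by (rule psd_adj[OF pn(2)])
  define y where "y = x * n"
  have ay: "adj y = n * adj x" by (simp add: y_def adj_simps an)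
  have "adj y * y = n * (adj x * x) * n" unfolding ay by (simp add: y_def mult.assoc)
  also have "\<dots> = - (n * n * n)" by (simp add: pn(3) pn(5) right_diff_distrib left_diff_distrib)
  finally have yy: "adj y * y = - (n * n * n)" .
  have nnn: "psd (n * n * n)" by (intro psd_mult psd_square an pn) (simp add: mult.assoc)
  have "psd (y * adj y)" using psd_add[OF psd_adj_mult_add[of y] nnn] by (simp add: yy)
  then have "adj y = 0"
    using nnn by (intro eq_0_if_adj_mult_self_neg[of "adj y"]) (simp_all add: adj_adj yy)
  then have "n * n * n = 0" using yy by simp
  then have "n * n * (n * n) = 0" by (simp add: mult.assoc)
  then have "n * n = 0" by (rule selfadjoint_square_eq_0[rotated]) (simp add: adj_mult an)
  then have "n = 0" by (rule selfadjoint_square_eq_0[OF an])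
  then show ?thesis using pn by simp
qed

lemma psd_mult_adj_self: "psd (x * adj (x::'a::unital_cstar_algebra))"
  using psd_adj_mult_self[of "adj x"] by (simp add: adj_adj)

lemma positive_iff_psd: "positive (a::'a::unital_cstar_algebra) \<longleftrightarrow> psd a"
proof
  show "positive a \<Longrightarrow> psd a" by (auto simp: positive_def psd_adj_mult_self)
  assume "psd a"
  then obtain h where "adj h = h" "h * h = a" by (auto simp: psd_def)
  then have "a = adj h * h" by simp
  then show "positive a" unfolding positive_def by blast
qed

lemma psd_conj:
  fixes a :: "'a::unital_cstar_algebra"
  assumes "psd a" shows "psd (adj x * a * x)"
proof -
  obtain h where "adj h = h" "h * h = a" using assms by (auto simp: psd_def)
  then have "adj (h * x) * (h * x) = adj x * a * x" by (simp add: adj_mult mult.assoc flip: \<open>h * h = a\<close>)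
  then show ?thesis using psd_adj_mult_self[of "h * x"] by simp
qed

lemma psd_conj': "psd a \<Longrightarrow> psd (x * a * adj (x::'a::unital_cstar_algebra))"
  using psd_conj[of a "adj x"] by (simp add: adj_adj)

lemma norm_conj_mono:
  fixes a b :: "'a::unital_cstar_algebra"
  assumes "psd a" "psd (b - a)"
  shows "norm (adj x * a * x) \<le> norm (adj x * b * x)"
  using psd_norm_mono[OF psd_conj[OF assms(1)], of "adj x * b * x" x] psd_conj[OF assms(2), of x]
  by (simp add: right_diff_distrib left_diff_distrib)

lemma mult_eq_0_if_conj_eq_0:
  fixes a :: "'a::unital_cstar_algebra"
  assumes "psd a" "adj x * a * x = 0"
  shows "a * x = 0"
proof -
  obtain h where h: "adj h = h" "h * h = a" using assms by (auto simp: psd_def)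
  then have "adj (h * x) * (h * x) = adj x * a * x" by (simp add: adj_mult mult.assoc flip: h(2))
  then have "h * x = 0" using assms by simp
  then show ?thesis by (simp add: h(2)[symmetric] mult.assoc)
qed

section \<open>Approximate division by a positive contraction\<close>

lemma norm_power_le_one:
  fixes r :: "'a::unital_cstar_algebra"
  assumes "norm r \<le> 1" shows "norm (r ^ n) \<le> 1"
proof (induction n)
  case (Suc n)
  have "norm (r * r ^ n) \<le> norm r * norm (r ^ n)" by (rule norm_mult_ineq)
  also have "\<dots> \<le> 1 * 1" using assms Suc by (intro mult_mono) auto
  finally show ?case by simp
qed (use norm_one_le in simp)

text \<open>Operator form of \<open>t (1 - t)^n \<le> 1/n\<close> on the unit interval:
  \<open>1 - r^n\<close> is the sum of the \<open>n\<close> elements \<open>d r^k\<close> with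
  \<open>k < n\<close>, each of which is at least \<open>d r^n\<close>.\<close>

lemma norm_mult_power_one_minus_le:
  fixes d :: "'a::unital_cstar_algebra"
  assumes d: "psd d" "norm d \<le> 1"
  shows "real n * norm (d * (1 - d) ^ n) \<le> 1"
proof -
  define r where "r = 1 - d"
  have r: "psd r" using psd_diff_norm(1)[OF psd_adj[OF d(1)], of 1] d by (simp add: r_def)
  have dr: "d * r = r * d" by (simp add: r_def algebra_simps)
  have drn: "d * r ^ n = r ^ n * d" for n
  proof (induction n)
    case (Suc n)
    have "d * r ^ Suc n = r * (d * r ^ n)" by (simp add: dr flip: mult.assoc)
    then show ?case by (simp add: Suc mult.assoc)
  qed simp
  have pdrn: "psd (d * r ^ n)" for n by (intro psd_mult d psd_power r drn)
  have "psd (1 - r ^ n - real n *\<^sub>R (d * r ^ n))" for n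
  proof (induction n)
    case (Suc n)
    have ddr: "psd (d * (d * r ^ n))"
      by (intro psd_mult d pdrn) (simp add: mult.assoc, simp add: drn)
    have e1: "r ^ Suc n = r ^ n - d * r ^ n"
      by (simp add: r_def left_diff_distrib)
    have e2: "d * r ^ Suc n = d * r ^ n - d * (d * r ^ n)"
      by (simp add: r_def left_diff_distrib right_diff_distrib)
    have eq: "1 - r ^ Suc n - real (Suc n) *\<^sub>R (d * r ^ Suc n)
        = (1 - r ^ n - real n *\<^sub>R (d * r ^ n)) + real (Suc n) *\<^sub>R (d * (d * r ^ n))"
      unfolding e1 e2 by (simp add: algebra_simps)
    show ?case unfolding eq by (intro psd_add Suc psd_scaleR ddr) simp
  qed simp
  from psd_add[OF this[of n] psd_power[OF r, of n]] have "psd (1 *\<^sub>R 1 - real n *\<^sub>R (d * r ^ n))" by simp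
  from selfadjoint_le_norm[OF psd_scaleR[OF pdrn] this] show ?thesis by (simp add: r_def)
qed

text \<open>For \<open>r = 1 - d\<close>, the inequality \<open>g * g \<le> d\<close> bounds the
  square of \<open>norm (g * r ^ n)\<close> by \<open>norm (r ^ n * d * r ^ n)\<close>, which is at
  most \<open>1/n\<close>. So polynomials in \<open>d\<close> without constant term act as right
  units on \<open>g\<close> in the limit, although \<open>g\<close> need not be a multiple of
  \<open>d\<close>.\<close>

lemma tendsto_mult_one_minus_power:
  fixes c d :: "'a::unital_cstar_algebra"
  assumes g: "adj g = g" and le: "psd (d - g * g)" and d: "norm d \<le> 1"
  shows "(\<lambda>n. g * (1 - (1 - d) ^ n)) \<longlonglongrightarrow> g"
proof -
  have pd: "psd d" using psd_add[OF le psd_square[OF g]] by simp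
  define r where "r = 1 - d"
  have r: "psd r" "norm r \<le> 1"
    using psd_diff_norm(1)[OF psd_adj[OF pd], of 1] psd_norm_diff_le[OF pd d] d by (simp_all add: r_def)
  have bound: "norm (g * r ^ n) \<le> sqrt (inverse (real n))" if "n > 0" for n
  proof -
    have ar: "adj (r ^ n) = r ^ n" by (rule psd_adj[OF psd_power[OF r(1)]])
    have "(norm (g * r ^ n))\<^sup>2 = norm (adj (r ^ n) * (g * g) * r ^ n)"
      by (simp add: norm_adj_mult_self[symmetric] adj_mult g mult.assoc)
    also have "\<dots> \<le> norm (adj (r ^ n) * d * r ^ n)" by (rule norm_conj_mono[OF psd_square[OF g] le])
    also have "\<dots> \<le> norm (r ^ n) * norm (d * r ^ n)" unfolding ar mult.assoc by (rule norm_mult_ineq)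
    also have "\<dots> \<le> 1 * norm (d * r ^ n)" by (intro mult_right_mono norm_power_le_one r) simp
    also have "\<dots> \<le> inverse (real n)"
      using norm_mult_power_one_minus_le[OF pd d, of n] that by (simp add: r_def field_simps)
    finally show ?thesis by (rule real_le_rsqrt)
  qed
  have "(\<lambda>n. sqrt (inverse (real n))) \<longlonglongrightarrow> 0"
    using tendsto_real_sqrt[OF lim_inverse_n[where 'a=real]] by simp
  moreover have "\<forall>\<^sub>F n in sequentially. norm (g * r ^ n) \<le> sqrt (inverse (real n))"
    by (rule eventually_sequentiallyI[of 1]) (rule bound, simp)
  ultimately have "(\<lambda>n. g * r ^ n) \<longlonglongrightarrow> 0" by (rule Lim_null_comparison[rotated])
  from tendsto_diff[OF tendsto_const this, of g] show ?thesis
    by (simp add: r_def right_diff_distrib)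
qed

lemma one_minus_power_eq:
  fixes d :: "'a::unital_cstar_algebra"
  shows "d * (\<Sum>k<n. (1 - d) ^ k) = 1 - (1 - d) ^ n"
  by (induction n) (simp_all add: distrib_left left_diff_distrib)

text \<open>The factor \<open>d\<close> in \<open>z n * d\<close> keeps the sequence inside every ideal that contains \<open>d\<close>.\<close>

lemma le_imp_limit_of_conjugates:
  fixes c d :: "'a::unital_cstar_algebra"
  assumes c: "psd c" and le: "psd (d - c)" and d: "norm d \<le> 1"
  obtains z where "(\<lambda>n. (z n * d) * d * adj (z n * d)) \<longlonglongrightarrow> c"
proof -
  obtain g where g: "adj g = g" "g * g = c" using c by (auto simp: psd_def)
  have pd: "psd d" using psd_add[OF le c] by simp
  have ad: "adj d = d" by (rule psd_adj[OF pd])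
  obtain s where s: "adj s = s" "s * s = d" "\<forall>x. x * d = d * x \<longrightarrow> x * s = s * x"
    using psd_sqrt[OF pd] by metis
  \<comment> \<open>\<open>q n\<close> imitates an inverse of \<open>d\<close>: the product
    \<open>d * q n\<close> is \<open>E n\<close>, which acts like a unit on \<open>g\<close> in the
    limit.\<close>
  define q where "q n = (\<Sum>k<n. (1 - d) ^ k)" for n :: nat
  define E where "E n = 1 - (1 - d) ^ n" for n :: nat
  have ar: "adj ((1 - d) ^ n) = (1 - d) ^ n" for n
    by (induction n) (simp_all add: adj_simps ad power_commutes)
  have rd: "(1 - d) ^ n * d = d * (1 - d) ^ n" for n
  proof (induction n)
    case (Suc n)
    have "(1 - d) ^ Suc n * d = (1 - d) * d * (1 - d) ^ n" by (simp add: mult.assoc Suc)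
    also have "(1 - d) * d = d * (1 - d)" by (simp add: algebra_simps)
    finally show ?case by (simp add: mult.assoc)
  qed simp
  have qd: "q n * d = d * q n" for n by (simp add: q_def sum_distrib_left sum_distrib_right rd)
  have qs: "q n * s = s * q n" for n using s(3) qd by blast
  have aq: "adj (q n) = q n" and aE: "adj (E n) = E n" for n
    by (simp_all add: q_def E_def adj_sum adj_diff ar)
  have E: "E n = d * q n" for n by (simp add: E_def q_def one_minus_power_eq)
  have Ed: "E n * d = d * E n" and Es: "E n * s = s * E n" for n
  proof -
    show Ed: "E n * d = d * E n" by (simp add: E mult.assoc qd)
    then show "E n * s = s * E n" using s(3) by blast
  qed
  have gE: "(\<lambda>n. g * E n) \<longlonglongrightarrow> g" unfolding E_def
    by (rule tendsto_mult_one_minus_power) (use g le d in simp_all)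
  have nE: "norm (E n) \<le> 2" for n
    using norm_triangle_ineq4[of 1 "(1 - d) ^ n"] norm_one_le[where 'a='a]
      norm_power_le_one[of "1 - d" n] psd_norm_diff_le[OF pd d] by (simp add: E_def)
  have "(\<lambda>n. (g * E n - g) * E n) \<longlonglongrightarrow> 0"
  proof (rule Lim_null_comparison)
    show "\<forall>\<^sub>F n in sequentially. norm ((g * E n - g) * E n) \<le> norm (g * E n - g) * 2"
      by (rule always_eventually) (auto intro!: order_trans[OF norm_mult_ineq] mult_left_mono nE)
    show "(\<lambda>n. norm (g * E n - g) * 2) \<longlonglongrightarrow> 0"
      using tendsto_mult_left_zero[OF tendsto_norm_zero[OF LIM_zero[OF gE]]] .
  qed
  from tendsto_add[OF this gE] have gEE: "(\<lambda>n. g * E n * E n) \<longlonglongrightarrow> g"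
    by (simp add: left_diff_distrib)
  show thesis
  proof (rule that)
    \<comment> \<open>The middle \<open>d\<close>, the two outer ones and \<open>s * s\<close> make
      \<open>d^4\<close>; with the four copies of \<open>q n\<close> this becomes the fourth power
      of \<open>E n\<close>, shared equally by the two sides.\<close>
    have "(g * s * q n * q n * d) * d * adj (g * s * q n * q n * d) = (g * E n * E n) * adj (g * E n * E n)" for n
    proof -
      have qd': "q n * (d * x) = d * (q n * x)" for x by (simp add: qd flip: mult.assoc)
      have qs': "q n * (s * x) = s * (q n * x)" for x by (simp add: qs flip: mult.assoc)
      have sd: "s * d = d * s" by (simp add: mult.assoc flip: s(2))
      have sd': "s * (d * x) = d * (s * x)" for x by (simp add: sd flip: mult.assoc)
      have ss: "s * (s * x) = d * x" for x by (simp add: s(2) flip: mult.assoc)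
      show ?thesis
        by (simp add: adj_mult ad aq aE g s(1) E mult.assoc qd qd' qs qs' sd sd' ss s(2))
    qed
    moreover have "(\<lambda>n. (g * E n * E n) * adj (g * E n * E n)) \<longlonglongrightarrow> g * adj g"
      by (intro tendsto_mult tendsto_adj gEE)
    ultimately show "(\<lambda>n. (g * s * q n * q n * d) * d * adj (g * s * q n * q n * d)) \<longlonglongrightarrow> c"
      using g by simp
  qed
qed

section \<open>Cuntz subequivalence and the order of the multiplier algebra\<close>

lemma multiplier_of_simps:
  "multiplier_of (0::'a::cstar_algebra) = 0"
  "multiplier_of (a - b) = multiplier_of a - multiplier_of (b::'a)"
  "multiplier_of (r *\<^sub>R a) = r *\<^sub>R multiplier_of (a::'a)"
proof -
  show "multiplier_of (0::'a) = 0" by (simp add: norm_multiplier_of flip: norm_eq_zero)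
  show "multiplier_of (r *\<^sub>R a) = r *\<^sub>R multiplier_of a" for r and a :: 'a
    using multiplier_of_hom(3)[of "of_real r" a] by (simp add: scaleC_of_real)
  from this[of "-1"] show "multiplier_of (a - b) = multiplier_of a - multiplier_of (b::'a)"
    using multiplier_of_hom(1)[of a "-b"] by simp
qed

lemmas mult_of_simps = multiplier_of_simps multiplier_of_hom

lemma multiplier_of_eq_iff [simp]: "multiplier_of a = multiplier_of b \<longleftrightarrow> a = b"
  using norm_multiplier_of[of "a - b"] by (auto simp: mult_of_simps)

lemma multiplier_of_eq_0_iff [simp]: "multiplier_of a = 0 \<longleftrightarrow> a = 0"
  using multiplier_of_eq_iff[of a 0] by (simp add: mult_of_simps del: multiplier_of_eq_iff)

lemma multiplier_of_sum: "multiplier_of (sum f A) = (\<Sum>i\<in>A. multiplier_of (f i))"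
  by (induction A rule: infinite_finite_induct) (simp_all add: mult_of_simps)

lemma psd_multiplier_of: "positive a \<Longrightarrow> psd (multiplier_of a)"
  by (auto simp: positive_def mult_of_simps psd_adj_mult_self)

lemma cuntz_le_iff: "a \<preceq> b \<longleftrightarrow> (\<exists>x. (\<lambda>n. x n * b * adj (x n)) \<longlonglongrightarrow> a)"
  unfolding cuntz_le_def by (simp add: tendsto_norm_zero_iff LIM_zero_iff)

lemma conj_cuntz_le: "x * b * adj x \<preceq> b"
  unfolding cuntz_le_iff by (rule exI[of _ "\<lambda>_. x"]) simp

lemma cuntz_le_trans:
  assumes ab: "a \<preceq> b" and bc: "b \<preceq> (c::'a::cstar_algebra)"
  shows "a \<preceq> c"
proof -
  obtain x where x: "(\<lambda>n. x n * b * adj (x n)) \<longlonglongrightarrow> a" using ab by (auto simp: cuntz_le_iff)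
  obtain y where y: "(\<lambda>n. y n * c * adj (y n)) \<longlonglongrightarrow> b" using bc by (auto simp: cuntz_le_iff)
  have "\<exists>m. norm (x n * (y m * c * adj (y m)) * adj (x n) - x n * b * adj (x n)) < inverse (real (Suc n))" for n
  proof -
    have "(\<lambda>m. x n * (y m * c * adj (y m)) * adj (x n)) \<longlonglongrightarrow> x n * b * adj (x n)"
      by (intro tendsto_intros y)
    from LIMSEQ_D[OF this, of "inverse (real (Suc n))"] show ?thesis by auto
  qed
  then obtain m where m: "norm (x n * (y (m n) * c * adj (y (m n))) * adj (x n) - x n * b * adj (x n))
      < inverse (real (Suc n))" for n by metis
  have "(\<lambda>n. x n * (y (m n) * c * adj (y (m n))) * adj (x n) - x n * b * adj (x n)) \<longlonglongrightarrow> 0"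
    by (rule Lim_null_comparison[OF _ LIMSEQ_inverse_real_of_nat])
      (use m in \<open>auto intro!: always_eventually less_imp_le\<close>)
  from tendsto_add[OF this x]
  have "(\<lambda>n. (x n * y (m n)) * c * adj (x n * y (m n))) \<longlonglongrightarrow> a"
    by (simp add: adj_mult mult.assoc)
  then show ?thesis by (auto simp: cuntz_le_iff)
qed

text \<open>The limit is found in the multiplier algebra, but \<open>z n * d\<close> lies in the
  algebra, an ideal there, so it is an admissible conjugator. Scaling both elements by
  \<open>t\<close> provides the norm bound on \<open>d\<close>.\<close>

lemma cuntz_le_if_le:
  fixes c d :: "'a::cstar_algebra"
  assumes c: "psd (multiplier_of c)" and le: "psd (multiplier_of d - multiplier_of c)"
  shows "c \<preceq> d"
proof (cases "d = 0")
  case True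
  then have "c = 0" using psd_antisym[of "multiplier_of c"] c le by (simp add: mult_of_simps)
  then show ?thesis unfolding cuntz_le_iff by (intro exI[of _ "\<lambda>_. 0"]) simp
next
  case False
  define t where "t = inverse (norm d)"
  have t: "t > 0" using False by (simp add: t_def)
  let ?c = "multiplier_of (t *\<^sub>R c)" and ?d = "multiplier_of (t *\<^sub>R d)"
  have t_facts: "psd ?c" "psd (?d - ?c)" "norm ?d \<le> 1"
    using psd_scaleR[OF c, of t] psd_scaleR[OF le, of t] t False
    by (simp_all add: mult_of_simps scaleR_diff_right norm_multiplier_of t_def)
  obtain z where z: "(\<lambda>n. (z n * ?d) * ?d * adj (z n * ?d)) \<longlonglongrightarrow> ?c"
    by (rule le_imp_limit_of_conjugates[OF t_facts])
  define x where "x n = lmul (z n) (t *\<^sub>R d)" for n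
  have zx: "z n * ?d = multiplier_of (x n)" for n by (simp add: x_def multiplier_of_ideal(1))
  have "(z n * ?d) * ?d * adj (z n * ?d) = multiplier_of (t *\<^sub>R (x n * d * adj (x n)))" for n
    unfolding zx by (simp add: mult_of_simps)
  with z have "(\<lambda>n. multiplier_of (t *\<^sub>R (x n * d * adj (x n)))) \<longlonglongrightarrow> ?c" by simp
  from tendsto_norm_zero[OF LIM_zero[OF this]]
  have "(\<lambda>n. norm (t *\<^sub>R (x n * d * adj (x n)) - t *\<^sub>R c)) \<longlonglongrightarrow> 0"
    by (simp only: norm_multiplier_of multiplier_of_simps(2)[symmetric])
  from LIM_zero_cancel[OF tendsto_norm_zero_cancel[OF this]]
  have "(\<lambda>n. t *\<^sub>R (x n * d * adj (x n))) \<longlonglongrightarrow> t *\<^sub>R c" .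
  from tendsto_scaleR[OF tendsto_const[of "inverse t"] this]
  have "(\<lambda>n. x n * d * adj (x n)) \<longlonglongrightarrow> c" using t by simp
  then show ?thesis by (auto simp: cuntz_le_iff)
qed

lemma cuntz_le_if_le_conj:
  fixes c d :: "'a::cstar_algebra"
  assumes "psd (multiplier_of c)" "psd (multiplier_of (x * d * adj x) - multiplier_of c)"
  shows "c \<preceq> d"
  using cuntz_le_trans[OF cuntz_le_if_le[OF assms] conj_cuntz_le] .

section \<open>Order separability of the Cuntz semigroup\<close>

text \<open>\<open>f\<close> and \<open>n\<close> are the positive and negative parts of
  \<open>a - l\<close>. If \<open>a * f = 0\<close>, then \<open>f * f = - l f\<close> forces
  \<open>f = 0\<close>, so \<open>a \<le> l\<close>, against \<open>l < norm a\<close>.\<close>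

lemma psd_truncation:
  fixes a :: "'a::unital_cstar_algebra"
  assumes a: "psd a" and l: "0 < l" "l < norm a"
  obtains f n where "psd f" "psd n" "a - l *\<^sub>R 1 = f - n" "f * n = 0" "n * f = 0"
    "a * f = f * a" "a * n = n * a" "a * f \<noteq> 0"
proof -
  have "adj (a - l *\<^sub>R 1) = a - l *\<^sub>R 1" by (simp add: adj_simps psd_adj[OF a])
  then obtain f n where fn: "psd f" "psd n" "a - l *\<^sub>R 1 = f - n" "f * n = 0" "n * f = 0"
    "\<forall>x. x * (a - l *\<^sub>R 1) = (a - l *\<^sub>R 1) * x \<longrightarrow> x * f = f * x \<and> x * n = n * x"
    by (rule pos_neg_parts)
  have comm: "a * f = f * a" "a * n = n * a"
    using fn(6)[rule_format, of a] by (simp_all add: algebra_simps)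
  have "a * f \<noteq> 0"
  proof
    assume "a * f = 0"
    have "f * f = (a - l *\<^sub>R 1) * f" unfolding fn(3) by (simp add: left_diff_distrib fn)
    also have "\<dots> = - (l *\<^sub>R f)" by (simp add: left_diff_distrib \<open>a * f = 0\<close>)
    finally have "psd (- (l *\<^sub>R f))" using psd_square[OF psd_adj[OF fn(1)]] by simp
    then have "l *\<^sub>R f = 0" using psd_antisym psd_scaleR[OF fn(1)] l by (meson less_imp_le)
    then have "f = 0" using l by simp
    then have "l *\<^sub>R 1 - a = n" using fn(3) by (simp add: algebra_simps)
    then have "norm a \<le> l" using selfadjoint_le_norm[OF a, of l] fn(2) l by simp
    then show False using l by simp
  qed
  then show thesis using that fn comm by blast
qed

lemma bounded_linear_multiplier_of: "bounded_linear (multiplier_of :: 'a::cstar_algebra \<Rightarrow> 'a multiplier)"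
  by (rule bounded_linear_intro[where K=1]) (simp_all add: mult_of_simps norm_multiplier_of)

lemmas continuous_on_multiplier_of [continuous_intros] =
  bounded_linear.continuous_on[OF bounded_linear_multiplier_of]

text \<open>Meant for the negative part \<open>n\<close> of a positive element minus a constant
  \<open>l\<close>: on the annihilator of \<open>n\<close> that element is bounded below by
  \<open>l\<close>. For heredity, \<open>0 \<le> a \<le> b\<close> and \<open>n b n = 0\<close> give
  \<open>n a n = 0\<close>, and then \<open>a n = 0\<close>.\<close>

lemma hereditary_subalgebra_annihilator:
  fixes n :: "'a::cstar_algebra multiplier"
  assumes n: "adj n = n"
  shows "hereditary_subalgebra {x. n * multiplier_of x = 0 \<and> multiplier_of x * n = 0}"
    (is "hereditary_subalgebra ?B")
  unfolding hereditary_subalgebra_def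
proof (intro conjI allI impI)
  show "cstar_subalgebra ?B" unfolding cstar_subalgebra_def
  proof (intro conjI ballI allI)
    show "closed ?B"
      by (intro closed_Collect_conj closed_Collect_eq continuous_intros)
    show "adj x \<in> ?B" if x: "x \<in> ?B" for x
    proof -
      have "adj (n * multiplier_of x) = 0" "adj (multiplier_of x * n) = 0" using x by simp_all
      then show ?thesis by (simp add: adj_mult n mult_of_simps)
    qed
    show "x * y \<in> ?B" if "x \<in> ?B" "y \<in> ?B" for x y
      using that by (simp add: mult_of_simps mult.assoc) (simp flip: mult.assoc)
  qed (simp_all add: mult_of_simps distrib_left distrib_right mult_scaleC_left mult_scaleC_right
      scaleC_zero_right)
  fix a b assume a: "positive a" and b: "b \<in> ?B" and ab: "a \<sqsubseteq>\<^sub>+ b"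
  have "psd (multiplier_of b - multiplier_of a)"
    using psd_multiplier_of[of "b - a"] ab by (simp add: cstar_le_def mult_of_simps)
  from norm_conj_mono[OF psd_multiplier_of[OF a] this, of n] b
  have "adj n * multiplier_of a * n = 0" by (simp add: mult.assoc)
  then have an: "multiplier_of a * n = 0" by (rule mult_eq_0_if_conj_eq_0[OF psd_multiplier_of[OF a]])
  have "n * multiplier_of a = adj (multiplier_of a * n)"
    by (simp add: adj_mult n psd_adj[OF psd_multiplier_of[OF a]])
  then show "a \<in> ?B" using an by simp
qed

lemma projection_positive: "projection p \<Longrightarrow> positive p"
  by (auto simp: projection_def positive_def intro!: exI[of _ p])

text \<open>A projection \<open>P\<close> annihilated by the negative part of \<open>a - l\<close>
  satisfies \<open>P a P = P f P + l P \<ge> l P\<close>, so \<open>p\<close> lies below the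
  conjugate of \<open>a\<close> by \<open>p / sqrt l\<close>. Any \<open>l\<close> strictly between
  zero and \<open>norm a\<close> would serve.\<close>

lemma property_SP_projection_below:
  fixes a :: "'a::cstar_algebra"
  assumes SP: "property_SP TYPE('a)" and a: "positive a" "a \<noteq> 0"
  obtains p where "projection p" "p \<noteq> 0" "p \<preceq> a"
proof -
  define l where "l = norm a / 2"
  have l: "0 < l" "l < norm (multiplier_of a)" using a by (simp_all add: l_def norm_multiplier_of)
  obtain f n where fn: "psd f" "psd n" "multiplier_of a - l *\<^sub>R 1 = f - n" "f * n = 0" "n * f = 0"
    "multiplier_of a * f = f * multiplier_of a" "multiplier_of a * n = n * multiplier_of a"
    "multiplier_of a * f \<noteq> 0"
    by (rule psd_truncation[OF psd_multiplier_of[OF a(1)] l])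
  define B where "B = {x. n * multiplier_of x = 0 \<and> multiplier_of x * n = 0}"
  have "n * (multiplier_of a * f) = 0" unfolding fn(6) by (simp add: fn(5) flip: mult.assoc)
  moreover have "multiplier_of a * f * n = 0" by (simp add: fn(4) mult.assoc)
  ultimately have "rmul f a \<in> B" "rmul f a \<noteq> 0"
    using fn(8) unfolding multiplier_of_ideal(2) B_def by auto
  then have "B \<noteq> {0}" by blast
  moreover have "hereditary_subalgebra B"
    unfolding B_def by (rule hereditary_subalgebra_annihilator[OF psd_adj[OF fn(2)]])
  ultimately obtain p where p: "p \<in> B" "projection p" "p \<noteq> 0"
    using SP by (auto simp: property_SP_def)
  define P where "P = multiplier_of p"
  have P: "adj P = P" "P * P = P" "n * P = 0" "P * n = 0"
    using p(1,2) by (simp_all add: B_def P_def projection_def flip: multiplier_of_hom)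
  have "p \<preceq> a"
  proof (rule cuntz_le_if_le_conj)
    let ?x = "(1 / sqrt l) *\<^sub>R p"
    show "psd (multiplier_of p)" by (intro psd_multiplier_of projection_positive p)
    have "multiplier_of (?x * a * adj ?x) = (1 / l) *\<^sub>R (P * multiplier_of a * P)"
      using l P(1) by (simp add: mult_of_simps adj_simps P_def)
    also have "P * multiplier_of a * P = P * (f - n + l *\<^sub>R 1) * P"
      using fn(3) by (simp add: eq_diff_eq flip: fn(3))
    also have "\<dots> = P * f * P + l *\<^sub>R P"
      by (simp add: distrib_left distrib_right right_diff_distrib P)
    also have "(1 / l) *\<^sub>R (P * f * P + l *\<^sub>R P) = (1 / l) *\<^sub>R (P * f * P) + P"
      using l by (simp add: scaleR_add_right)
    finally show "psd (multiplier_of (?x * a * adj ?x) - multiplier_of p)"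
      using psd_scaleR[OF psd_conj[OF fn(1), of P], of "1 / l"] l P(1) by (simp add: P_def)
  qed
  then show thesis using that p by blast
qed

lemma order_separable_if_SP:
  assumes "property_SP TYPE('a::cstar_algebra)" "dimension_semigroup_order_separable TYPE('a)"
  shows "cuntz_semigroup_order_separable TYPE('a)"
proof -
  obtain p :: "nat \<Rightarrow> 'a" where p: "\<And>n. projection (p n)" "\<And>n. p n \<noteq> 0"
    "\<And>q. projection q \<Longrightarrow> q \<noteq> 0 \<Longrightarrow> \<exists>n. p n \<preceq> q"
    using assms(2) unfolding dimension_semigroup_order_separable_def by blast
  have "\<exists>n. p n \<preceq> a" if a: "positive a" "a \<noteq> 0" for a
  proof -
    obtain q where q: "projection q" "q \<noteq> 0" "q \<preceq> a"
      by (rule property_SP_projection_below[OF assms(1) a])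
    then show ?thesis using p(3) cuntz_le_trans by blast
  qed
  then show ?thesis unfolding cuntz_semigroup_order_separable_def
    by (intro exI[of _ p] conjI allI impI p(2) projection_positive[OF p(1)])
qed

text \<open>The witnesses are the increments \<open>e (Suc n) - e n\<close>, nonzero because
  approximate identities are strictly increasing.\<close>

lemma order_separable_if_continuous_scale:
  assumes "continuous_scale TYPE('a::cstar_algebra)"
  shows "cuntz_semigroup_order_separable TYPE('a)"
proof -
  obtain e :: "nat \<Rightarrow> 'a" where e: "approximate_identity e"
    and N: "\<And>a. positive a \<Longrightarrow> a \<noteq> 0 \<Longrightarrow> \<exists>N. \<forall>m n. m > n \<longrightarrow> n \<ge> N \<longrightarrow> e m - e n \<preceq> a"
    using assms unfolding continuous_scale_def by blast
  have "\<exists>n. e (Suc n) - e n \<preceq> a" if "positive a" "a \<noteq> 0" for a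
    using N[OF that] by blast
  moreover have "positive (e (Suc n) - e n) \<and> e (Suc n) - e n \<noteq> 0" for n
    using e by (auto simp: approximate_identity_def cstar_le_def) metis
  ultimately show ?thesis unfolding cuntz_semigroup_order_separable_def
    by (intro exI[of _ "\<lambda>n. e (Suc n) - e n"] conjI allI impI) simp_all
qed

text \<open>For \<open>b\<close> close to \<open>a\<close> and \<open>f = (b - 1/4)\<^sub>+\<close>, the element \<open>b f\<^sup>3 b\<close> depends on \<open>b\<close> only
  and lies below a conjugate of \<open>a\<close>.\<close>

lemma cuntz_below_perturbations:
  fixes b :: "'a::cstar_algebra"
  assumes b: "adj b = b"
  obtains s where "positive s"
    "\<And>a. positive a \<Longrightarrow> a \<noteq> 0 \<Longrightarrow> norm (b - (1 / norm a) *\<^sub>R a) \<le> 1/4 \<Longrightarrow> s \<noteq> 0 \<and> s \<preceq> a"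
proof -
  let ?b = "multiplier_of b"
  have ab: "adj ?b = ?b" using b by (simp flip: multiplier_of_hom)
  then have "adj (?b - (1/4) *\<^sub>R 1) = ?b - (1/4) *\<^sub>R 1" by (simp add: adj_simps)
  then obtain f n where fn: "psd f" "psd n" "?b - (1/4) *\<^sub>R 1 = f - n" "f * n = 0" "n * f = 0"
    "\<forall>x. x * (?b - (1/4) *\<^sub>R 1) = (?b - (1/4) *\<^sub>R 1) * x \<longrightarrow> x * f = f * x \<and> x * n = n * x"
    by (rule pos_neg_parts)
  have bf: "?b * f = f * ?b" using fn(6)[rule_format, of ?b] by (simp add: algebra_simps)
  have bn: "?b * n = n * ?b" using fn(6)[rule_format, of ?b] by (simp add: algebra_simps)
  have "?b * (f * x) = f * (?b * x)" "?b * (n * x) = n * (?b * x)" "f * (n * x) = 0" for x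
    by (simp_all add: bf bn fn(4) flip: mult.assoc)
  note comm = this bf bn
  have af: "adj f = f" by (rule psd_adj[OF fn(1)])
  obtain h where h: "adj h = h" "h * h = f" using fn(1) by (auto simp: psd_def)
  \<comment> \<open>Splitting off the root \<open>h\<close> of \<open>f\<close> writes
    \<open>b f^3 b\<close> as \<open>adj y * y\<close>, which exhibits \<open>s\<close> as a
    positive element of the algebra itself.\<close>
  define y where "y = lmul (h * f) b"
  have y: "multiplier_of y = h * f * ?b" by (simp add: y_def multiplier_of_ideal(1))
  define s where "s = adj y * y"
  define x where "x = rmul f b"
  have x: "multiplier_of x = ?b * f" by (simp add: x_def multiplier_of_ideal(2))
  have s: "multiplier_of s = ?b * (f * f * f) * ?b"
  proof -
    have "multiplier_of s = ?b * (f * (h * h) * f) * ?b"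
      by (simp add: s_def mult_of_simps y adj_mult h(1) af ab mult.assoc)
    then show ?thesis by (simp only: h(2))
  qed
  show thesis
  proof (rule that[of s])
    show ps: "positive s" by (auto simp: s_def positive_def)
    fix a assume a: "positive a" "a \<noteq> 0" and close: "norm (b - (1 / norm a) *\<^sub>R a) \<le> 1/4"
    let ?a = "multiplier_of ((1 / norm a) *\<^sub>R a)"
    have na: "norm ?a = 1" using a by (simp add: norm_multiplier_of)
    have pa: "psd ?a" using psd_multiplier_of[OF a(1)] by (simp add: mult_of_simps psd_scaleR)
    have "norm (?b - ?a) \<le> 1/4" using close by (simp add: norm_multiplier_of flip: mult_of_simps(2))
    then have le1: "psd ((1/4) *\<^sub>R 1 - (?b - ?a))" and le2: "psd ((1/4) *\<^sub>R 1 + (?b - ?a))"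
      using psd_diff_norm[of "?b - ?a"] psd_adj[OF pa] ab by (simp_all add: adj_diff)
    show "s \<noteq> 0 \<and> s \<preceq> a"
    proof
      show "s \<noteq> 0"
      proof
        assume "s = 0"
        then have "y = 0" by (simp add: s_def)
        then have "h * (h * f * ?b) = 0" using y by (simp add: mult_of_simps)
        then have "f * f * ?b = 0" by (simp add: h(2) flip: mult.assoc)
        moreover have "f * f * (?b - (1/4) *\<^sub>R 1) = f * f * f"
          unfolding fn(3) by (simp add: right_diff_distrib mult.assoc fn(4))
        ultimately have "- ((1/4) *\<^sub>R (f * f)) = f * f * f" by (simp add: right_diff_distrib)
        moreover have "psd (f * f * f)"
          by (intro psd_mult psd_square af fn(1)) (simp add: mult.assoc)
        ultimately have "(1/4) *\<^sub>R (f * f) = 0"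
          using psd_antisym[of "(1/4) *\<^sub>R (f * f)"] psd_scaleR[OF psd_square[OF af], of "1/4"] by simp
        then have "f * f = 0" by simp
        then have "f = 0" by (rule selfadjoint_square_eq_0[OF af])
        then have "(1/4) *\<^sub>R 1 - ?b = n" using fn(3) by (simp add: algebra_simps)
        then have "psd ((1/4) *\<^sub>R 1 - ?b)" using fn(2) by simp
        \<comment> \<open>If \<open>f = 0\<close> then \<open>b \<le> 1/4\<close>, and
          \<open>?a\<close> exceeds \<open>b\<close> by at most \<open>1/4\<close>; so
          \<open>?a \<le> 1/2\<close>, although \<open>?a\<close> has norm one.\<close>
        from psd_add[OF this le2] have "psd ((1/4) *\<^sub>R 1 + (1/4) *\<^sub>R 1 - ?a)" by (simp add: algebra_simps)
        then have "psd ((1/2) *\<^sub>R 1 - ?a)" by (simp flip: scaleR_add_left)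
        from selfadjoint_le_norm[OF pa this] na show False by simp
      qed
      show "s \<preceq> a"
      proof (rule cuntz_le_if_le_conj)
        let ?x = "(1 / sqrt (norm a)) *\<^sub>R x"
        show "psd (multiplier_of s)" by (rule psd_multiplier_of[OF ps])
        have ax: "adj (multiplier_of x) = ?b * f" by (simp add: x adj_mult af ab bf)
        have "multiplier_of (?x * a * adj ?x) = (?b * f) * ?a * (?b * f)"
          using a ax by (simp add: mult_of_simps adj_simps x)
        \<comment> \<open>Because \<open>(b - 1/4) f = f\<^sup>2\<close>, the element
          \<open>s\<close> is the conjugate of \<open>b - 1/4\<close> by \<open>b f\<close>.
          Subtracting it from the conjugate of \<open>?a\<close> leaves the conjugate of
          \<open>1/4 - (b - ?a)\<close>, which is positive.\<close>
        moreover have "multiplier_of s = (?b * f) * (?b - (1/4) *\<^sub>R 1) * (?b * f)"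
          unfolding s fn(3) by (simp add: comm mult.assoc right_diff_distrib left_diff_distrib)
        ultimately have "multiplier_of (?x * a * adj ?x) - multiplier_of s
            = (?b * f) * ((1/4) *\<^sub>R 1 - (?b - ?a)) * (?b * f)"
          by (simp add: right_diff_distrib left_diff_distrib)
        also have "psd \<dots>" using psd_conj[OF le1, of "?b * f"] ax x by simp
        finally show "psd (multiplier_of (?x * a * adj ?x) - multiplier_of s)" .
      qed
    qed
  qed
qed

text \<open>Every normalised positive element is within \<open>1/4\<close> of the self-adjoint part
  of some member of a dense sequence, since passing to self-adjoint parts does not increase the
  distance to a self-adjoint element.\<close>

lemma order_separable_if_separable:
  assumes sep: "separable_space (euclidean :: 'a::cstar_algebra topology)"
    and nz: "\<exists>a::'a. a \<noteq> 0"
  shows "cuntz_semigroup_order_separable TYPE('a)"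
proof -
  obtain C :: "'a set" where C: "countable C" "closure C = UNIV"
    using sep by (auto simp: separable_space_def)
  then have "C \<noteq> {}" by auto
  define c where "c = from_nat_into C"
  define b where "b n = (1/2) *\<^sub>R (c n + adj (c n))" for n
  obtain a0 :: 'a where "a0 \<noteq> 0" using nz by blast
  then have a0: "positive (adj a0 * a0)" "adj a0 * a0 \<noteq> 0" by (auto simp: positive_def)
  have "adj (b n) = b n" for n by (simp add: b_def adj_simps add.commute)
  then have "\<exists>s. positive s \<and> (\<forall>a. positive a \<longrightarrow> a \<noteq> 0 \<longrightarrow>
      norm (b n - (1 / norm a) *\<^sub>R a) \<le> 1/4 \<longrightarrow> s \<noteq> 0 \<and> s \<preceq> a)" for n
    by (rule cuntz_below_perturbations) blast
  then obtain s where s: "\<And>n. positive (s n)" "\<And>n a. positive a \<Longrightarrow> a \<noteq> 0 \<Longrightarrow>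
      norm (b n - (1 / norm a) *\<^sub>R a) \<le> 1/4 \<Longrightarrow> s n \<noteq> 0 \<and> s n \<preceq> a" by metis
  \<comment> \<open>\<open>s n\<close> may vanish when \<open>b n\<close> is close to no normalised
    positive element; an arbitrary nonzero positive element then takes its place.\<close>
  define s' where "s' n = (if s n = 0 then adj a0 * a0 else s n)" for n
  have "\<exists>n. s' n \<preceq> a" if a: "positive a" "a \<noteq> 0" for a
  proof -
    let ?a = "(1 / norm a) *\<^sub>R a"
    have aa: "adj ?a = ?a" using a(1) by (auto simp: positive_def adj_simps)
    have "?a \<in> closure C" unfolding C(2) by (rule UNIV_I)
    then have "\<exists>x\<in>C. dist x ?a < 1/4"
      unfolding closure_approachable by (rule allE[of _ "1/4"]) simp
    then obtain x where x: "x \<in> C" "dist x ?a < 1/4" by blast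
    obtain n where n: "c n = x" using from_nat_into_surj[OF C(1) x(1)] by (auto simp: c_def)
    have d: "norm (c n - ?a) \<le> 1/4" using x n by (simp add: dist_norm)
    have "b n - ?a = (1/2) *\<^sub>R ((c n - ?a) + adj (c n - ?a))"
      unfolding adj_diff aa by (simp add: b_def algebra_simps flip: scaleR_add_left)
    also have "norm \<dots> \<le> 1/2 * (1/4 + 1/4)"
      using norm_triangle_mono[OF d, of "adj (c n - ?a)" "1/4"] d by (simp add: norm_adj)
    finally have "norm (b n - ?a) \<le> 1/4" by simp
    from s(2)[OF a this] show ?thesis by (auto simp: s'_def intro!: exI[of _ n])
  qed
  moreover have "positive (s' n) \<and> s' n \<noteq> 0" for n using s(1) a0 by (simp add: s'_def)
  ultimately show ?thesis unfolding cuntz_semigroup_order_separable_def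
    by (intro exI[of _ s'] conjI allI impI) simp_all
qed

section \<open>Orthogonal elements and minimal projections\<close>

text \<open>No closure is taken: elements must factor exactly through \<open>c\<close>, so that they
  can later be written as \<open>u * adj b\<close>.\<close>

definition corner :: "'a::cstar_algebra \<Rightarrow> 'a set" where
  "corner c = range (\<lambda>x. c * x * c)"

definition minimal_projection :: "'a::cstar_algebra \<Rightarrow> bool" where
  "minimal_projection p \<longleftrightarrow> projection p \<and> p \<noteq> 0 \<and> (\<forall>x. \<exists>c. p * x * p = c *\<^sub>C p)"

definition splits :: "'a::cstar_algebra \<Rightarrow> bool" where
  "splits c \<longleftrightarrow> (\<exists>t u. t \<in> corner c \<and> u \<in> corner c \<and> adj t = t \<and> adj u = u \<and>
     t \<noteq> 0 \<and> u \<noteq> 0 \<and> t * u = 0)"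

lemma cornerI: "x = c * y * c \<Longrightarrow> x \<in> corner c"
  by (auto simp: corner_def)

lemma corner_trans:
  assumes "b \<in> corner c" shows "corner b \<subseteq> corner c"
proof
  fix x assume "x \<in> corner b"
  then obtain y where y: "x = b * y * b" by (auto simp: corner_def)
  obtain z where z: "b = c * z * c" using assms by (auto simp: corner_def)
  have "x = c * (z * c * y * c * z) * c" by (simp add: y z mult.assoc)
  then show "x \<in> corner c" by (rule cornerI)
qed

lemma splits_mono: "b \<in> corner c \<Longrightarrow> splits b \<Longrightarrow> splits c"
  unfolding splits_def using corner_trans by blast

lemma corner_scaleR: "x \<in> corner c \<Longrightarrow> r *\<^sub>R x \<in> corner c"
  by (auto simp: corner_def image_iff) (metis mult_scaleR_left mult_scaleR_right)

lemma corner_diff: "x \<in> corner c \<Longrightarrow> y \<in> corner c \<Longrightarrow> x - y \<in> corner c"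
  by (auto simp: corner_def image_iff) (metis left_diff_distrib right_diff_distrib)

lemma corner_add: "x \<in> corner c \<Longrightarrow> y \<in> corner c \<Longrightarrow> x + y \<in> corner c"
  by (auto simp: corner_def image_iff) (metis distrib_left distrib_right)

text \<open>With \<open>a = c\<^sup>2\<close>, the elements \<open>a (a - l)\<^sub>+ a\<close> and \<open>a (a - l)\<^sub>- a\<close> are orthogonal. If for every
  \<open>l < norm a\<close> one of them vanishes, then \<open>norm a\<close> is the only nonzero point in the spectrum of \<open>a\<close>.\<close>

lemma square_idempotent_if_not_splits:
  fixes c :: "'a::cstar_algebra"
  assumes c: "adj c = c" and ns: "\<not> splits c"
  shows "(c * c) * (c * c) = norm (c * c) *\<^sub>R (c * c)"
proof -
  define a where "a = c * c"
  define A where "A = multiplier_of a"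
  have "positive a" unfolding positive_def a_def by (rule exI[of _ c]) (simp add: c)
  then have pA: "psd A" unfolding A_def by (rule psd_multiplier_of)
  have aA: "adj A = A" by (rule psd_adj[OF pA])
  define N where "N = norm A"
  define D where "D = norm (A * A - N *\<^sub>R A)"
  have in_corner: "a * lmul f a \<in> corner c" for f
    by (rule cornerI[of _ _ "c * lmul f c"]) (simp add: a_def lmul_mult mult.assoc)
  have mult_corner: "multiplier_of (a * lmul f a) = A * f * A" for f
    by (simp add: A_def mult_of_simps multiplier_of_ideal(1)[symmetric] mult.assoc)
  \<comment> \<open>Equivalent to \<open>D \<le> 2 N (N - l)\<close>; letting \<open>l\<close> tend
    to \<open>N\<close> gives \<open>D = 0\<close>.\<close>
  have bound: "l \<le> N - D / (2 * N)" if l: "0 < l" "l < N" for l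
  proof -
    obtain f n where fn: "psd f" "psd n" "A - l *\<^sub>R 1 = f - n" "f * n = 0" "n * f = 0"
      "A * f = f * A" "A * n = n * A" "A * f \<noteq> 0"
      by (rule psd_truncation[OF pA l[unfolded N_def]])
    have adj_corner: "adj (a * lmul h a) = a * lmul h a" if "adj h = h" for h
    proof -
      have "multiplier_of (adj (a * lmul h a)) = multiplier_of (a * lmul h a)"
        unfolding multiplier_of_hom(4) mult_corner by (simp add: adj_mult aA that mult.assoc)
      then show ?thesis by (simp only: multiplier_of_eq_iff)
    qed
    have "multiplier_of (a * lmul f a) \<noteq> 0"
    proof
      assume "multiplier_of (a * lmul f a) = 0"
      then have "f * A = 0" using mult_eq_0_if_conj_eq_0[OF fn(1), of A] by (simp add: mult_corner aA)
      then show False using fn(6,8) by simp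
    qed
    moreover have "multiplier_of ((a * lmul f a) * (a * lmul n a)) = 0"
    proof -
      have "multiplier_of ((a * lmul f a) * (a * lmul n a)) = (A * f * A) * (A * n * A)"
        by (simp only: multiplier_of_hom(2)[of "a * lmul f a"] mult_corner)
      also have "\<dots> = A * (f * A) * (A * n) * A" by (simp only: mult.assoc)
      also have "\<dots> = A * (A * f) * (n * A) * A" by (simp only: fn(6)[symmetric] fn(7))
      also have "\<dots> = A * A * (f * n) * A * A" by (simp only: mult.assoc)
      finally show ?thesis by (simp only: fn(4) mult_zero_left mult_zero_right)
    qed
    \<comment> \<open>The two corner elements are self-adjoint and orthogonal and the first is
      nonzero, so the second must vanish.\<close>
    ultimately have "a * lmul n a = 0"
      using ns in_corner[of f] in_corner[of n] adj_corner psd_adj[OF fn(1)] psd_adj[OF fn(2)]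
      unfolding splits_def multiplier_of_eq_0_iff by blast
    then have "A * n * A = 0" using mult_corner[of n] by (simp add: mult_of_simps)
    then have nA: "n * A = 0" using mult_eq_0_if_conj_eq_0[OF fn(2), of A] by (simp add: aA)
    \<comment> \<open>\<open>f * f = (A - l) f \<le> (N - l) f\<close>, where
      \<open>A \<le> N\<close> is multiplied by the commuting positive \<open>f\<close>.\<close>
    have f: "norm f \<le> N - l"
    proof -
      have ff: "f * f = (A - l *\<^sub>R 1) * f" unfolding fn(3) by (simp add: left_diff_distrib fn)
      have pNA: "psd (N *\<^sub>R 1 - A)" unfolding N_def using psd_diff_norm(1)[OF aA order_refl] .
      have "psd (f * (N *\<^sub>R 1 - A))"
        by (rule psd_mult[OF fn(1) pNA]) (simp add: algebra_simps fn(6))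
      moreover have "f * (N *\<^sub>R 1 - A) = (N - l) *\<^sub>R f - f * f"
        unfolding ff by (simp add: algebra_simps fn(6))
      ultimately have "norm (f * f) \<le> norm ((N - l) *\<^sub>R f)"
        by (intro psd_norm_mono psd_square psd_adj fn(1)) simp
      then have "norm f * norm f \<le> (N - l) * norm f"
        using norm_selfadjoint_square[OF psd_adj[OF fn(1)]] l by (simp add: power2_eq_square)
      then show ?thesis using l by (cases "f = 0") (auto dest: mult_right_le_imp_le)
    qed
    have "A * A - l *\<^sub>R A = (A - l *\<^sub>R 1) * A" by (simp add: algebra_simps)
    also have "\<dots> = f * A" unfolding fn(3) by (simp add: left_diff_distrib nA)
    finally have "A * A - N *\<^sub>R A = f * A - (N - l) *\<^sub>R A" by (simp add: algebra_simps)
    then have "D \<le> norm (f * A) + norm ((N - l) *\<^sub>R A)" unfolding D_def by (metis norm_triangle_ineq4)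
    also have "norm (f * A) \<le> (N - l) * N"
      unfolding N_def by (rule order_trans[OF norm_mult_ineq]) (intro mult_right_mono, use f N_def in simp_all)
    also have "norm ((N - l) *\<^sub>R A) = (N - l) * N" using l by (simp add: N_def)
    finally show ?thesis using l by (simp add: field_simps)
  qed
  have "D = 0"
  proof (cases "N = 0")
    case True
    then show ?thesis by (simp add: D_def N_def)
  next
    case False
    then have "0 < N" by (simp add: N_def)
    then have "N \<le> N - D / (2 * N)" using bound by (rule dense_le_bounded)
    then have "D \<le> 0" using \<open>0 < N\<close> by (simp add: field_simps)
    then show ?thesis by (simp add: D_def)
  qed
  then have "multiplier_of (a * a) = multiplier_of (N *\<^sub>R a)" by (simp add: D_def A_def mult_of_simps)
  then show ?thesis unfolding multiplier_of_eq_iff by (simp add: a_def N_def A_def norm_multiplier_of)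
qed

text \<open>Corners inside a corner that does not split do not split either. For self-adjoint
  nonzero \<open>x\<close> in the corner of \<open>p\<close>, the square \<open>x * x\<close> is
  thus a multiple of a projection \<open>q\<close>, and \<open>q = p\<close> since \<open>q\<close>
  and \<open>p - q\<close> are orthogonal. Normalising gives \<open>y\<close> with
  \<open>y * y = p\<close>, and \<open>(p + y) * (p - y) = 0\<close> forces \<open>y\<close> to be
  \<open>p\<close> or \<open>- p\<close>. Real and imaginary parts then show that the whole corner
  consists of complex multiples of \<open>p\<close>.\<close>

lemma minimal_projection_if_not_splits:
  fixes c :: "'a::cstar_algebra"
  assumes c: "adj c = c" "c \<noteq> 0" and ns: "\<not> splits c"
  shows "\<exists>p::'a. minimal_projection p"
proof -
  have proj: "projection ((1 / norm (x * x)) *\<^sub>R (x * x)) \<and> (1 / norm (x * x)) *\<^sub>R (x * x) \<noteq> 0"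
    if x: "adj x = x" "x \<noteq> 0" "\<not> splits x" for x :: 'a
  proof -
    have "x * x \<noteq> 0" using x selfadjoint_square_eq_0 by blast
    then show ?thesis using square_idempotent_if_not_splits[OF x(1,3)] x(1)
      by (simp add: projection_def adj_simps)
  qed
  define p where "p = (1 / norm (c * c)) *\<^sub>R (c * c)"
  have p: "adj p = p" "p * p = p" "p \<noteq> 0" using proj[OF c ns] by (simp_all add: p_def projection_def)
  have "p = c * ((1 / norm (c * c)) ^ 3 *\<^sub>R (c * c * c * c)) * c"
  proof -
    have "p = p * p * p" by (simp add: p)
    then show ?thesis by (simp add: p_def mult.assoc power3_eq_cube)
  qed
  then have pc: "p \<in> corner c" by (rule cornerI)
  have pp: "p \<in> corner p" by (rule cornerI[of _ _ p]) (simp add: p)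
  have nsp: "\<not> splits p" using splits_mono[OF pc] ns by blast
  have unit: "p * x = x" "x * p = x" if "x \<in> corner p" for x
    using that p by (auto simp: corner_def mult.assoc) (simp_all flip: mult.assoc)
  have real: "\<exists>r. x = r *\<^sub>R p" if x: "adj x = x" "x \<in> corner p" for x
  proof (cases "x = 0")
    case True
    then show ?thesis by (intro exI[of _ 0]) simp
  next
    case False
    define \<mu> where "\<mu> = norm (x * x)"
    define q where "q = (1 / \<mu>) *\<^sub>R (x * x)"
    have "\<not> splits x" using splits_mono[OF x(2)] nsp by blast
    from proj[OF x(1) False this] have q: "adj q = q" "q * q = q" "q \<noteq> 0"
      by (simp_all add: q_def \<mu>_def projection_def)
    then have \<mu>: "\<mu> > 0" by (auto simp: q_def \<mu>_def)
    have "x * x \<in> corner p"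
      by (rule cornerI[of _ _ "x * x"]) (simp add: unit[OF x(2)] flip: mult.assoc, simp add: unit[OF x(2)] mult.assoc)
    then have qc: "q \<in> corner p" unfolding q_def by (rule corner_scaleR)
    have "p - q = 0"
    proof (rule ccontr)
      assume "p - q \<noteq> 0"
      moreover have "q * (p - q) = 0" by (simp add: right_diff_distrib q unit[OF qc])
      ultimately have "splits p" unfolding splits_def
        using qc corner_diff[OF pp qc] q p(1) by (intro exI[of _ q] exI[of _ "p - q"]) (simp add: adj_diff)
      then show False using nsp by blast
    qed
    then have xx: "x * x = \<mu> *\<^sub>R p" using \<mu> by (simp add: q_def)
    define y where "y = (1 / sqrt \<mu>) *\<^sub>R x"
    have yc: "y \<in> corner p" unfolding y_def by (rule corner_scaleR[OF x(2)])
    have y: "adj y = y" "y * y = p" using \<mu> x(1) by (simp_all add: y_def adj_simps xx)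
    have "(p + y) * (p - y) = 0" by (simp add: algebra_simps unit[OF yc] p y)
    then have "p + y = 0 \<or> p - y = 0"
      using nsp corner_add[OF pp yc] corner_diff[OF pp yc] p(1) y(1)
      unfolding splits_def by (metis adj_add adj_diff)
    moreover have "x = sqrt \<mu> *\<^sub>R y" using \<mu> by (simp add: y_def)
    ultimately have "x = sqrt \<mu> *\<^sub>R p \<or> x = (- sqrt \<mu>) *\<^sub>R p"
      by (auto simp: add_eq_0_iff)
    then show ?thesis by blast
  qed
  have "\<exists>c. p * x * p = c *\<^sub>C p" for x
  proof -
    define u where "u = p * x * p"
    have u: "u \<in> corner p" "adj u \<in> corner p"
      by (auto simp: u_def corner_def adj_mult p mult.assoc)
    obtain r where r: "u + adj u = r *\<^sub>R p"
      using real[of "u + adj u"] corner_add[OF u] by (auto simp: adj_simps add.commute)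
    have "\<i> *\<^sub>C (adj u - u) \<in> corner p"
      using corner_diff[OF u(2,1)] by (auto simp: corner_def image_iff) (metis mult_scaleC_left mult_scaleC_right)
    then obtain s where s: "\<i> *\<^sub>C (adj u - u) = s *\<^sub>R p"
      using real[of "\<i> *\<^sub>C (adj u - u)"] by (auto simp: adj_simps scaleC_diff_right scaleC_minus_left)
    have "\<i> *\<^sub>C \<i> *\<^sub>C (adj u - u) = u - adj u"
      using scaleC_of_real[of "-1" "adj u - u"] by (simp add: scaleC_scaleC)
    then have diff: "u - adj u = (\<i> * s) *\<^sub>C p" unfolding s by (simp add: scaleC_of_real[symmetric] scaleC_scaleC)
    have "2 *\<^sub>R u = (u + adj u) + (u - adj u)" by (simp add: scaleR_2)
    also have "\<dots> = (r + \<i> * s) *\<^sub>C p" by (simp only: r diff scaleC_add_left scaleC_of_real)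
    finally have "(1/2) *\<^sub>R 2 *\<^sub>R u = (1/2) *\<^sub>R (r + \<i> * s) *\<^sub>C p" by (rule arg_cong)
    then have "u = ((1/2) * (r + \<i> * s)) *\<^sub>C p"
      using scaleC_of_real[of "1/2" "(r + \<i> * s) *\<^sub>C p"] by (simp add: scaleC_scaleC)
    then show ?thesis unfolding u_def by blast
  qed
  then have "minimal_projection p" using p by (auto simp: minimal_projection_def projection_def)
  then show ?thesis by blast
qed

text \<open>Each \<open>C k\<close> is split into \<open>T (C k)\<close>, which is kept, and
  \<open>U (C k)\<close>, which is split next. All later \<open>T\<close> lie in the corner of
  \<open>U (C k)\<close>, and \<open>T (C k)\<close> annihilates that corner.\<close>

lemma orthogonal_sequence_if_splits:
  fixes c :: "'a::cstar_algebra"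
  assumes splits: "\<And>c::'a. adj c = c \<Longrightarrow> c \<noteq> 0 \<Longrightarrow> splits c" and c: "adj c = c" "c \<noteq> 0"
  shows "\<exists>t. \<forall>k::nat. adj (t k) = t k \<and> t k \<noteq> 0 \<and> t k \<in> corner c \<and> (\<forall>l. k \<noteq> l \<longrightarrow> t k * t l = 0)"
proof -
  define P where "P c t u \<longleftrightarrow> t \<in> corner c \<and> u \<in> corner c \<and> adj t = t \<and> adj u = u \<and>
     t \<noteq> 0 \<and> u \<noteq> 0 \<and> t * u = 0" for c t u :: 'a
  have "\<forall>c. \<exists>t u. adj c = c \<longrightarrow> c \<noteq> 0 \<longrightarrow> P c t u"
    using splits unfolding splits_def P_def by simp
  then obtain T U where TU: "\<And>c. adj c = c \<Longrightarrow> c \<noteq> 0 \<Longrightarrow> P c (T c) (U c)" by metis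
  define C where "C k = (U ^^ k) c" for k
  have C0: "C 0 = c" and CS: "C (Suc k) = U (C k)" for k by (simp_all add: C_def)
  have C: "adj (C k) = C k \<and> C k \<noteq> 0" for k
  proof (induction k)
    case (Suc k)
    then show ?case using TU[of "C k"] by (simp add: CS P_def)
  qed (use c in \<open>simp add: C0\<close>)
  have TUC: "T (C k) \<in> corner (C k)" "U (C k) \<in> corner (C k)" "adj (T (C k)) = T (C k)"
    "T (C k) \<noteq> 0" "T (C k) * U (C k) = 0" for k
    using TU[of "C k"] C[of k] by (simp_all add: P_def)
  have C_mono: "corner (C (k + m)) \<subseteq> corner (C k)" for k m
  proof (induction m)
    case (Suc m)
    have "corner (C (k + Suc m)) \<subseteq> corner (C (k + m))" using corner_trans[OF TUC(2)[of "k + m"]] by (simp add: CS)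
    then show ?case using Suc by blast
  qed simp
  have less: "T (C k) * T (C l) = 0" if "k < l" for k l
  proof -
    have "T (C l) \<in> corner (C (Suc k))"
      using C_mono[of "Suc k" "l - Suc k"] TUC(1)[of l] that by auto
    then obtain y where y: "T (C l) = C (Suc k) * y * C (Suc k)" by (auto simp: corner_def)
    have "T (C k) * C (Suc k) = 0" using TUC(5) by (simp add: CS)
    then show ?thesis by (simp add: y flip: mult.assoc)
  qed
  have "T (C k) * T (C l) = 0" if "k \<noteq> l" for k l
  proof (cases "k < l")
    case False
    then have "T (C l) * T (C k) = 0" using that less by simp
    then have "adj (T (C l) * T (C k)) = 0" by simp
    then show ?thesis by (simp add: adj_mult TUC(3))
  qed (rule less)
  moreover have "T (C k) \<in> corner c" for k using C_mono[of 0 k] TUC(1)[of k] by (auto simp: C0)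
  ultimately show ?thesis by (intro exI[of _ "\<lambda>k. T (C k)"]) (simp add: TUC(3,4))
qed

section \<open>Primeness of simple algebras\<close>

text \<open>The \<open>x\<close> with \<open>u y x = 0\<close> for all \<open>y\<close> form a
  closed ideal. It is proper: otherwise the square of \<open>u * adj u\<close> would vanish.\<close>

lemma simple_algebra_prime:
  fixes u v :: "'a::cstar_algebra"
  assumes simple: "simple_algebra TYPE('a)" and "u \<noteq> 0" "v \<noteq> 0"
  obtains x where "u * x * v \<noteq> 0"
proof -
  define I where "I = {x. \<forall>y. u * y * x = 0}"
  have "closed_ideal I" unfolding closed_ideal_def
  proof (intro conjI allI ballI)
    show "closed I" unfolding I_def by (intro closed_Collect_all closed_Collect_eq continuous_intros)
    fix a x assume x: "x \<in> I"
    have "u * y * (a * x) = u * (y * a) * x" "u * y * (x * a) = (u * y * x) * a" for y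
      by (simp_all add: mult.assoc)
    then show "a * x \<in> I" "x * a \<in> I" using x by (simp_all only: I_def mem_Collect_eq) auto
  qed (simp_all add: I_def distrib_left mult_scaleC_right scaleC_zero_right)
  then have "I = {0} \<or> I = UNIV" using simple by (auto simp: simple_algebra_def)
  moreover have "I \<noteq> UNIV"
  proof
    assume "I = UNIV"
    then have "u * adj u * (u * adj u) = 0" by (auto simp: I_def)
    then have "u * adj u = 0" by (rule selfadjoint_square_eq_0[rotated]) (simp add: adj_simps)
    then show False using assms by simp
  qed
  ultimately have "v \<notin> I" using assms by auto
  then show thesis using that by (auto simp: I_def)
qed

text \<open>Factors are appended on the right, which preserves the earlier factorisations. The last
  factor \<open>u\<close> is an adjoint, so that the product stays nonzero and \<open>T n\<close>
  gets a right neighbour without recourse to a unit.\<close>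

lemma nonzero_product_through:
  fixes T :: "nat \<Rightarrow> 'a::cstar_algebra"
  assumes simple: "simple_algebra TYPE('a)" and g: "g \<noteq> 0" and T: "\<And>j. T j \<noteq> 0"
  shows "\<exists>v. v \<noteq> 0 \<and> (\<exists>w. v = g * w) \<and> (\<forall>j<n. \<exists>p r. v = p * T j * r)"
proof (induction n)
  case 0
  show ?case using g by (intro exI[of _ "g * adj g"]) auto
next
  case (Suc n)
  then obtain v w where v: "v \<noteq> 0" "v = g * w" "\<And>j. j < n \<Longrightarrow> \<exists>p r. v = p * T j * r" by blast
  obtain x where x: "v * x * T n \<noteq> 0" by (rule simple_algebra_prime[OF simple v(1) T])
  define u where "u = adj (v * x * T n)"
  define v' where "v' = v * x * T n * u"
  have "v' \<noteq> 0" using x by (simp add: v'_def u_def)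
  moreover have "v' = g * (w * x * T n * u)" by (simp add: v'_def v(2) mult.assoc)
  moreover have "\<exists>p r. v' = p * T j * r" if "j < Suc n" for j
  proof (cases "j = n")
    case True
    then show ?thesis unfolding v'_def by blast
  next
    case False
    then obtain p r where "v = p * T j * r" using v(3)[of j] \<open>j < Suc n\<close> by auto
    then have "v' = p * T j * (r * x * T n * u)" by (simp add: v'_def mult.assoc)
    then show ?thesis by blast
  qed
  ultimately show ?case by blast
qed

section \<open>A strictly convergent sum outside the algebra\<close>

lemma lmul_one: "lmul (1::'a::cstar_algebra multiplier) = id_blinfun"
  by transfer simp

text \<open>Convergence of \<open>S n * a\<close> suffices: \<open>a * S n\<close> is the adjoint of
  \<open>S n * adj a\<close> and converges too, and the two limits form a double centralizer,
  bounded because \<open>norm (S n) \<le> 1\<close>.\<close>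

lemma strict_limit:
  fixes S :: "nat \<Rightarrow> 'a::cstar_algebra"
  assumes S: "\<And>n. adj (S n) = S n" "\<And>n. norm (S n) \<le> 1" and conv: "\<And>a. convergent (\<lambda>n. S n * a)"
  obtains X where "adj X = X" "\<forall>a. (\<lambda>n. S n * a) \<longlonglongrightarrow> lmul X a"
proof -
  define L where "L a = lim (\<lambda>n. S n * a)" for a
  define R where "R a = adj (L (adj a))" for a
  have L: "(\<lambda>n. S n * a) \<longlonglongrightarrow> L a" for a
    using conv[of a] by (simp add: convergent_LIMSEQ_iff L_def)
  have R: "(\<lambda>n. a * S n) \<longlonglongrightarrow> R a" for a
    using tendsto_adj[OF L[of "adj a"]] by (simp add: R_def adj_simps S)
  note tendsto_scaleC = bounded_linear.tendsto[OF bounded_linear_scaleC]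
  have L_scale: "L (c *\<^sub>C a) = c *\<^sub>C L a" for c a
    by (rule LIMSEQ_unique[OF L]) (simp add: mult_scaleC_right tendsto_scaleC L)
  have L_add: "L (a + b) = L a + L b" for a b
    by (rule LIMSEQ_unique[OF L]) (simp add: distrib_left tendsto_add L)
  have L_mult: "L (a * b) = L a * b" for a b
    by (rule LIMSEQ_unique[OF L]) (simp add: mult.assoc[symmetric] tendsto_mult L)
  have L_norm: "norm (L a) \<le> norm a * 1" for a
  proof (rule LIMSEQ_le_const2[OF tendsto_norm[OF L]])
    have "norm (S n * a) \<le> norm a * 1" for n
      using norm_mult_ineq[of "S n" a] mult_right_mono[OF S(2) norm_ge_zero[of a]] by (simp add: order_trans)
    then show "\<exists>N. \<forall>n\<ge>N. norm (S n * a) \<le> norm a * 1" by blast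
  qed
  have RL: "R a * b = a * L b" for a b
    by (rule LIMSEQ_unique[OF tendsto_mult[OF R tendsto_const]])
      (simp add: mult.assoc tendsto_mult L)
  have bL: "bounded_linear L"
    by (rule bounded_linear_intro[OF L_add _ L_norm]) (simp add: L_scale flip: scaleC_of_real)
  have bR: "bounded_linear R"
    unfolding R_def using bounded_linear_compose[OF bounded_linear_adj bounded_linear_compose[OF bL bounded_linear_adj]] .
  define X where "X = Abs_multiplier (Blinfun L, Blinfun R)"
  have "(Blinfun L, Blinfun R) \<in> {(L, R). (\<forall>c a. blinfun_apply L (c *\<^sub>C a) = c *\<^sub>C blinfun_apply L a) \<and>
            (\<forall>c a. blinfun_apply R (c *\<^sub>C a) = c *\<^sub>C blinfun_apply R a) \<and>
            (\<forall>a b. blinfun_apply L (a * b) = blinfun_apply L a * b) \<and>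
            (\<forall>a b. blinfun_apply R (a * b) = a * blinfun_apply R b) \<and>
            (\<forall>a b. blinfun_apply R a * b = a * blinfun_apply L b)}"
    by (simp add: bounded_linear_Blinfun_apply bL bR L_scale L_mult RL)
      (simp add: R_def adj_simps L_scale L_mult)
  then have "Rep_multiplier X = (Blinfun L, Blinfun R)" unfolding X_def by (rule Abs_multiplier_inverse)
  then have X: "lmul X a = L a" "rmul X a = R a" for a
    by (simp_all add: lmul.rep_eq rmul.rep_eq bounded_linear_Blinfun_apply bL bR)
  show thesis
  proof (rule that)
    show "adj X = X"
      by (rule multiplier_eqI_left) (simp add: multiplier_cstar_ops blinfun_ops_apply X R_def adj_adj)
    show "\<forall>a. (\<lambda>n. S n * a) \<longlonglongrightarrow> lmul X a" by (simp add: X L)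
  qed
qed

lemma approximate_identity_adj: "approximate_identity e \<Longrightarrow> adj (e n) = e n"
  by (auto simp: approximate_identity_def positive_def) (metis adj_adj adj_mult)

lemma approximate_identity_mult:
  assumes e: "approximate_identity e" and "i < j"
  shows "e j * e i = e i" "e i * e j = e i"
proof -
  have step: "e (Suc n) * e n = e n" for n using e by (simp add: approximate_identity_def)
  show *: "e j * e i = e i" using \<open>i < j\<close>
  proof (induction j)
    case (Suc j)
    show ?case
    proof (cases "i = j")
      case False
      then have ji: "e j * e i = e i" using Suc by simp
      have "e (Suc j) * e i = e (Suc j) * e j * e i" by (simp only: ji mult.assoc)
      also have "\<dots> = e i" by (simp only: step ji)
      finally show ?thesis .
    qed (simp add: step)
  qed simp
  have "e i * e j = adj (e j * e i)" by (simp add: adj_mult approximate_identity_adj[OF e])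
  then show "e i * e j = e i" by (simp add: * approximate_identity_adj[OF e])
qed

lemma approximate_identity_tendsto:
  assumes "approximate_identity e"
  shows "(\<lambda>n. e n * a) \<longlonglongrightarrow> a" "(\<lambda>n. a * e n) \<longlonglongrightarrow> a" "norm (e n) \<le> 1"
  using assms by (auto simp: approximate_identity_def)

text \<open>The sum lies below \<open>Z (b\<^sup>* b) Z\<^sup>*\<close> with \<open>Z = \<Sum> \<parallel>r\<^sub>k\<parallel> p\<^sub>k u\<^sub>k\<close>, where \<open>t\<^sub>k = u\<^sub>k b\<^sup>*\<close>;
  orthogonality of the \<open>t\<^sub>k\<close> kills the cross terms.\<close>

lemma sum_cuntz_le:
  fixes t :: "nat \<Rightarrow> 'a::cstar_algebra"
  assumes I: "finite I" and t: "\<And>k. adj (t k) = t k" "\<And>k l. k \<noteq> l \<Longrightarrow> t k * t l = 0"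
    "\<And>k. t k = u k * adj b" and v: "\<And>k. k \<in> I \<Longrightarrow> v k = p k * t k * r k"
  shows "(\<Sum>k\<in>I. v k * adj (v k)) \<preceq> adj b * b"
proof (rule cuntz_le_if_le_conj)
  let ?M = "multiplier_of"
  define Z where "Z = (\<Sum>k\<in>I. norm (r k) *\<^sub>R (p k * u k))"
  have Zb: "Z * adj b = (\<Sum>k\<in>I. norm (r k) *\<^sub>R (p k * t k))"
    by (simp add: Z_def sum_distrib_right mult.assoc flip: t(3))
  have "Z * (adj b * b) * adj Z = (Z * adj b) * adj (Z * adj b)"
    by (simp add: adj_simps mult.assoc)
  also have "\<dots> = (\<Sum>k\<in>I. \<Sum>l\<in>I. (norm (r k) *\<^sub>R (p k * t k)) * adj (norm (r l) *\<^sub>R (p l * t l)))"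
    unfolding Zb adj_sum sum_product ..
  also have "\<dots> = (\<Sum>k\<in>I. \<Sum>l\<in>I. if k = l then (norm (r k))\<^sup>2 *\<^sub>R (p k * t k * adj (p k * t k)) else 0)"
  proof (intro sum.cong refl)
    fix k l
    have "p k * t k * (t l * adj (p l)) = p k * (t k * t l) * adj (p l)" by (simp add: mult.assoc)
    then show "(norm (r k) *\<^sub>R (p k * t k)) * adj (norm (r l) *\<^sub>R (p l * t l))
      = (if k = l then (norm (r k))\<^sup>2 *\<^sub>R (p k * t k * adj (p k * t k)) else 0)"
      using t(2)[of k l] by (auto simp: adj_simps t(1) power2_eq_square)
  qed
  also have "\<dots> = (\<Sum>k\<in>I. (norm (r k))\<^sup>2 *\<^sub>R (p k * t k * adj (p k * t k)))"
    using I by simp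
  finally have ZZ: "Z * (adj b * b) * adj Z = (\<Sum>k\<in>I. (norm (r k))\<^sup>2 *\<^sub>R (p k * t k * adj (p k * t k)))" .
  show "psd (?M (\<Sum>k\<in>I. v k * adj (v k)))"
    unfolding multiplier_of_sum by (intro psd_sum) (simp add: mult_of_simps psd_mult_adj_self)
  have "psd (?M ((norm (r k))\<^sup>2 *\<^sub>R (p k * t k * adj (p k * t k))) - ?M (v k * adj (v k)))"
    if k: "k \<in> I" for k
  proof -
    \<comment> \<open>The weights in \<open>Z\<close> match this bound:
      \<open>r k * adj (r k)\<close> is at most the square of \<open>norm (r k)\<close>, and
      conjugation by \<open>p k * t k\<close> preserves the inequality.\<close>
    have "norm (?M (r k) * adj (?M (r k))) \<le> (norm (r k))\<^sup>2"
      using norm_adj_mult_self[of "adj (r k)"] norm_multiplier_of[of "r k * adj (r k)"]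
      by (simp add: adj_adj norm_adj mult_of_simps)
    then have "psd ((norm (r k))\<^sup>2 *\<^sub>R 1 - ?M (r k) * adj (?M (r k)))"
      by (intro psd_diff_norm) (simp_all add: adj_simps)
    from psd_conj'[OF this, of "?M (p k * t k)"] show ?thesis
      by (simp add: v[OF k] mult_of_simps adj_mult right_diff_distrib left_diff_distrib mult.assoc)
  qed
  from psd_sum[of I, OF this]
  show "psd (?M (Z * (adj b * b) * adj Z) - ?M (\<Sum>k\<in>I. v k * adj (v k)))"
    unfolding ZZ multiplier_of_sum by (simp only: sum_subtractf)
qed

text \<open>By orthogonality the difference is the product of the commuting positive factors
  \<open>1 - d k\<close>.\<close>

lemma psd_one_minus_orthogonal_sum:
  fixes d :: "nat \<Rightarrow> 'a::unital_cstar_algebra"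
  assumes "\<And>k. psd (d k)" "\<And>k. norm (d k) \<le> 1" "\<And>k l. k \<noteq> l \<Longrightarrow> d k * d l = 0"
  shows "psd (1 - (\<Sum>k<n. d k))"
proof (induction n)
  case (Suc n)
  define s where "s = (\<Sum>k<n. d k)"
  have s: "s * d n = 0" "d n * s = 0"
    by (simp_all add: s_def sum_distrib_left sum_distrib_right assms(3))
  have "psd (1 *\<^sub>R 1 - d n)" by (rule psd_diff_norm(1)[OF psd_adj assms(2)]) (rule assms(1))
  then have "psd ((1 - s) * (1 - d n))"
    by (intro psd_mult Suc[folded s_def]) (simp_all add: algebra_simps s)
  also have "(1 - s) * (1 - d n) = 1 - (\<Sum>k<Suc n. d k)"
    by (simp add: left_diff_distrib right_diff_distrib s) (simp add: s_def)
  finally show ?case .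
qed simp

lemma exists_multiplier_in_K_o:
  fixes e :: "nat \<Rightarrow> 'a::cstar_algebra"
  assumes simple: "simple_algebra TYPE('a)" and e: "approximate_identity e"
    and no_min: "\<nexists>p::'a. minimal_projection p"
    and sep: "cuntz_semigroup_order_separable TYPE('a)"
  obtains X where "X \<in> K_o e" "X \<notin> range multiplier_of"
proof -
  let ?M = "multiplier_of"
  obtain s :: "nat \<Rightarrow> 'a" where s: "\<And>n. positive (s n)" "\<And>n. s n \<noteq> 0"
    "\<And>a. positive a \<Longrightarrow> a \<noteq> 0 \<Longrightarrow> \<exists>n. s n \<preceq> a"
    using sep unfolding cuntz_semigroup_order_separable_def by blast
  have "\<forall>j. \<exists>b. s j = adj b * b" using s(1) by (simp add: positive_def)
  then obtain b where b: "\<And>j. s j = adj (b j) * b j" by metis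
  have b0: "b j \<noteq> 0" for j using s(2)[of j] by (auto simp: b)
  define Q where "Q j t u \<longleftrightarrow> (\<forall>k::nat. adj (t k) = t k \<and> t k \<noteq> 0 \<and> t k = u k * adj (b j) \<and>
    (\<forall>l. k \<noteq> l \<longrightarrow> t k * t l = 0))" for j t u
  have "\<forall>j. \<exists>t u. Q j t u"
  proof
    fix j
    \<comment> \<open>Elements of the corner of \<open>b * adj b\<close> end in the factor
      \<open>adj b\<close>, hence have the form \<open>u * adj b\<close> that
      \<open>sum_cuntz_le\<close> compares with \<open>s j = adj b * b\<close>.\<close>
    define c where "c = b j * adj (b j)"
    have c: "adj c = c" "c \<noteq> 0" using b0 by (simp_all add: c_def adj_simps)
    have splits: "adj c = c \<Longrightarrow> c \<noteq> 0 \<Longrightarrow> splits c" for c :: 'a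
      using minimal_projection_if_not_splits no_min by blast
    obtain t where t: "\<forall>k::nat. adj (t k) = t k \<and> t k \<noteq> 0 \<and> t k \<in> corner c \<and> (\<forall>l. k \<noteq> l \<longrightarrow> t k * t l = 0)"
      using orthogonal_sequence_if_splits[OF splits c] by blast
    have "\<exists>u. t k = u * adj (b j)" for k
      using t[rule_format, of k] by (auto simp: corner_def c_def simp flip: mult.assoc)
    then obtain u where u: "\<And>k. t k = u k * adj (b j)" by metis
    show "\<exists>t u. Q j t u" unfolding Q_def
    proof (rule exI[of _ t], rule exI[of _ u], intro allI conjI impI)
      fix k l :: nat
      show "adj (t k) = t k" "t k \<noteq> 0" using t by blast+
      show "t k = u k * adj (b j)" by (rule u)
      show "t k * t l = 0" if "k \<noteq> l" using t that by blast
    qed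
  qed
  then obtain t u where "\<And>j. Q j (t j) (u j)" by metis
  then have t: "\<And>j k. adj (t j k) = t j k" "\<And>j k. t j k \<noteq> 0"
    "\<And>j k. t j k = u j k * adj (b j)" "\<And>j k l. k \<noteq> l \<Longrightarrow> t j k * t j l = 0"
    unfolding Q_def by blast+
  \<comment> \<open>Every second increment is left out: neighbouring increments of an approximate
    identity need not be orthogonal, but the \<open>g k\<close> are.\<close>
  define g where "g k = e (2 * k + 1) - e (2 * k)" for k
  note ee = approximate_identity_mult[OF e]
  have ag: "adj (g k) = g k" for k by (simp add: g_def adj_diff approximate_identity_adj[OF e])
  have g0: "g k \<noteq> 0" for k
    using e unfolding g_def approximate_identity_def by (metis Suc_eq_plus1 right_minus_eq)
  have g_lo: "g k * e i = 0" if "i < 2 * k" for i k using that by (simp add: g_def left_diff_distrib ee)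
  have g_hi: "g k * e i = g k" if "2 * k + 1 < i" for i k using that by (simp add: g_def left_diff_distrib ee)
  have gg: "g k * g l = 0" if "k \<noteq> l" for k l
  proof (cases "k < l")
    case True
    then show ?thesis by (simp add: g_def[of l] right_diff_distrib g_hi)
  next
    case False
    then show ?thesis using that by (simp add: g_def[of l] right_diff_distrib g_lo)
  qed
  have "\<exists>v. norm v = 1 \<and> (\<exists>w. v = g k * w) \<and> (\<forall>j\<le>k. \<exists>p r. v = p * t j k * r)" for k
  proof -
    obtain v w where v: "v \<noteq> 0" "v = g k * w" "\<And>j. j < Suc k \<Longrightarrow> \<exists>p r. v = p * t j k * r"
      using nonzero_product_through[OF simple g0[of k], of "\<lambda>j. t j k" "Suc k", OF t(2)] by blast
    define v' where "v' = (1 / norm v) *\<^sub>R v"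
    have "norm v' = 1" using v(1) by (simp add: v'_def)
    moreover have "v' = g k * ((1 / norm v) *\<^sub>R w)" by (simp add: v'_def flip: v(2))
    moreover have "\<exists>p r. v' = p * t j k * r" if j: "j \<le> k" for j
    proof -
      obtain p r where "v = p * t j k * r" using v(3)[of j] j by auto
      then have "v' = ((1 / norm v) *\<^sub>R p) * t j k * r" by (simp add: v'_def)
      then show ?thesis by blast
    qed
    ultimately show ?thesis by blast
  qed
  then obtain v where v: "\<And>k. norm (v k) = 1" "\<And>k. \<exists>w. v k = g k * w"
    "\<And>j k. j \<le> k \<Longrightarrow> \<exists>p r. v k = p * t j k * r" by metis
  then obtain w where w: "\<And>k. v k = g k * w k" by metis
  define d where "d k = v k * adj (v k)" for k
  have d: "d k = g k * (w k * adj (w k)) * g k" for k by (simp add: d_def w adj_mult ag mult.assoc)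
  have ad: "adj (d k) = d k" for k by (simp add: d_def adj_simps)
  have nd: "norm (d k) = 1" for k
    using norm_adj_mult_self[of "adj (v k)"] v(1) by (simp add: d_def adj_adj norm_adj)
  have d_lo: "d k * e i = 0" if "i < 2 * k" for i k by (simp add: d mult.assoc g_lo[OF that])
  have d_hi: "d k * e i = d k" if "2 * k + 1 < i" for i k by (simp add: d mult.assoc g_hi[OF that])
  have dd: "d k * d l = 0" if "k \<noteq> l" for k l
  proof -
    have "d k * d l = g k * (w k * adj (w k)) * (g k * g l) * (w l * adj (w l)) * g l"
      by (simp add: d mult.assoc)
    then show ?thesis by (simp add: gg[OF that])
  qed
  define S where "S n = (\<Sum>k<n. d k)" for n
  have aS: "adj (S n) = S n" for n by (simp add: S_def adj_sum ad)
  have pd: "psd (?M (d k))" for k by (rule psd_multiplier_of) (auto simp: d_def positive_def intro!: exI[of _ "adj (v k)"] simp: adj_adj)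
  have pS: "psd (?M (S n))" for n unfolding S_def multiplier_of_sum by (intro psd_sum pd)
  have "psd (1 - (\<Sum>k<n. ?M (d k)))" for n
    by (rule psd_one_minus_orthogonal_sum)
      (simp_all add: pd norm_multiplier_of nd dd mult_of_simps flip: multiplier_of_hom(2))
  then have p1S: "psd (1 - ?M (S n))" for n by (simp add: S_def multiplier_of_sum)
  have nS: "norm (S n) \<le> 1" for n
    using selfadjoint_le_norm[OF pS, of 1 n] p1S by (simp add: norm_multiplier_of)
  have n1S: "norm (1 - ?M (S n)) \<le> 1" for n
    using psd_norm_diff_le[OF pS, of n 1] nS by (simp add: norm_multiplier_of)
  \<comment> \<open>\<open>d k * e i\<close> vanishes as soon as \<open>2 * k > i\<close>, in
    particular for \<open>k > i\<close>.\<close>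
  have S_const: "S n * e i = S (Suc i) * e i" if "Suc i \<le> n" for n i
    using that
  proof (induction n rule: dec_induct)
    case (step n)
    then show ?case by (simp add: S_def distrib_right d_lo)
  qed simp
  have conv: "convergent (\<lambda>n. S n * a)" for a
  proof (rule Cauchy_convergent, rule metric_CauchyI)
    fix \<epsilon> :: real assume "\<epsilon> > 0"
    then obtain i where i: "norm (e i * a - a) < \<epsilon> / 2"
      using LIMSEQ_D[OF approximate_identity_tendsto(1)[OF e, of a], of "\<epsilon> / 2"] by auto
    have near: "norm (S n * a - S n * e i * a) < \<epsilon> / 2" for n
    proof -
      have "norm (S n * (a - e i * a)) \<le> 1 * norm (a - e i * a)"
        by (rule order_trans[OF norm_mult_ineq]) (intro mult_right_mono nS norm_ge_zero)
      then show ?thesis using i by (simp add: right_diff_distrib mult.assoc norm_minus_commute)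
    qed
    have "dist (S m * a) (S n * a) < \<epsilon>" if "m \<ge> Suc i" "n \<ge> Suc i" for m n
      using norm_triangle_ineq4[of "S m * a - S m * e i * a" "S n * a - S n * e i * a"] near[of m] near[of n]
      unfolding S_const[OF that(1)] S_const[OF that(2)] dist_norm by simp
    then show "\<exists>M. \<forall>m\<ge>M. \<forall>n\<ge>M. dist (S m * a) (S n * a) < \<epsilon>" by blast
  qed
  obtain X where X: "adj X = X" and "\<forall>a. (\<lambda>n. S n * a) \<longlonglongrightarrow> lmul X a"
    by (rule strict_limit[OF aS nS conv])
  then have limX: "(\<lambda>n. S n * a) \<longlonglongrightarrow> lmul X a" for a by blast
  have lim_const: "lmul X a = S m * a" if "\<And>n. n \<ge> m \<Longrightarrow> S n * a = S m * a" for a m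
  proof (rule LIMSEQ_unique[OF limX])
    show "(\<lambda>n. S n * a) \<longlonglongrightarrow> S m * a"
      by (rule tendsto_eventually, rule eventually_sequentiallyI[of m], rule that)
  qed
  \<comment> \<open>The norm test for positivity of \<open>X\<close>; unlike an explicit root, it
    passes to strict limits.\<close>
  have "norm (1 *\<^sub>R 1 - X) \<le> 1"
    unfolding norm_multiplier_def
  proof (rule norm_blinfun_bound)
    fix a
    have "(\<lambda>n. a - S n * a) \<longlonglongrightarrow> a - lmul X a" by (intro tendsto_diff tendsto_const limX)
    moreover have "norm (a - S n * a) \<le> 1 * norm a" for n
    proof -
      have "?M (a - S n * a) = (1 - ?M (S n)) * ?M a" by (simp add: mult_of_simps left_diff_distrib)
      then have "norm (a - S n * a) \<le> norm (1 - ?M (S n)) * norm a"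
        using norm_mult_ineq[of "1 - ?M (S n)" "?M a"] by (metis norm_multiplier_of)
      also have "\<dots> \<le> 1 * norm a" by (intro mult_right_mono n1S norm_ge_zero)
      finally show ?thesis .
    qed
    ultimately have "norm (a - lmul X a) \<le> 1 * norm a"
      by (intro LIMSEQ_le_const2[OF tendsto_norm]) auto
    then show "norm (lmul (1 *\<^sub>R 1 - X) a) \<le> 1 * norm a"
      by (simp add: lmul_ops lmul_one blinfun.bilinear_simps)
  qed simp
  then have "positive X" unfolding positive_iff_psd by (rule psdI_norm[OF X])
  moreover have "\<exists>N. \<forall>m n. m > n \<longrightarrow> n \<ge> N \<longrightarrow> (e m - e n) * lmul X (e m - e n) \<preceq> a"
    if a: "positive a" "a \<noteq> 0" for a
  proof -
    obtain j where j: "s j \<preceq> a" using s(3)[OF a] by blast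
    \<comment> \<open>For \<open>k < j\<close> the index \<open>2 * k + 1\<close> is below
      \<open>2 * j \<le> n\<close>, so \<open>e m\<close> and \<open>e n\<close> both act as units
      on \<open>d k\<close> and the term drops out. The surviving \<open>v k\<close> with
      \<open>k \<ge> j\<close> factor through \<open>t j k\<close>.\<close>
    have "(e m - e n) * lmul X (e m - e n) \<preceq> a" if mn: "m > n" "n \<ge> 2 * j" for m n
    proof -
      define E where "E = e m - e n"
      have aE: "adj E = E" by (simp add: E_def adj_diff approximate_identity_adj[OF e])
      define F where "F = (\<Sum>k\<in>{j..<Suc m}. d k)"
      have "S k * E = S (Suc m) * E" if "Suc m \<le> k" for k
      proof -
        have "S k * e i = S (Suc m) * e i" if "i \<le> m" for i
          using S_const[of i k] S_const[of i "Suc m"] that \<open>Suc m \<le> k\<close> by simp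
        from this[of m] this[of n] show ?thesis using mn by (simp add: E_def right_diff_distrib)
      qed
      then have "lmul X E = S (Suc m) * E" by (rule lim_const)
      also have "\<dots> = (\<Sum>k<Suc m. d k * E)" by (simp add: S_def sum_distrib_right del: sum.lessThan_Suc)
      also have "\<dots> = (\<Sum>k\<in>{j..<Suc m}. d k * E)"
        by (rule sum.mono_neutral_right) (use mn in \<open>auto simp: E_def right_diff_distrib d_hi\<close>)
      also have "\<dots> = F * E" by (simp only: F_def sum_distrib_right)
      finally have "E * lmul X E = E * F * adj E" by (simp add: aE mult.assoc)
      then have 1: "E * lmul X E \<preceq> F" using conj_cuntz_le[of E F] by simp
      have "\<exists>p r. \<forall>k. j \<le> k \<longrightarrow> v k = p k * t j k * r k" using v(3) by metis
      then obtain p r where pr: "\<And>k. j \<le> k \<Longrightarrow> v k = p k * t j k * r k" by blast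
      have "F \<preceq> adj (b j) * b j"
        unfolding F_def d_def by (rule sum_cuntz_le[OF _ t(1) t(4) t(3) pr]) auto
      from cuntz_le_trans[OF cuntz_le_trans[OF 1 this[folded b]] j] show ?thesis by (simp add: E_def)
    qed
    then show ?thesis by blast
  qed
  ultimately have "X \<in> K_o e" by (simp add: K_o_def)
  moreover have "X \<notin> range ?M"
  proof
    assume "X \<in> range ?M"
    then obtain a where a: "X = ?M a" by blast
    \<comment> \<open>If \<open>X\<close> were given by \<open>a\<close>, then
      \<open>a * d k = d k * d k\<close> would have norm one. Since \<open>k > 0\<close> gives
      \<open>k < 2 * k\<close>, also \<open>d k * e k = 0\<close>, so \<open>e k * adj a\<close>
      cannot approach \<open>adj a\<close>.\<close>
    have one: "1 \<le> norm (e k * adj a - adj a)" if k: "k > 0" for k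
    proof -
      have "S n * d k = S (Suc k) * d k" if "n \<ge> Suc k" for n
        using that
      proof (induction n rule: dec_induct)
        case (step n)
        then show ?case by (simp add: S_def distrib_right dd)
      qed simp
      then have "lmul X (d k) = S (Suc k) * d k" by (rule lim_const)
      then have "a * d k = S (Suc k) * d k" by (simp only: a lmul_multiplier_of)
      also have "\<dots> = d k * d k" by (simp add: S_def distrib_right sum_distrib_right dd)
      finally have "norm (a * d k) = 1" using norm_selfadjoint_square[OF ad, of k] nd by simp
      then have "norm (adj (a * d k)) = 1" by (simp only: norm_adj)
      moreover have "adj (a * d k) = - (d k * (e k * adj a - adj a))"
        using d_lo[of k k] k by (simp add: adj_mult ad right_diff_distrib flip: mult.assoc)
      ultimately have "norm (d k * (e k * adj a - adj a)) = 1" by simp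
      then show ?thesis using norm_mult_ineq[of "d k" "e k * adj a - adj a"] nd[of k] by simp
    qed
    obtain N where "\<forall>n\<ge>N. norm (e n * adj a - adj a) < 1"
      using LIMSEQ_D[OF approximate_identity_tendsto(1)[OF e, of "adj a"], of 1] by auto
    then have "norm (e (Suc N) * adj a - adj a) < 1" by simp
    then show False using one[of "Suc N"] by simp
  qed
  ultimately show thesis by (rule that)
qed

section \<open>Algebras with a minimal projection are elementary\<close>

locale simple_minimal_projection =
  fixes p :: "'a::cstar_algebra"
  assumes simple: "simple_algebra TYPE('a)" and min: "minimal_projection p"
begin

lemma p: "adj p = p" "p * p = p" "p \<noteq> 0"
  using min by (auto simp: minimal_projection_def projection_def)

lemma norm_p: "norm p = 1"
proof -
  have "r = 1" if "r\<^sup>2 = r" "r \<noteq> 0" for r :: real using that by (simp add: power2_eq_square)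
  from this[OF norm_selfadjoint_square[OF p(1), symmetric, unfolded p(2)]] p(3) show ?thesis by simp
qed

section \<open>The Hilbert space carried by the left ideal generated by \<open>p\<close>\<close>

definition coef :: "'a \<Rightarrow> complex" where
  "coef x = (SOME c. p * x * p = c *\<^sub>C p)"

lemma coef: "p * x * p = coef x *\<^sub>C p"
  unfolding coef_def by (rule someI_ex) (use min in \<open>auto simp: minimal_projection_def\<close>)

lemma scaleC_p_eq_iff: "c *\<^sub>C p = d *\<^sub>C p \<longleftrightarrow> c = d"
proof
  assume "c *\<^sub>C p = d *\<^sub>C p"
  then have "(c - d) *\<^sub>C p = 0" by (simp add: diff_conv_add_uminus scaleC_add_left scaleC_minus_left del: add_uminus_conv_diff)
  then have "cmod (c - d) * norm p = 0" by (simp flip: norm_scaleC)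
  then show "c = d" by (simp add: norm_p)
qed simp

lemma coefI: "p * x * p = c *\<^sub>C p \<Longrightarrow> coef x = c"
  using coef scaleC_p_eq_iff by metis

lemma coef_add: "coef (x + y) = coef x + coef y"
  by (rule coefI) (simp add: distrib_left distrib_right coef scaleC_add_left)

lemma coef_scaleC: "coef (c *\<^sub>C x) = c * coef x"
  by (rule coefI) (simp add: mult_scaleC_left mult_scaleC_right coef scaleC_scaleC)

lemma coef_adj: "coef (adj x) = cnj (coef x)"
proof (rule coefI)
  have "p * adj x * p = adj (p * x * p)" by (simp add: adj_mult p mult.assoc)
  then show "p * adj x * p = cnj (coef x) *\<^sub>C p" by (simp add: coef adj_scaleC p)
qed

text \<open>The left ideal \<open>A p\<close>; the equation describes it as a closed set because
  \<open>p\<close> is idempotent.\<close>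

definition V :: "'a set" where "V = {x. x * p = x}"

lemma V_unit: "x \<in> V \<Longrightarrow> x * p = x"
  by (simp add: V_def)

lemma V_adj_unit: "x \<in> V \<Longrightarrow> p * adj x = adj x"
  by (metis V_unit adj_mult p(1))

lemma V_ops:
  "0 \<in> V" "x \<in> V \<Longrightarrow> y \<in> V \<Longrightarrow> x + y \<in> V" "x \<in> V \<Longrightarrow> y \<in> V \<Longrightarrow> x - y \<in> V"
  "x \<in> V \<Longrightarrow> c *\<^sub>C x \<in> V" "x \<in> V \<Longrightarrow> r *\<^sub>R x \<in> V" "x \<in> V \<Longrightarrow> a * x \<in> V" "a * p \<in> V"
  by (simp_all add: V_def distrib_right left_diff_distrib mult_scaleC_left mult.assoc p)

lemma closed_V: "closed V"
  unfolding V_def by (intro closed_Collect_eq continuous_intros)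

lemma inner_V: "x \<in> V \<Longrightarrow> y \<in> V \<Longrightarrow> adj y * x = coef (adj y * x) *\<^sub>C p"
  using coef[of "adj y * x"] by (simp add: V_unit mult.assoc) (simp add: V_adj_unit flip: mult.assoc)

text \<open>The scalar in \<open>adj x * x = r p\<close> is real by self-adjointness and nonnegative
  by positivity, so the norm identity determines it. Hence the Hilbert norm is the norm of the
  algebra, and completeness of \<open>V\<close> is inherited.\<close>

lemma inner_self_V:
  assumes x: "x \<in> V" shows "adj x * x = (norm x)\<^sup>2 *\<^sub>R p"
proof -
  let ?c = "coef (adj x * x)"
  have "cnj ?c = ?c" using coef_adj[of "adj x * x"] by (simp add: adj_simps)
  then obtain r where r: "?c = of_real r" using Reals_cnj_iff by (metis Reals_cases)
  have xx: "adj x * x = r *\<^sub>R p" using inner_V[OF x x] r by (simp add: scaleC_of_real)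
  have "psd (multiplier_of (adj x * x))" by (rule psd_multiplier_of) (auto simp: positive_def)
  then have ps: "psd (r *\<^sub>R multiplier_of p)" by (simp only: xx mult_of_simps)
  have "r \<ge> 0"
  proof (rule ccontr)
    assume r0: "\<not> r \<ge> 0"
    have "psd (multiplier_of p)" by (rule psd_multiplier_of[OF projection_positive]) (simp add: projection_def p)
    from psd_scaleR[OF this, of "-r"] have "psd (- (r *\<^sub>R multiplier_of p))" using r0 by simp
    then have "r *\<^sub>R multiplier_of p = 0" using ps psd_antisym by blast
    then show False using p(3) r0 by simp
  qed
  moreover have "(norm x)\<^sup>2 = \<bar>r\<bar>" using norm_adj_mult_self[of x] by (simp add: xx norm_p)
  ultimately show ?thesis by (simp add: xx)
qed

lemma coef_self: "x \<in> V \<Longrightarrow> coef (adj x * x) = of_real ((norm x)\<^sup>2)"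
  using inner_self_V[of x] inner_V[of x x] scaleC_p_eq_iff by (metis scaleC_of_real)

definition H :: "'a hilbert" where
  "H = \<lparr>hcarrier = V, hzero = 0, hadd = (+), hscale = (*\<^sub>C), hinner = (\<lambda>x y. coef (adj y * x))\<rparr>"

lemma H_sel [simp]: "hcarrier H = V" "hzero H = 0" "hadd H = (+)" "hscale H = (*\<^sub>C)"
  "hinner H x y = coef (adj y * x)"
  by (simp_all add: H_def)

lemma hnorm_H: "x \<in> V \<Longrightarrow> hnorm H x = norm x"
  by (simp add: hnorm_def coef_self)

lemma hdist_H: "hdist H x y = (if x \<in> V \<and> y \<in> V then dist x y else 0)"
proof -
  have "x + (-1) *\<^sub>C y = x - y" using scaleC_of_real[of "-1" y] by simp
  then show ?thesis by (auto simp: hdist_def hnorm_H V_ops dist_norm)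
qed

sublocale hV: Metric_space V "hdist H"
  by unfold_locales (auto simp: hdist_H dist_commute dist_triangle)

text \<open>Allows compactness in the Hilbert space to be tested in the algebra.\<close>

lemma mtopology_V: "hV.mtopology = top_of_set V"
proof (rule topology_eq[THEN iffD2, rule_format])
  fix U
  have "(\<forall>x. x \<in> U \<longrightarrow> (\<exists>r>0. hV.mball x r \<subseteq> U)) \<longleftrightarrow> (\<forall>x\<in>U. \<exists>r>0. \<forall>y\<in>V. dist y x < r \<longrightarrow> y \<in> U)"
    if U: "U \<subseteq> V"
  proof -
    have "hV.mball x r \<subseteq> U \<longleftrightarrow> (\<forall>y\<in>V. dist y x < r \<longrightarrow> y \<in> U)" if "x \<in> U" for x r
      using that U by (auto simp: hV.mball_def hdist_H dist_commute)
    then show ?thesis by blast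
  qed
  then show "openin hV.mtopology U \<longleftrightarrow> openin (top_of_set V) U"
    unfolding hV.openin_mtopology openin_euclidean_subtopology_iff by blast
qed

lemma mcomplete_V: "hV.mcomplete"
  unfolding hV.mcomplete_def
proof (intro allI impI)
  fix \<sigma> assume \<sigma>: "hV.MCauchy \<sigma>"
  then have rng: "\<sigma> n \<in> V" for n by (auto simp: hV.MCauchy_def)
  have "Cauchy \<sigma>"
    using \<sigma> rng by (simp add: hV.MCauchy_def hdist_H Cauchy_def)
  then obtain x where x: "\<sigma> \<longlonglongrightarrow> x" using Cauchy_convergent convergent_def by blast
  have "x \<in> V" by (rule closed_sequentially[OF closed_V rng x])
  then have "limitin hV.mtopology \<sigma> x sequentially"
    using x rng by (simp add: mtopology_V limitin_subtopology)
  then show "\<exists>x. limitin hV.mtopology \<sigma> x sequentially" by blast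
qed

lemma hilbert_space_H: "hilbert_space H"
proof
  show "\<exists>y\<in>hcarrier H. hadd H x y = hzero H" if "x \<in> hcarrier H" for x
    using that V_ops(3)[OF V_ops(1), of x] by (intro bexI[of _ "- x"]) simp_all
  show "hinner H x y = cnj (hinner H y x)" for x y
    by (simp add: adj_simps flip: coef_adj)
  show "x = hzero H" if "x \<in> hcarrier H" "hinner H x x = 0" for x
    using that by (simp add: coef_self)
  show "Metric_space.mcomplete (hcarrier H) (hdist H)" using mcomplete_V by simp
  show "hscale H 1 x = x" for x using scaleC_of_real[of 1 x] by simp
qed (simp_all add: V_ops add.assoc add.commute scaleC_add_right scaleC_add_left scaleC_scaleC
    distrib_left coef_add coef_scaleC mult_scaleC_right coef_self)

section \<open>Left multiplications are compact operators on \<open>V\<close>\<close>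

definition B :: "'a set" where "B = {x \<in> V. norm x \<le> 1}"

lemma scale_to_B: "x \<in> V \<Longrightarrow> norm x \<le> t \<Longrightarrow> t > 0 \<Longrightarrow> \<exists>y\<in>B. x = t *\<^sub>R y"
  by (intro bexI[of _ "(1/t) *\<^sub>R x"]) (auto simp: B_def V_ops)

lemma compact_closure_iff_totally_bounded:
  fixes S :: "'a set"
  shows "compact (closure S) \<longleftrightarrow> (\<forall>\<epsilon>>0. \<exists>k. finite k \<and> S \<subseteq> (\<Union>x\<in>k. ball x \<epsilon>))"
proof
  assume "compact (closure S)"
  then show "\<forall>\<epsilon>>0. \<exists>k. finite k \<and> S \<subseteq> (\<Union>x\<in>k. ball x \<epsilon>)"
    unfolding compact_eq_totally_bounded using closure_subset[of S] by (meson subset_trans)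
next
  assume tb: "\<forall>\<epsilon>>0. \<exists>k. finite k \<and> S \<subseteq> (\<Union>x\<in>k. ball x \<epsilon>)"
  show "compact (closure S)"
    unfolding compact_eq_totally_bounded
  proof (intro conjI allI impI)
    show "complete (closure S)" by (simp add: complete_eq_closed)
    fix \<epsilon> :: real assume \<epsilon>: "\<epsilon> > 0"
    then obtain k where k: "finite k" "S \<subseteq> (\<Union>x\<in>k. ball x (\<epsilon>/2))" using tb half_gt_zero by blast
    have "closure S \<subseteq> (\<Union>x\<in>k. ball x \<epsilon>)"
    proof
      fix y assume "y \<in> closure S"
      then obtain s where s: "s \<in> S" "dist s y < \<epsilon>/2"
        using \<epsilon> closure_approachable half_gt_zero by blast
      then obtain x where x: "x \<in> k" "dist x s < \<epsilon>/2" using k by auto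
      have "dist x y < \<epsilon>" using dist_triangle[of x y s] s x by simp
      then show "y \<in> (\<Union>x\<in>k. ball x \<epsilon>)" using x by auto
    qed
    then show "\<exists>k. finite k \<and> closure S \<subseteq> (\<Union>x\<in>k. ball x \<epsilon>)" using k by blast
  qed
qed

lemma ideal_containing_p: "closed_ideal J \<Longrightarrow> p \<in> J \<Longrightarrow> a \<in> J"
  using simple p(3) unfolding simple_algebra_def by blast

text \<open>The elements that map the unit ball \<open>B\<close> of \<open>V\<close> to a totally
  bounded set form a closed ideal. It contains \<open>p\<close>, because \<open>p\<close> maps
  \<open>B\<close> into the disc of multiples \<open>c p\<close> with \<open>cmod c \<le> 1\<close>;
  simplicity gives the rest.\<close>

lemma compact_closure_image:
  "compact (closure ((*) a ` B))"
proof -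
  define J where "J = {a. \<forall>\<epsilon>>0. \<exists>k. finite k \<and> (\<forall>x\<in>B. \<exists>y\<in>k. dist y (a * x) < \<epsilon>)}"
  have J: "a \<in> J" if "\<And>\<epsilon>. \<epsilon> > 0 \<Longrightarrow> \<exists>k. finite k \<and> (\<forall>x\<in>B. \<exists>y\<in>k. dist y (a * x) < \<epsilon>)" for a
    using that by (simp add: J_def)
  have JD: "\<exists>k. finite k \<and> (\<forall>x\<in>B. \<exists>y\<in>k. dist y (a * x) < \<epsilon>)" if "a \<in> J" "\<epsilon> > 0" for a \<epsilon>
    using that by (simp add: J_def)
  \<comment> \<open>If a Lipschitz map \<open>L\<close> carries part of the image of
    \<open>B\<close> under \<open>a\<close> onto its image under \<open>b\<close>, it also carries
    finite nets over. This serves scalar multiples and both products.\<close>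
  have lin: "b \<in> J" if a: "a \<in> J" and ba: "\<And>x. x \<in> B \<Longrightarrow> \<exists>y\<in>B. b * x = L (a * y)"
    and L: "\<And>y z. dist (L y) (L z) \<le> C * dist y z" and C: "C > 0" for a b L C
  proof (rule J)
    fix \<epsilon> :: real assume "\<epsilon> > 0"
    then obtain k where k: "finite k" "\<forall>x\<in>B. \<exists>y\<in>k. dist y (a * x) < \<epsilon> / C" using JD[OF a, of "\<epsilon> / C"] C by auto
    have "\<exists>y\<in>L ` k. dist y (b * x) < \<epsilon>" if x: "x \<in> B" for x
    proof -
      obtain x' where x': "x' \<in> B" "b * x = L (a * x')" using ba[OF x] by blast
      obtain y where y: "y \<in> k" "dist y (a * x') < \<epsilon> / C" using k x' by blast
      have "dist (L y) (b * x) \<le> C * dist y (a * x')" unfolding x' by (rule L)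
      also have "\<dots> < \<epsilon>" using y C by (simp add: field_simps)
      finally show ?thesis using y by blast
    qed
    then show "\<exists>k. finite k \<and> (\<forall>x\<in>B. \<exists>y\<in>k. dist y (b * x) < \<epsilon>)" using k by blast
  qed
  have "closed_ideal J" unfolding closed_ideal_def
  proof (intro conjI allI ballI)
    have "closure J \<subseteq> J"
    proof
      fix a assume a: "a \<in> closure J"
      show "a \<in> J"
      proof (rule J)
        fix \<epsilon> :: real assume \<epsilon>: "\<epsilon> > 0"
        then obtain a' where a': "a' \<in> J" "dist a' a < \<epsilon> / 2" using a closure_approachable half_gt_zero by blast
        obtain k where k: "finite k" "\<forall>x\<in>B. \<exists>y\<in>k. dist y (a' * x) < \<epsilon> / 2" using JD[OF a'(1), of "\<epsilon>/2"] \<epsilon> by auto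
        have "\<exists>y\<in>k. dist y (a * x) < \<epsilon>" if x: "x \<in> B" for x
        proof -
          obtain y where y: "y \<in> k" "dist y (a' * x) < \<epsilon> / 2" using k x by blast
          have "dist (a' * x) (a * x) = norm ((a' - a) * x)" by (simp add: dist_norm left_diff_distrib)
          also have "\<dots> \<le> norm (a' - a) * 1"
            using x by (intro order_trans[OF norm_mult_ineq] mult_left_mono) (auto simp: B_def)
          finally have "dist y (a * x) < \<epsilon>"
            using dist_triangle[of y "a * x" "a' * x"] y a'(2) by (simp add: dist_norm)
          then show ?thesis using y by blast
        qed
        then show "\<exists>k. finite k \<and> (\<forall>x\<in>B. \<exists>y\<in>k. dist y (a * x) < \<epsilon>)" using k by blast
      qed
    qed
    then show "closed J" using closure_subset_eq by blast
    show "0 \<in> J" by (rule J) (intro exI[of _ "{0}"], simp)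
    show "x + y \<in> J" if xy: "x \<in> J" "y \<in> J" for x y
    proof (rule J)
      fix \<epsilon> :: real assume \<epsilon>: "\<epsilon> > 0"
      obtain k where k: "finite k" "\<forall>z\<in>B. \<exists>u\<in>k. dist u (x * z) < \<epsilon> / 2" using JD[OF xy(1), of "\<epsilon>/2"] \<epsilon> by auto
      obtain l where l: "finite l" "\<forall>z\<in>B. \<exists>u\<in>l. dist u (y * z) < \<epsilon> / 2" using JD[OF xy(2), of "\<epsilon>/2"] \<epsilon> by auto
      have "\<exists>w\<in>(\<lambda>(u, v). u + v) ` (k \<times> l). dist w ((x + y) * z) < \<epsilon>" if z: "z \<in> B" for z
      proof -
        obtain u where u: "u \<in> k" "dist u (x * z) < \<epsilon> / 2" using k z by blast
        obtain v where v: "v \<in> l" "dist v (y * z) < \<epsilon> / 2" using l z by blast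
        have "dist (u + v) ((x + y) * z) < \<epsilon>"
          using dist_triangle_add[of u v "x * z" "y * z"] u v by (simp add: distrib_right)
        moreover have "u + v \<in> (\<lambda>(u, v). u + v) ` (k \<times> l)"
          by (rule image_eqI[of _ _ "(u, v)"]) (use u v in simp_all)
        ultimately show ?thesis by (rule bexI)
      qed
      then show "\<exists>k. finite k \<and> (\<forall>z\<in>B. \<exists>w\<in>k. dist w ((x + y) * z) < \<epsilon>)"
        using k(1) l(1) by (intro exI[of _ "(\<lambda>(u, v). u + v) ` (k \<times> l)"] conjI ballI) auto
    qed
    show "c *\<^sub>C x \<in> J" if "x \<in> J" for c x
    proof (rule lin[of x _ "\<lambda>y. c *\<^sub>C y" "cmod c + 1", OF that])
      show "dist (c *\<^sub>C y) (c *\<^sub>C z) \<le> (cmod c + 1) * dist y z" for y z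
        by (simp add: dist_norm norm_scaleC distrib_right flip: scaleC_diff_right)
    qed (auto simp: mult_scaleC_left intro: add_nonneg_pos)
    fix a x assume x: "x \<in> J"
    show "a * x \<in> J"
    proof (rule lin[of x _ "\<lambda>y. a * y" "norm a + 1", OF x])
      show "dist (a * y) (a * z) \<le> (norm a + 1) * dist y z" for y z
        using norm_mult_ineq[of a "y - z"] by (simp add: dist_norm distrib_right right_diff_distrib add_increasing2)
    qed (auto simp: mult.assoc intro: add_nonneg_pos)
    show "x * a \<in> J"
    \<comment> \<open>\<open>a\<close> maps \<open>B\<close> into \<open>norm a + 1\<close> times
      \<open>B\<close>; the summand one keeps the factor positive for \<open>a = 0\<close>.\<close>
    proof (rule lin[of x _ "\<lambda>y. (norm a + 1) *\<^sub>R y" "norm a + 1", OF x])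
      show "dist ((norm a + 1) *\<^sub>R y) ((norm a + 1) *\<^sub>R z) \<le> (norm a + 1) * dist y z" for y z :: 'a
        unfolding dist_norm scaleR_diff_right[symmetric] by simp
      fix z assume z: "z \<in> B"
      have "norm (a * z) \<le> norm a * 1"
        using z by (intro order_trans[OF norm_mult_ineq] mult_left_mono) (auto simp: B_def)
      then obtain y where "y \<in> B" "a * z = (norm a + 1) *\<^sub>R y"
        using scale_to_B[of "a * z" "norm a + 1"] z by (auto simp: B_def V_ops add_nonneg_pos)
      then show "\<exists>y\<in>B. x * a * z = (norm a + 1) *\<^sub>R (x * y)" by (auto simp: mult.assoc)
    qed (auto intro: add_nonneg_pos)
  qed
  moreover have "p \<in> J"
  proof (rule J)
    fix \<epsilon> :: real assume \<epsilon>: "\<epsilon> > 0"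
    have "continuous_on (cball 0 1) (\<lambda>c. c *\<^sub>C p)"
    proof (rule continuous_onI)
      fix c :: complex and \<delta> :: real assume "\<delta> > 0"
      have "dist (c' *\<^sub>C p) (c *\<^sub>C p) = dist c' c" for c'
      proof -
        have "c' *\<^sub>C p - c *\<^sub>C p = (c' - c) *\<^sub>C p"
          by (simp add: diff_conv_add_uminus scaleC_add_left scaleC_minus_left del: add_uminus_conv_diff)
        then show ?thesis by (simp add: dist_norm norm_scaleC norm_p)
      qed
      then show "\<exists>d>0. \<forall>c'\<in>cball 0 1. dist c' c < d \<longrightarrow> dist (c' *\<^sub>C p) (c *\<^sub>C p) \<le> \<delta>"
        using \<open>\<delta> > 0\<close> by (intro exI[of _ \<delta>]) auto
    qed
    then have "compact ((\<lambda>c. c *\<^sub>C p) ` cball 0 1)" by (rule compact_continuous_image) simp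
    then obtain k where k: "finite k" "(\<lambda>c. c *\<^sub>C p) ` cball 0 1 \<subseteq> (\<Union>x\<in>k. ball x \<epsilon>)"
      unfolding compact_eq_totally_bounded using \<epsilon> by blast
    have "\<exists>y\<in>k. dist y (p * x) < \<epsilon>" if x: "x \<in> B" for x
    proof -
      have px: "p * x = coef x *\<^sub>C p" using coef[of x] x by (simp add: B_def V_unit mult.assoc)
      have "norm (coef x *\<^sub>C p) \<le> 1 * 1" unfolding px[symmetric]
        using x norm_p by (intro order_trans[OF norm_mult_ineq] mult_mono) (auto simp: B_def)
      then have "p * x \<in> (\<lambda>c. c *\<^sub>C p) ` cball 0 1" using px by (auto simp: norm_scaleC norm_p)
      from subsetD[OF k(2) this] show ?thesis by auto
    qed
    then show "\<exists>k. finite k \<and> (\<forall>x\<in>B. \<exists>y\<in>k. dist y (p * x) < \<epsilon>)" using k by blast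
  qed
  ultimately have "a \<in> J" by (rule ideal_containing_p)
  show ?thesis unfolding compact_closure_iff_totally_bounded
  proof (intro allI impI)
    fix \<epsilon> :: real assume "\<epsilon> > 0"
    then obtain k where "finite k" "\<forall>x\<in>B. \<exists>y\<in>k. dist y (a * x) < \<epsilon>" using JD[OF \<open>a \<in> J\<close>] by blast
    then show "\<exists>k. finite k \<and> (*) a ` B \<subseteq> (\<Union>x\<in>k. ball x \<epsilon>)" by (intro exI[of _ k]) auto
  qed
qed

section \<open>The action on \<open>V\<close> is isometric\<close>

text \<open>If some \<open>rmul Y a\<close> were nonzero, primeness would give \<open>x\<close> with
  \<open>rmul Y a * x * p \<noteq> 0\<close>, although \<open>x * p\<close> lies in
  \<open>V\<close>.\<close>

lemma eq_0_if_annihilates_V: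
  assumes "\<And>x. x \<in> V \<Longrightarrow> Y * multiplier_of x = 0"
  shows "Y = 0"
proof (rule multiplier_eqI_left)
  fix b
  have "rmul Y a = 0" for a
  proof (rule ccontr)
    assume nz: "rmul Y a \<noteq> 0"
    obtain x where x: "rmul Y a * x * p \<noteq> 0" by (rule simple_algebra_prime[OF simple nz p(3)])
    have "multiplier_of (rmul Y a * (x * p)) = multiplier_of a * Y * multiplier_of (x * p)"
      by (simp only: multiplier_of_hom(2)[of "rmul Y a"] multiplier_of_ideal(2))
    also have "\<dots> = 0" using assms[OF V_ops(7)[of x]] by (simp only: mult.assoc mult_zero_right)
    finally show False using x by (simp add: mult.assoc)
  qed
  then have "a * lmul Y b = a * 0" for a by (simp flip: rmul_lmul)
  then have "lmul Y b = 0" by (rule mult_left_cancel_all)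
  then show "lmul Y b = lmul 0 b" by (simp add: lmul_ops)
qed

text \<open>Let \<open>n\<close> be the negative part of \<open>N\<^sup>2 - adj a * a\<close>.
  Testing the bound on \<open>y = n z\<close> for \<open>z\<close> in \<open>V\<close> shows that
  \<open>- n\<^sup>3\<close> is positive after conjugation by \<open>z\<close>, so
  \<open>n\<^sup>3\<close> annihilates \<open>V\<close> and \<open>n = 0\<close>.\<close>

lemma norm_le_if_bounded_on_V:
  assumes N: "0 \<le> N" and a: "\<And>x. x \<in> V \<Longrightarrow> norm (a * x) \<le> N * norm x"
  shows "norm a \<le> N"
proof -
  define b where "b = multiplier_of (adj a * a)"
  have pb: "psd b" unfolding b_def by (rule psd_multiplier_of) (auto simp: positive_def)
  have "adj (N\<^sup>2 *\<^sub>R 1 - b) = N\<^sup>2 *\<^sub>R 1 - b" by (simp add: adj_simps psd_adj[OF pb])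
  then obtain f n where fn: "psd f" "psd n" "N\<^sup>2 *\<^sub>R 1 - b = f - n" "f * n = 0" "n * f = 0"
    "\<forall>x. x * (N\<^sup>2 *\<^sub>R 1 - b) = (N\<^sup>2 *\<^sub>R 1 - b) * x \<longrightarrow> x * f = f * x \<and> x * n = n * x"
    by (rule pos_neg_parts)
  have an: "adj n = n" by (rule psd_adj[OF fn(2)])
  have pnnn: "psd (n * n * n)" by (intro psd_mult psd_square an fn(2)) (simp add: mult.assoc)
  have "n * n * n = 0"
  proof (rule eq_0_if_annihilates_V)
    fix z assume z: "z \<in> V"
    let ?z = "multiplier_of z"
    define y where "y = lmul n z"
    have yV: "y \<in> V" using z by (simp add: y_def V_def flip: lmul_mult)
    have y: "multiplier_of y = n * ?z" by (simp add: y_def multiplier_of_ideal(1))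
    have ay: "adj (multiplier_of y) = adj ?z * n" by (simp add: y adj_mult an)
    have "multiplier_of (N\<^sup>2 *\<^sub>R (adj y * y) - adj (a * y) * (a * y))
        = adj (multiplier_of y) * (N\<^sup>2 *\<^sub>R 1 - b) * multiplier_of y"
      by (simp add: b_def mult_of_simps adj_mult right_diff_distrib left_diff_distrib mult.assoc)
    also have "\<dots> = adj ?z * (n * (f - n) * n) * ?z" unfolding ay fn(3) by (simp only: y mult.assoc)
    also have "n * (f - n) * n = - (n * n * n)" by (simp add: right_diff_distrib left_diff_distrib fn(5))
    finally have eq: "multiplier_of (N\<^sup>2 *\<^sub>R (adj y * y) - adj (a * y) * (a * y))
        = - (adj ?z * (n * n * n) * ?z)" by simp
    have "N\<^sup>2 *\<^sub>R (adj y * y) - adj (a * y) * (a * y) = (N\<^sup>2 * (norm y)\<^sup>2 - (norm (a * y))\<^sup>2) *\<^sub>R p"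
      unfolding inner_self_V[OF yV] inner_self_V[OF V_ops(6)[OF yV]] by (simp add: scaleR_diff_left)
    moreover have "(norm (a * y))\<^sup>2 \<le> N\<^sup>2 * (norm y)\<^sup>2"
      using power_mono[OF a[OF yV], of 2] by (simp add: power_mult_distrib)
    moreover have "psd (multiplier_of p)" by (rule psd_multiplier_of[OF projection_positive]) (simp add: projection_def p)
    ultimately have "psd (- (adj ?z * (n * n * n) * ?z))"
      unfolding eq[symmetric] by (simp add: mult_of_simps psd_scaleR)
    then have "adj ?z * (n * n * n) * ?z = 0" using psd_conj[OF pnnn] psd_antisym by blast
    then show "n * n * n * ?z = 0" by (rule mult_eq_0_if_conj_eq_0[OF pnnn])
  qed
  then have "n * n * (n * n) = 0" by (simp add: mult.assoc)
  then have "n * n = 0" by (rule selfadjoint_square_eq_0[rotated]) (simp add: adj_mult an)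
  then have "n = 0" by (rule selfadjoint_square_eq_0[OF an])
  then have "psd (N\<^sup>2 *\<^sub>R 1 - b)" unfolding fn(3) using fn(1) by simp
  from selfadjoint_le_norm[OF pb this] have "norm b \<le> N\<^sup>2" by simp
  then have "(norm a)\<^sup>2 \<le> N\<^sup>2" unfolding b_def norm_multiplier_of norm_adj_mult_self .
  then show ?thesis using N by (rule power2_le_imp_le)
qed

lemma scaleR_p_eq_iff: "r *\<^sub>R p = s *\<^sub>R p \<longleftrightarrow> r = s"
  using p(3) by simp

section \<open>Riesz representation on \<open>V\<close>\<close>

lemma parallelogram_V:
  assumes "x \<in> V" "y \<in> V"
  shows "(norm (x + y))\<^sup>2 + (norm (x - y))\<^sup>2 = 2 * (norm x)\<^sup>2 + 2 * (norm y)\<^sup>2"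
proof -
  have "adj (x + y) * (x + y) + adj (x - y) * (x - y) = 2 *\<^sub>R (adj x * x) + 2 *\<^sub>R (adj y * y)"
    by (simp add: adj_simps algebra_simps scaleR_2)
  then have "((norm (x + y))\<^sup>2 + (norm (x - y))\<^sup>2) *\<^sub>R p = (2 * (norm x)\<^sup>2 + 2 * (norm y)\<^sup>2) *\<^sub>R p"
    by (simp only: inner_self_V assms V_ops(2,3) scaleR_add_left scaleR_scaleR)
  then show ?thesis by (simp only: scaleR_p_eq_iff)
qed

lemma minimizer_in_hyperplane:
  fixes f :: "'a \<Rightarrow> complex"
  assumes add: "\<And>x y. x \<in> V \<Longrightarrow> y \<in> V \<Longrightarrow> f (x + y) = f x + f y"
    and scale: "\<And>c x. x \<in> V \<Longrightarrow> f (c *\<^sub>C x) = c * f x"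
    and bound: "\<And>x. x \<in> V \<Longrightarrow> cmod (f x) \<le> M * norm x"
    and x0: "x0 \<in> V" "f x0 = 1"
  shows "\<exists>w\<in>V. f w = 1 \<and> (\<forall>x\<in>V. f x = 1 \<longrightarrow> (norm w)\<^sup>2 \<le> (norm x)\<^sup>2)"
proof -
  define D where "D = (\<lambda>x. (norm x)\<^sup>2) ` {x \<in> V. f x = 1}"
  define \<delta> where "\<delta> = Inf D"
  have D: "D \<noteq> {}" "bdd_below D" using x0 by (auto simp: D_def intro!: bdd_belowI[of _ 0])
  have lower: "\<delta> \<le> (norm x)\<^sup>2" if "x \<in> V" "f x = 1" for x
    unfolding \<delta>_def using that D by (intro cInf_lower) (auto simp: D_def)
  have "\<exists>x. x \<in> V \<and> f x = 1 \<and> (norm x)\<^sup>2 < \<delta> + \<epsilon>" if "\<epsilon> > 0" for \<epsilon>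
    using cInf_lessD[OF D(1), of "\<delta> + \<epsilon>"] that by (auto simp: \<delta>_def D_def)
  then have "\<forall>n. \<exists>x. x \<in> V \<and> f x = 1 \<and> (norm x)\<^sup>2 < \<delta> + inverse (real (Suc n))" by simp
  then obtain x where x: "\<And>n. x n \<in> V" "\<And>n. f (x n) = 1" "\<And>n. (norm (x n))\<^sup>2 < \<delta> + inverse (real (Suc n))"
    by metis
  have fR: "f (r *\<^sub>R y) = r * f y" if "y \<in> V" for r y
    using scale[OF that, of "of_real r"] by (simp add: scaleC_of_real)
  have fdiff: "f (y - z) = f y - f z" if "y \<in> V" "z \<in> V" for y z
    using add[OF that(1), of "(-1) *\<^sub>R z"] fR[OF that(2), of "-1"]
      V_ops(5)[OF that(2), of "-1"] by simp
  have close: "(norm (x m - x n))\<^sup>2 \<le> 4 * inverse (real (Suc N))" if mn: "m \<ge> N" "n \<ge> N" for m n N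
  proof -
    \<comment> \<open>The midpoint of two nearly minimal points is again in the hyperplane, so the
      parallelogram law bounds their distance.\<close>
    define z where "z = (1/2) *\<^sub>R (x m + x n)"
    have "z \<in> V" "f z = 1" using x by (simp_all add: z_def fR add V_ops)
    then have "\<delta> \<le> (norm z)\<^sup>2" by (rule lower)
    also have "(norm z)\<^sup>2 = (norm (x m + x n))\<^sup>2 / 4" by (simp add: z_def power_divide)
    finally have "4 * \<delta> \<le> (norm (x m + x n))\<^sup>2" by simp
    moreover have "inverse (real (Suc m)) \<le> inverse (real (Suc N))" "inverse (real (Suc n)) \<le> inverse (real (Suc N))"
      using mn by (simp_all add: le_imp_inverse_le)
    ultimately show ?thesis
      using parallelogram_V[OF x(1)[of m] x(1)[of n]] x(3)[of m] x(3)[of n] by linarith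
  qed
  have "Cauchy x"
  proof (rule metric_CauchyI)
    fix \<epsilon> :: real assume \<epsilon>: "\<epsilon> > 0"
    obtain N where N: "inverse (real (Suc N)) < \<epsilon>\<^sup>2 / 4" using reals_Archimedean[of "\<epsilon>\<^sup>2 / 4"] \<epsilon> by auto
    have "dist (x m) (x n) < \<epsilon>" if mn: "m \<ge> N" "n \<ge> N" for m n
    proof -
      have "(norm (x m - x n))\<^sup>2 < \<epsilon>\<^sup>2" using close[OF mn] N by linarith
      then show ?thesis unfolding dist_norm using \<epsilon> by (intro power2_less_imp_less[of _ \<epsilon>]) simp_all
    qed
    then show "\<exists>M. \<forall>m\<ge>M. \<forall>n\<ge>M. dist (x m) (x n) < \<epsilon>" by blast
  qed
  then obtain w where w: "x \<longlonglongrightarrow> w" using Cauchy_convergent convergent_def by blast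
  have wV: "w \<in> V" by (rule closed_sequentially[OF closed_V x(1) w])
  have "(\<lambda>n. M * norm (x n - w)) \<longlonglongrightarrow> M * 0"
    by (intro tendsto_mult tendsto_const tendsto_norm_zero LIM_zero w)
  then have "(\<lambda>n. M * norm (x n - w)) \<longlonglongrightarrow> 0" by simp
  moreover have "cmod (1 - f w) \<le> M * norm (x n - w)" for n
    using bound[of "x n - w"] x[of n] wV by (simp add: V_ops fdiff)
  ultimately have "cmod (1 - f w) \<le> 0"
    by (intro LIMSEQ_le_const[of _ 0]) auto
  then have "f w = 1" by simp
  moreover have "(norm w)\<^sup>2 \<le> \<delta>"
  proof (rule LIMSEQ_le)
    show "(\<lambda>n. (norm (x n))\<^sup>2) \<longlonglongrightarrow> (norm w)\<^sup>2" by (intro tendsto_intros w)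
    show "(\<lambda>n. \<delta> + inverse (real (Suc n))) \<longlonglongrightarrow> \<delta>"
      using tendsto_add[OF tendsto_const LIMSEQ_inverse_real_of_nat, of \<delta>] by simp
    show "\<exists>N. \<forall>n\<ge>N. (norm (x n))\<^sup>2 \<le> \<delta> + inverse (real (Suc n))"
      using x(3) less_imp_le by blast
  qed
  ultimately show ?thesis using wV lower order_trans by blast
qed

text \<open>The functional appears as left multiplication by an element, which is the form needed
  for representing operators. The minimiser \<open>w\<close> in the hyperplane \<open>f = 1\<close>
  is orthogonal to the kernel of \<open>f\<close>; evaluating at \<open>x - f x *\<^sub>C w\<close>
  then yields \<open>adj w\<close> up to the factor \<open>1 / N\<close>.\<close>

lemma riesz_representation:
  fixes f :: "'a \<Rightarrow> complex"
  assumes add: "\<And>x y. x \<in> V \<Longrightarrow> y \<in> V \<Longrightarrow> f (x + y) = f x + f y"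
    and scale: "\<And>c x. x \<in> V \<Longrightarrow> f (c *\<^sub>C x) = c * f x"
    and bound: "\<And>x. x \<in> V \<Longrightarrow> cmod (f x) \<le> M * norm x"
  shows "\<exists>w. \<forall>x\<in>V. w * x = f x *\<^sub>C p"
proof (cases "\<forall>x\<in>V. f x = 0")
  case True
  then show ?thesis using scaleC_of_real[of 0 p] by (intro exI[of _ 0]) simp
next
  case False
  then obtain x1 where x1: "x1 \<in> V" "f x1 \<noteq> 0" by blast
  then have "(1 / f x1) *\<^sub>C x1 \<in> V" "f ((1 / f x1) *\<^sub>C x1) = 1" by (simp_all add: V_ops scale)
  from minimizer_in_hyperplane[OF add scale bound this]
  obtain w where w: "w \<in> V" "f w = 1" "\<And>x. x \<in> V \<Longrightarrow> f x = 1 \<Longrightarrow> (norm w)\<^sup>2 \<le> (norm x)\<^sup>2" by blast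
  have fdiff: "f (y - z) = f y - f z" if "y \<in> V" "z \<in> V" for y z
    using add[OF that(1), of "(-1) *\<^sub>C z"] scale[OF that(2), of "-1"] V_ops(4)[OF that(2), of "-1"]
      scaleC_of_real[of "-1" z] by simp
  have orth: "adj w * k = 0" if k: "k \<in> V" "f k = 0" for k
  proof -
    define c where "c = coef (adj w * k)"
    have wk: "adj w * k = c *\<^sub>C p" unfolding c_def by (rule inner_V[OF k(1) w(1)])
    have "adj k * w = adj (adj w * k)" by (simp add: adj_simps)
    then have kw: "adj k * w = cnj c *\<^sub>C p" unfolding wk by (simp add: adj_scaleC p)
    \<comment> \<open>Moving from \<open>w\<close> by \<open>t k\<close> with
      \<open>t = s cnj c\<close> changes the squared norm by
      \<open>- 2 s |c|\<^sup>2 + s\<^sup>2 |c|\<^sup>2 (norm k)\<^sup>2\<close>, negative for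
      \<open>c \<noteq> 0\<close> since \<open>s (norm k)\<^sup>2 < 1\<close>. The summand one
      avoids division by zero.\<close>
    define s where "s = 1 / ((norm k)\<^sup>2 + 1)"
    have pos: "(norm k)\<^sup>2 + 1 > 0" by (rule add_nonneg_pos) simp_all
    have s: "s > 0" "s * (norm k)\<^sup>2 < 1" using pos by (simp_all add: s_def)
    define t where "t = of_real s * cnj c"
    define y where "y = w - t *\<^sub>C k"
    have yV: "y \<in> V" "f y = 1" using k w by (simp_all add: y_def V_ops fdiff scale)
    have "adj y * y = adj w * w - t *\<^sub>C (adj w * k) - cnj t *\<^sub>C (adj k * w) + (cnj t * t) *\<^sub>C (adj k * k)"
      by (simp add: y_def adj_simps right_diff_distrib left_diff_distrib mult_scaleC_left mult_scaleC_right scaleC_scaleC scaleC_diff_right mult.commute[of t])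
    also have "\<dots> = (of_real ((norm w)\<^sup>2) - t * c - cnj t * cnj c + cnj t * t * of_real ((norm k)\<^sup>2)) *\<^sub>C p"
      unfolding wk kw inner_self_V[OF w(1)] inner_self_V[OF k(1)]
      by (simp add: scaleC_of_real[symmetric] scaleC_scaleC scaleC_add_left diff_conv_add_uminus scaleC_minus_left
          del: add_uminus_conv_diff)
    finally have "of_real ((norm y)\<^sup>2) *\<^sub>C p = (of_real ((norm w)\<^sup>2) - t * c - cnj t * cnj c + cnj t * t * of_real ((norm k)\<^sup>2)) *\<^sub>C p"
      unfolding inner_self_V[OF yV(1)] by (simp only: scaleC_of_real)
    then have eq: "complex_of_real ((norm y)\<^sup>2) = of_real ((norm w)\<^sup>2) - t * c - cnj t * cnj c + cnj t * t * of_real ((norm k)\<^sup>2)"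
      by (simp only: scaleC_p_eq_iff)
    have "t * c = of_real (s * (cmod c)\<^sup>2)" "cnj t * cnj c = of_real (s * (cmod c)\<^sup>2)"
      "cnj t * t = of_real (s * s * (cmod c)\<^sup>2)"
      unfolding of_real_mult complex_norm_square by (simp_all add: t_def)
    then have "complex_of_real ((norm y)\<^sup>2) = of_real ((norm w)\<^sup>2 - s * (cmod c)\<^sup>2 - s * (cmod c)\<^sup>2 + s * s * (cmod c)\<^sup>2 * (norm k)\<^sup>2)"
      unfolding eq by simp
    then have "(norm y)\<^sup>2 = (norm w)\<^sup>2 - s * (cmod c)\<^sup>2 - s * (cmod c)\<^sup>2 + s * s * (cmod c)\<^sup>2 * (norm k)\<^sup>2"
      by (simp only: of_real_eq_iff)
    with w(3)[OF yV] have "s * (2 * (cmod c)\<^sup>2) \<le> s * ((s * (norm k)\<^sup>2) * (cmod c)\<^sup>2)"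
      by (simp add: algebra_simps)
    then have "2 * (cmod c)\<^sup>2 \<le> (s * (norm k)\<^sup>2) * (cmod c)\<^sup>2" using s(1) by (rule mult_left_le_imp_le)
    also have "\<dots> \<le> 1 * (cmod c)\<^sup>2" using s by (intro mult_right_mono) simp_all
    finally have "(cmod c)\<^sup>2 \<le> 0" by simp
    then have "c = 0" by simp
    then show ?thesis unfolding wk using scaleC_of_real[of 0 p] by simp
  qed
  define N where "N = (norm w)\<^sup>2"
  have "w \<noteq> 0" using w(2) fdiff[OF w(1) w(1)] by auto
  then have N: "N \<noteq> 0" by (simp add: N_def)
  have "((1 / N) *\<^sub>R adj w) * x = f x *\<^sub>C p" if x: "x \<in> V" for x
  proof -
    have "adj w * (x - f x *\<^sub>C w) = 0" using x w by (intro orth) (simp_all add: V_ops fdiff scale)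
    then have "adj w * x = f x *\<^sub>C (N *\<^sub>R p)"
      by (simp add: right_diff_distrib mult_scaleC_right inner_self_V[OF w(1)] N_def)
    then show ?thesis using N by (simp add: scaleC_scaleR)
  qed
  then show ?thesis by blast
qed

section \<open>Compact operators on \<open>V\<close> are left multiplications\<close>

definition bounded_operator :: "('a \<Rightarrow> 'a) \<Rightarrow> real \<Rightarrow> bool" where
  "bounded_operator T M \<longleftrightarrow> (\<forall>x\<in>V. T x \<in> V \<and> norm (T x) \<le> M * norm x) \<and>
     (\<forall>x\<in>V. \<forall>y\<in>V. T (x + y) = T x + T y) \<and> (\<forall>c. \<forall>x\<in>V. T (c *\<^sub>C x) = c *\<^sub>C T x)"

text \<open>Again an ideal argument. For \<open>p\<close> the map \<open>x \<mapsto> p * T x\<close>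
  is a functional times \<open>p\<close>, represented by Riesz; under limits the representing
  elements converge because the action on \<open>V\<close> is isometric.\<close>

lemma represented_after_multiplication:
  assumes "bounded_operator T M" "M \<ge> 0"
  shows "\<exists>b. \<forall>x\<in>V. a * T x = b * x"
proof -
  \<comment> \<open>\<open>T\<close> is quantified inside \<open>J\<close>, since closure under
    \<open>a * z\<close> applies the property of \<open>a\<close> to the operator
    \<open>x \<mapsto> z * T x\<close>.\<close>
  define J where "J = {a. \<forall>T M. bounded_operator T M \<longrightarrow> M \<ge> 0 \<longrightarrow> (\<exists>b. \<forall>x\<in>V. a * T x = b * x)}"
  have J: "a \<in> J" if "\<And>T M. bounded_operator T M \<Longrightarrow> M \<ge> 0 \<Longrightarrow> \<exists>b. \<forall>x\<in>V. a * T x = b * x" for a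
    using that by (simp add: J_def)
  have JD: "\<exists>b. \<forall>x\<in>V. a * T x = b * x" if "a \<in> J" "bounded_operator T M" "M \<ge> 0" for a T M
    using that by (auto simp: J_def)
  have "closed_ideal J" unfolding closed_ideal_def
  proof (intro conjI allI ballI)
    show "closed J" unfolding closed_sequential_limits
    proof (intro allI impI, elim conjE)
      fix s a assume s: "\<forall>n. s n \<in> J" and lim: "s \<longlonglongrightarrow> a"
      show "a \<in> J"
      proof (rule J)
        fix T M assume T: "bounded_operator T M" and M: "M \<ge> 0"
        have "\<forall>n. \<exists>b. \<forall>x\<in>V. s n * T x = b * x" using JD[OF s[rule_format] T M] by blast
        then obtain b where b: "\<And>n x. x \<in> V \<Longrightarrow> s n * T x = b n * x" by metis
        have dist_b: "dist (b m) (b n) \<le> M * dist (s m) (s n)" for m n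
          unfolding dist_norm
        proof (rule norm_le_if_bounded_on_V)
          fix x assume x: "x \<in> V"
          have "(b m - b n) * x = (s m - s n) * T x" using b[OF x] by (simp add: left_diff_distrib)
          also have "norm \<dots> \<le> norm (s m - s n) * (M * norm x)"
            using T x by (intro order_trans[OF norm_mult_ineq] mult_left_mono) (auto simp: bounded_operator_def)
          finally show "norm ((b m - b n) * x) \<le> M * norm (s m - s n) * norm x" by (simp add: ac_simps)
        qed (use M in simp)
        have "Cauchy b"
        proof (rule metric_CauchyI)
          fix \<epsilon> :: real assume \<epsilon>: "\<epsilon> > 0"
          then obtain N where N: "\<forall>m\<ge>N. \<forall>n\<ge>N. dist (s m) (s n) < \<epsilon> / (M + 1)"
            using metric_CauchyD[OF LIMSEQ_imp_Cauchy[OF lim], of "\<epsilon> / (M + 1)"] M by auto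
          have "dist (b m) (b n) < \<epsilon>" if mn: "m \<ge> N" "n \<ge> N" for m n
          proof -
            have "dist (b m) (b n) \<le> (M + 1) * dist (s m) (s n)"
              by (rule order_trans[OF dist_b]) (intro mult_right_mono, simp_all)
            also have "\<dots> < \<epsilon>" using N mn M by (simp add: field_simps)
            finally show ?thesis .
          qed
          then show "\<exists>N. \<forall>m\<ge>N. \<forall>n\<ge>N. dist (b m) (b n) < \<epsilon>" by blast
        qed
        then obtain c where c: "b \<longlonglongrightarrow> c" using Cauchy_convergent convergent_def by blast
        have "a * T x = c * x" if x: "x \<in> V" for x
        proof (rule LIMSEQ_unique)
          show "(\<lambda>n. s n * T x) \<longlonglongrightarrow> a * T x" by (intro tendsto_intros lim)
          show "(\<lambda>n. s n * T x) \<longlonglongrightarrow> c * x" unfolding b[OF x] by (intro tendsto_intros c)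
        qed
        then show "\<exists>b. \<forall>x\<in>V. a * T x = b * x" by blast
      qed
    qed
    show "0 \<in> J" by (rule J) (intro exI[of _ 0], simp)
    show "a + a' \<in> J" if a: "a \<in> J" "a' \<in> J" for a a'
    proof (rule J)
      fix T M assume T: "bounded_operator T M" "M \<ge> 0"
      obtain b where "\<forall>x\<in>V. a * T x = b * x" using JD[OF a(1) T] by blast
      moreover obtain b' where "\<forall>x\<in>V. a' * T x = b' * x" using JD[OF a(2) T] by blast
      ultimately show "\<exists>b. \<forall>x\<in>V. (a + a') * T x = b * x"
        by (intro exI[of _ "b + b'"]) (simp add: distrib_right)
    qed
    show "c *\<^sub>C a \<in> J" if a: "a \<in> J" for c a
    proof (rule J)
      fix T M assume T: "bounded_operator T M" "M \<ge> 0"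
      obtain b where "\<forall>x\<in>V. a * T x = b * x" using JD[OF a T] by blast
      then show "\<exists>b. \<forall>x\<in>V. (c *\<^sub>C a) * T x = b * x"
        by (intro exI[of _ "c *\<^sub>C b"]) (simp add: mult_scaleC_left)
    qed
    fix z a assume a: "a \<in> J"
    show "z * a \<in> J"
    proof (rule J)
      fix T M assume T: "bounded_operator T M" "M \<ge> 0"
      obtain b where "\<forall>x\<in>V. a * T x = b * x" using JD[OF a T] by blast
      then show "\<exists>b. \<forall>x\<in>V. (z * a) * T x = b * x"
        by (intro exI[of _ "z * b"]) (simp add: mult.assoc)
    qed
    show "a * z \<in> J"
    proof (rule J)
      fix T M assume T: "bounded_operator T M" "M \<ge> 0"
      have "norm (z * T x) \<le> norm z * M * norm x" if "x \<in> V" for x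
        unfolding mult.assoc using T that
        by (intro order_trans[OF norm_mult_ineq] mult_left_mono) (auto simp: bounded_operator_def)
      then have "bounded_operator (\<lambda>x. z * T x) (norm z * M)"
        using T by (simp add: bounded_operator_def V_ops distrib_left mult_scaleC_right)
      from JD[OF a this] T show "\<exists>b. \<forall>x\<in>V. (a * z) * T x = b * x" by (simp add: mult.assoc)
    qed
  qed
  moreover have "p \<in> J"
  proof (rule J)
    fix T M assume T: "bounded_operator T M" "M \<ge> 0"
    have pT: "p * T x = coef (T x) *\<^sub>C p" if "x \<in> V" for x
      using coef[of "T x"] T that by (simp add: bounded_operator_def V_unit mult.assoc)
    have "cmod (coef (T x)) \<le> M * norm x" if x: "x \<in> V" for x
    proof -
      have "cmod (coef (T x)) = norm (p * T x)" by (simp add: pT[OF x] norm_scaleC norm_p)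
      also have "\<dots> \<le> norm (T x)" using norm_mult_ineq[of p "T x"] by (simp add: norm_p)
      also have "\<dots> \<le> M * norm x" using T x by (simp add: bounded_operator_def)
      finally show ?thesis .
    qed
    then have "\<exists>w. \<forall>x\<in>V. w * x = coef (T x) *\<^sub>C p"
      using T by (intro riesz_representation) (auto simp: bounded_operator_def coef_add coef_scaleC)
    then show "\<exists>b. \<forall>x\<in>V. p * T x = b * x" using pT by metis
  qed
  ultimately have "a \<in> J" by (rule ideal_containing_p)
  then show ?thesis using JD assms by blast
qed

lemma compact_operators_H_iff:
  "T \<in> compact_operators H \<longleftrightarrow> T \<in> V \<rightarrow>\<^sub>E V \<and> (\<forall>x\<in>V. \<forall>y\<in>V. T (x + y) = T x + T y) \<and>
     (\<forall>c. \<forall>x\<in>V. T (c *\<^sub>C x) = c *\<^sub>C T x) \<and> compact (closure (T ` B))"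
proof -
  have "{x \<in> hcarrier H. hnorm H x \<le> 1} = B" by (auto simp: B_def hnorm_H)
  moreover have "compactin (htopology H) (htopology H closure_of (T ` B)) \<longleftrightarrow> compact (closure (T ` B))"
    if T: "T \<in> V \<rightarrow>\<^sub>E V"
  proof -
    have sub: "T ` B \<subseteq> V" using T by (auto simp: B_def)
    then have clos: "closure (T ` B) \<subseteq> V" by (rule closure_minimal[OF _ closed_V])
    have "htopology H = top_of_set V" using mtopology_V by simp
    moreover have "top_of_set V closure_of (T ` B) = closure (T ` B)"
      using sub clos by (simp add: closure_of_subtopology Int_absorb1)
    ultimately show ?thesis using clos by (simp add: compactin_subtopology)
  qed
  ultimately show ?thesis unfolding compact_operators_def by auto
qed

text \<open>Each \<open>e n\<close> after \<open>T\<close> is left multiplication by some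
  \<open>b n\<close>. As \<open>T\<close> maps \<open>B\<close> to a totally bounded set,
  \<open>e n * T x\<close> tends to \<open>T x\<close> uniformly on \<open>B\<close>; by isometry
  the \<open>b n\<close> are Cauchy, and their limit represents \<open>T\<close>.\<close>

lemma compact_operator_represented:
  assumes e: "approximate_identity (e :: nat \<Rightarrow> 'a)" and T: "T \<in> compact_operators H"
  shows "\<exists>b. \<forall>x\<in>V. T x = b * x"
proof -
  have TV: "T x \<in> V" if "x \<in> V" for x using T that by (auto simp: compact_operators_H_iff)
  have Tadd: "T (x + y) = T x + T y" if "x \<in> V" "y \<in> V" for x y using T that by (auto simp: compact_operators_H_iff)
  have TC: "T (c *\<^sub>C x) = c *\<^sub>C T x" if "x \<in> V" for c x using T that by (auto simp: compact_operators_H_iff)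
  have TR: "T (r *\<^sub>R x) = r *\<^sub>R T x" if "x \<in> V" for r x using TC[OF that, of "of_real r"] by (simp add: scaleC_of_real)
  have T0: "T 0 = 0" using TR[OF V_ops(1), of 0] by simp
  have tb: "\<forall>\<epsilon>>0. \<exists>k. finite k \<and> T ` B \<subseteq> (\<Union>x\<in>k. ball x \<epsilon>)" and cpt: "compact (closure (T ` B))"
    using T by (simp_all add: compact_operators_H_iff flip: compact_closure_iff_totally_bounded)
  \<comment> \<open>Kept general in \<open>G\<close> for two uses: the identity gives boundedness of
    \<open>T\<close>, and multiplication by \<open>e m - e n\<close> gives the Cauchy
    estimate.\<close>
  have scaled: "norm (G (T x)) \<le> C * norm x"
    if G: "\<And>r y. G (r *\<^sub>R y) = r *\<^sub>R G y" and C: "\<And>x. x \<in> B \<Longrightarrow> norm (G (T x)) \<le> C" and x: "x \<in> V" for G :: "'a \<Rightarrow> 'a" and C x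
  proof (cases "x = 0")
    case True
    then show ?thesis using G[of 0 0] by (simp add: T0)
  next
    case False
    then obtain y where y: "y \<in> B" "x = norm x *\<^sub>R y" using scale_to_B[OF x order_refl] by auto
    then have "T x = norm x *\<^sub>R T y" using TR[of y "norm x"] by (simp add: B_def)
    then show ?thesis using mult_left_mono[OF C[OF y(1)] norm_ge_zero[of x]] by (simp add: G mult.commute)
  qed
  have "bounded (T ` B)" by (rule bounded_subset[OF compact_imp_bounded[OF cpt] closure_subset])
  then obtain M where M: "\<And>x. x \<in> B \<Longrightarrow> norm (T x) \<le> M" unfolding bounded_iff by blast
  have M0: "M \<ge> 0" using M[of 0] by (simp add: B_def V_ops T0)
  have bop: "bounded_operator T M"
    using TV Tadd TC scaled[of "\<lambda>x. x"] M by (auto simp: bounded_operator_def)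
  have "\<forall>n. \<exists>b. \<forall>x\<in>V. e n * T x = b * x" using represented_after_multiplication[OF bop M0] by blast
  then obtain b where b: "\<And>n x. x \<in> V \<Longrightarrow> e n * T x = b n * x" by metis
  have unif: "\<exists>N. \<forall>n\<ge>N. \<forall>x\<in>B. norm (e n * T x - T x) \<le> \<epsilon>" if \<epsilon>: "\<epsilon> > 0" for \<epsilon>
  proof -
    have "\<epsilon>/3 > 0" using \<epsilon> by simp
    then obtain k where k: "finite k" "T ` B \<subseteq> (\<Union>x\<in>k. ball x (\<epsilon>/3))" using tb by blast
    have "\<forall>\<^sub>F n in sequentially. \<forall>y\<in>k. norm (e n * y - y) < \<epsilon>/3"
      unfolding eventually_ball_finite_distrib[OF k(1)]
    proof
      fix y
      show "\<forall>\<^sub>F n in sequentially. norm (e n * y - y) < \<epsilon>/3"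
        using tendstoD[OF approximate_identity_tendsto(1)[OF e, of y], of "\<epsilon>/3"] \<epsilon> by (simp add: dist_norm)
    qed
    then obtain N where N: "\<And>n y. n \<ge> N \<Longrightarrow> y \<in> k \<Longrightarrow> norm (e n * y - y) < \<epsilon>/3"
      unfolding eventually_sequentially by blast
    have "norm (e n * T x - T x) \<le> \<epsilon>" if n: "n \<ge> N" and x: "x \<in> B" for n x
    proof -
      obtain y where y: "y \<in> k" "norm (T x - y) < \<epsilon>/3" using k(2) x by (force simp: dist_norm norm_minus_commute)
      have "norm (e n * (T x - y)) \<le> 1 * norm (T x - y)"
        by (rule order_trans[OF norm_mult_ineq]) (intro mult_right_mono approximate_identity_tendsto(3)[OF e] norm_ge_zero)
      then have "norm (e n * (T x - y)) \<le> \<epsilon>/3" using y by simp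
      moreover have "e n * T x - T x = (e n * (T x - y) + (e n * y - y)) - (T x - y)" by (simp add: right_diff_distrib)
      ultimately show ?thesis
        using norm_triangle_ineq4[of "e n * (T x - y) + (e n * y - y)" "T x - y"]
          norm_triangle_ineq[of "e n * (T x - y)" "e n * y - y"] N[OF n y(1)] y(2) by simp
    qed
    then show ?thesis by blast
  qed
  have "Cauchy b"
  proof (rule metric_CauchyI)
    fix \<epsilon> :: real assume \<epsilon>: "\<epsilon> > 0"
    then obtain N where N: "\<And>n x. n \<ge> N \<Longrightarrow> x \<in> B \<Longrightarrow> norm (e n * T x - T x) \<le> \<epsilon>/3"
      using unif[of "\<epsilon>/3"] by auto
    have "dist (b m) (b n) < \<epsilon>" if mn: "m \<ge> N" "n \<ge> N" for m n
    proof -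
      have "norm (b m - b n) \<le> \<epsilon>/3 + \<epsilon>/3"
      proof (rule norm_le_if_bounded_on_V)
        fix x assume x: "x \<in> V"
        have "norm ((e m - e n) * T x) \<le> (\<epsilon>/3 + \<epsilon>/3) * norm x"
        proof (rule scaled[OF _ _ x])
          fix x assume x: "x \<in> B"
          have "(e m - e n) * T x = (e m * T x - T x) - (e n * T x - T x)" by (simp add: left_diff_distrib)
          then show "norm ((e m - e n) * T x) \<le> \<epsilon>/3 + \<epsilon>/3"
            using norm_triangle_ineq4[of "e m * T x - T x" "e n * T x - T x"] N[OF mn(1) x] N[OF mn(2) x]
            by simp
        qed simp
        then show "norm ((b m - b n) * x) \<le> (\<epsilon>/3 + \<epsilon>/3) * norm x" using b[OF x] by (simp add: left_diff_distrib)
      qed (use \<epsilon> in simp)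
      then show ?thesis using \<epsilon> by (simp add: dist_norm)
    qed
    then show "\<exists>N. \<forall>m\<ge>N. \<forall>n\<ge>N. dist (b m) (b n) < \<epsilon>" by blast
  qed
  then obtain c where c: "b \<longlonglongrightarrow> c" using Cauchy_convergent convergent_def by blast
  have "T x = c * x" if x: "x \<in> V" for x
  proof (rule LIMSEQ_unique)
    show "(\<lambda>n. e n * T x) \<longlonglongrightarrow> T x" by (rule approximate_identity_tendsto(1)[OF e])
    show "(\<lambda>n. e n * T x) \<longlonglongrightarrow> c * x" unfolding b[OF x] by (intro tendsto_intros c)
  qed
  then show ?thesis by blast
qed

lemma elementary_if_approximate_identity:
  assumes e: "approximate_identity (e :: nat \<Rightarrow> 'a)"
  shows "elementary TYPE('a)"
proof (rule elementaryI[OF hilbert_space_H])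
  define \<phi> where "\<phi> a = (\<lambda>x\<in>V. a * x)" for a
  have "bij_betw \<phi> UNIV (compact_operators H)"
    unfolding bij_betw_def
  proof
    show "inj \<phi>"
    proof (rule injI)
      fix a b assume eq: "\<phi> a = \<phi> b"
      have "a * x = b * x" if "x \<in> V" for x using fun_cong[OF eq, of x] that by (simp add: \<phi>_def)
      then have "norm (a - b) \<le> 0"
        by (intro norm_le_if_bounded_on_V[OF order_refl]) (simp add: left_diff_distrib)
      then show "a = b" by simp
    qed
    show "range \<phi> = compact_operators H"
    proof
      show "range \<phi> \<subseteq> compact_operators H"
      proof (rule image_subsetI)
        fix a
        have "\<phi> a ` B = (*) a ` B" by (rule image_cong) (simp_all add: \<phi>_def B_def)
        then show "\<phi> a \<in> compact_operators H"
          using compact_closure_image[of a]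
          by (simp add: compact_operators_H_iff) (simp add: \<phi>_def V_ops distrib_left mult_scaleC_right)
      qed
      show "compact_operators H \<subseteq> range \<phi>"
      proof
        fix T assume T: "T \<in> compact_operators H"
        then obtain b where b: "\<forall>x\<in>V. T x = b * x" using compact_operator_represented[OF e] by blast
        have "T = \<phi> b"
        proof
          show "T x = \<phi> b x" for x
            using T b by (cases "x \<in> V") (auto simp: \<phi>_def compact_operators_H_iff PiE_def extensional_def)
        qed
        then show "T \<in> range \<phi>" by blast
      qed
    qed
  qed
  then show "compact_operators_iso H \<phi>"
    by (simp add: compact_operators_iso_def \<phi>_def V_ops distrib_right mult_scaleC_left mult.assoc adj_mult)
qed

end

theorem corollary3p15:
  fixes e :: "nat \<Rightarrow> 'a::cstar_algebra"
  assumes "simple_algebra TYPE('a)"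
    and "sigma_unital TYPE('a)"
    and "\<not> unital TYPE('a)"
    and "\<not> elementary TYPE('a)"
    and "approximate_identity e"
    and "separable_space (euclidean :: 'a topology)
         \<or> cuntz_semigroup_order_separable TYPE('a)
         \<or> (property_SP TYPE('a) \<and> dimension_semigroup_order_separable TYPE('a))
         \<or> continuous_scale TYPE('a)"
  shows "multiplier_of ` {a. positive a} \<noteq> closure (K_o e)"
proof -
  have "\<nexists>p::'a. minimal_projection p"
    using simple_minimal_projection.elementary_if_approximate_identity[OF _ assms(5)] assms(1,4)
    by (auto simp: simple_minimal_projection_def)
  moreover have "cuntz_semigroup_order_separable TYPE('a)"
    using assms(1,6) order_separable_if_separable order_separable_if_SP order_separable_if_continuous_scale
    by (auto simp: simple_algebra_def)
  ultimately obtain X where X: "X \<in> K_o e" "X \<notin> range multiplier_of"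
    by (rule exists_multiplier_in_K_o[OF assms(1,5)])
  then have "X \<in> closure (K_o e)" using closure_subset by blast
  then show ?thesis using X(2) by blast
qed

end
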